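(* Let the problem data $f^{(1)},f^{(2)},g^{(1)},g^{(2)}$ satisfy the Basic Assumption, and suppose that $\sigma_k\searrow0$ and $\sum_{k\in\mathbb N}\sigma_k=\infty$. Then the following hold for the iterates generated by the algorithm adaBiM (assumption and algorithm are described in the context). (i) For all $k\ge1$, $$\alpha_k\ge\alpha_{\min}:=\frac{1}{2L_{f_0,\mathcal V}}\min\bigl\{\sqrt{1-\nu},\ \sqrt3\,\eta\nu\bigr\}.$$ Here $L_{f_0,\mathcal V}$ is a Lipschitz modulus for $\nabla f_0=\sigma_0\nabla f^{(1)}+\nabla f^{(2)}$ on the bounded set $\mathcal V:=\operatorname{conv}\{x_k: k\in\mathbb N\}+B\bigl(0;\tfrac{1-\eta}{\eta}r\bigr)$, where $r:=\max_{k\in\mathbb N}\|x_{k+1}-x_k\|$ and $B(0;\rho)$ is the Euclidean ball of radius $\rho$ centered at $0$. (ii) The following worst-case rates hold: $$\min_{k\le K}\|x_{k+1}-x_k\|^2\le\frac{\alpha_{\max}\,\bar\varphi_0(x_0)}{(1-\nu)(1+K)}$$ and $$\min_{k\le K}\operatorname{dist}^2\bigl(0,\partial\varphi_k(x_{k+1})\bigr)\le\frac{\alpha_{\max}}{\alpha_{\min}}\,\frac{M_{\max}^2\,\bar\varphi_0(x_0)}{(1-\nu)(1+K)},$$ where $M_{\max}=1+\alpha_{\max}L_{f_0,\mathcal V}$ and $\bar\varphi_0:=\sigma_0(\varphi^{(1)}-\bar\phi^{(1)})+\varphi^{(2)}-\bar\phi^{(2)}$. (iii) ($(x_k)_{k\in\mathbb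 N}$ is bounded and) $(\operatorname{dist}(x_k,\mathcal X_\star))_{k\in\mathbb N}$ converges to zero.
   Context: Bilevel problem: minimize $\varphi^{(1)}(x)=f^{(1)}(x)+g^{(1)}(x)$ over $x\in\mathcal X^{(2)}=\operatorname{argmin}_{w\in\mathbb R^n}\varphi^{(2)}(w)$, where $\varphi^{(2)}=f^{(2)}+g^{(2)}$. Basic Assumption: (1) $f^{(1)},f^{(2)}:\mathbb R^n\to\mathbb R$ are convex and have locally Lipschitz-continuous gradients; (2) $g^{(1)},g^{(2)}:\mathbb R^n\to\mathbb R\cup\{\infty\}$ are proper, lower semicontinuous and convex, with easy to compute proximal mappings; (3) $\bar\phi^{(1)}:=\inf_{x\in\operatorname{dom}\varphi^{(2)}}\varphi^{(1)}(x)>-\infty$; (4) the solution set $\mathcal X_\star:=\operatorname{argmin}\{\varphi^{(1)}(x): x\in\mathcal X^{(2)}\}$ is nonempty and bounded; in particular $\bar\phi^{(2)}:=\inf_{\mathbb R^n}\varphi^{(2)}>-\infty$. Notation: $f_k=\sigma_kf^{(1)}+f^{(2)}$, $g_k=\sigma_kg^{(1)}+g^{(2)}$, $\varphi_k=f_k+g_k$; $\operatorname{prox}_h(x)=\operatorname{argmin}_w\{h(w)+\tfrac12\|w-x\|^2\}$, $\partial$ is the convex subdifferential, $\operatorname{dom}h=\{x:h(x)<\infty\}$, $[t]_+=\max\{0,t\}$, $\operatorname{dist}(x,E)=\inf_{z\in E}\|z-x\|$, $\operatorname{conv}$ is the convex hull, the sum of sets is the Minkowski sum, $0\in\mathbb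 N$. Conventions: $0/0=0$ in the local estimates below, and otherwise $1/0=\infty$. Local estimates: $$\ell_k=\frac{\langle\nabla f_k(x_{k-1})-\nabla f_k(x_k),x_{k-1}-x_k\rangle}{\|x_{k-1}-x_k\|^2},\quad L_k=\frac{\|\nabla f_k(x_{k-1})-\nabla f_k(x_k)\|}{\|x_{k-1}-x_k\|},\quad \ell_k^{(2)}=\frac{\langle\nabla f^{(2)}(x_{k-1})-\nabla f^{(2)}(x_k),x_{k-1}-x_k\rangle}{\|x_{k-1}-x_k\|^2}.$$ Algorithm adaBiM. Inputs: $x_{-1}\in\mathbb R^n$, $\alpha_0>0$, $\sigma_{-1}=\sigma_0>0$, $\eta,\nu\in(0,1)$. Initialization: $x_0=\operatorname{prox}_{\alpha_0g_0}(x_{-1}-\alpha_0\nabla f_0(x_{-1}))$; a large constant $\alpha_{\max}\gg1/\ell_0$; $\alpha_{-1}=\alpha_0$ if $\alpha_0\ell_0\ge\tfrac12$, and $\alpha_{-1}=\alpha_0\frac{(\alpha_0\ell_0)^2}{1-(\alpha_0\ell_0)^2}$ otherwise. For $k=0,1,2,\dots$: Step 1: choose $\sigma_{k+1}\in[\tfrac34\sigma_k,\sigma_k]$ and, with $\rho_k=\frac{\sigma_k\alpha_k}{\sigma_{k-1}\alpha_{k-1}}$, let $$\widehat\alpha_{k+1}=\frac{\sigma_k}{\sigma_{k+1}}\alpha_k\min\left\{\sqrt{\tfrac{\sigma_k}{\sigma_{k-1}}(1+\rho_k)},\ \frac{\sqrt{1-4\bigl(1-\tfrac{\sigma_k}{\sigma_{k-1}}\bigr)\alpha_k\ell_k^{(2)}}}{2\sqrt{[\alpha_k^2L_k^2-\alpha_k\ell_k]_+}}\right\}$$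 (when $\alpha_k^2L_k^2-\alpha_k\ell_k\le0$ the minimum reduces to its first term). Step 2: set $x_{k+1}=\operatorname{prox}_{\alpha_{k+1}g_{k+1}}(x_k-\alpha_{k+1}\nabla f_{k+1}(x_k))$, with $\alpha_{k+1}$ the largest element of $\{\eta^i\min(\alpha_{\max},\widehat\alpha_{k+1}): i\in\mathbb N\}$ such that $\alpha_{k+1}\ell_{k+1}\le\nu$.
   Formalization: In (ii), ∂φ_k(x_{k+1}) is corrected to ∂φ_{k+1}(x_{k+1}), and this rate assumes α_max ≥ 1; the Lipschitz modulus L_{f_0,V} is also required to be at least the local estimate L_0 (between x_{-1} and x_0) and at least 1/α_max. *)

theory Defs
  imports "HOL-Analysis.Analysis"
begin

section \<open>Convex analysis for extended-real-valued functions\<close>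

definition grad :: "('a::euclidean_space \<Rightarrow> real) \<Rightarrow> 'a \<Rightarrow> 'a" where
  "grad f x = (THE D. GDERIV f x :> D)"

definition locally_Lipschitz :: "('a::metric_space \<Rightarrow> 'b::metric_space) \<Rightarrow> bool" where
  "locally_Lipschitz F \<longleftrightarrow> (\<forall>x. \<exists>u>0. \<exists>L. L-lipschitz_on (cball x u) F)"

definition ext_dom :: "('a \<Rightarrow> ereal) \<Rightarrow> 'a set" where
  "ext_dom h = {x. h x < \<infinity>}"

definition proper :: "('a \<Rightarrow> ereal) \<Rightarrow> bool" where
  "proper h \<longleftrightarrow> (\<forall>x. h x \<noteq> - \<infinity>) \<and> ext_dom h \<noteq> {}"

definition lower_semicont :: "('a::topological_space \<Rightarrow> ereal) \<Rightarrow> bool" where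
  "lower_semicont h \<longleftrightarrow> (\<forall>x. h x \<le> Liminf (at x) h)"

definition ext_convex :: "('a::real_vector \<Rightarrow> ereal) \<Rightarrow> bool" where
  "ext_convex h \<longleftrightarrow> (\<forall>x y. \<forall>u\<ge>0. \<forall>v\<ge>0. u + v = 1 \<longrightarrow>
     h (u *\<^sub>R x + v *\<^sub>R y) \<le> ereal u * h x + ereal v * h y)"

text \<open>A minimizer is required to have a value below \<open>\<infinity>\<close>: a function that is
  identically \<open>\<infinity>\<close> on \<open>S\<close> has no minimizers there.\<close>

definition argmin_set :: "('a \<Rightarrow> ereal) \<Rightarrow> 'a set \<Rightarrow> 'a set" where
  "argmin_set h S = {x \<in> S. h x < \<infinity> \<and> (\<forall>y\<in>S. h x \<le> h y)}"

definition prox :: "('a::euclidean_space \<Rightarrow> ereal) \<Rightarrow> 'a \<Rightarrow> 'a" where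
  "prox h x = arg_min (\<lambda>w. h w + ereal ((norm (w - x))\<^sup>2 / 2)) (\<lambda>_. True)"

definition subdiff :: "('a::euclidean_space \<Rightarrow> ereal) \<Rightarrow> 'a \<Rightarrow> 'a set" where
  "subdiff h x = {v. \<forall>y. h x + ereal (v \<bullet> (y - x)) \<le> h y}"

text \<open>Unlike \<^const>\<open>infdist\<close>, the distance to the empty set is \<open>\<infinity>\<close> here.\<close>

definition ext_dist :: "'a::euclidean_space \<Rightarrow> 'a set \<Rightarrow> ereal" where
  "ext_dist x E = (INF z\<in>E. ereal (norm (z - x)))"


section \<open>The bilevel problem\<close>

definition composite :: "('a \<Rightarrow> real) \<Rightarrow> ('a \<Rightarrow> ereal) \<Rightarrow> 'a \<Rightarrow> ereal" where
  "composite f g x = ereal (f x) + g x"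

definition lower_solutions :: "('a \<Rightarrow> real) \<Rightarrow> ('a \<Rightarrow> ereal) \<Rightarrow> 'a set" where
  "lower_solutions f2 g2 = argmin_set (composite f2 g2) UNIV"

definition bilevel_solutions ::
  "('a \<Rightarrow> real) \<Rightarrow> ('a \<Rightarrow> real) \<Rightarrow> ('a \<Rightarrow> ereal) \<Rightarrow> ('a \<Rightarrow> ereal) \<Rightarrow> 'a set" where
  "bilevel_solutions f1 f2 g1 g2 = argmin_set (composite f1 g1) (lower_solutions f2 g2)"

definition inf_upper ::
  "('a \<Rightarrow> real) \<Rightarrow> ('a \<Rightarrow> real) \<Rightarrow> ('a \<Rightarrow> ereal) \<Rightarrow> ('a \<Rightarrow> ereal) \<Rightarrow> ereal" where
  "inf_upper f1 f2 g1 g2 = (INF x\<in>ext_dom (composite f2 g2). composite f1 g1 x)"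

definition inf_lower :: "('a \<Rightarrow> real) \<Rightarrow> ('a \<Rightarrow> ereal) \<Rightarrow> ereal" where
  "inf_lower f2 g2 = (INF x. composite f2 g2 x)"

definition convex_loc_smooth :: "('a::euclidean_space \<Rightarrow> real) \<Rightarrow> bool" where
  "convex_loc_smooth f \<longleftrightarrow>
     convex_on UNIV f \<and> (\<forall>x. f differentiable (at x)) \<and> locally_Lipschitz (grad f)"

definition basic_assumption ::
  "('a::euclidean_space \<Rightarrow> real) \<Rightarrow> ('a \<Rightarrow> real) \<Rightarrow> ('a \<Rightarrow> ereal) \<Rightarrow> ('a \<Rightarrow> ereal) \<Rightarrow> bool" where
  "basic_assumption f1 f2 g1 g2 \<longleftrightarrow>
     convex_loc_smooth f1 \<and> convex_loc_smooth f2 \<and>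
     proper g1 \<and> lower_semicont g1 \<and> ext_convex g1 \<and>
     proper g2 \<and> lower_semicont g2 \<and> ext_convex g2 \<and>
     inf_upper f1 f2 g1 g2 > - \<infinity> \<and>
     bilevel_solutions f1 f2 g1 g2 \<noteq> {} \<and> bounded (bilevel_solutions f1 f2 g1 g2)"

text \<open>With \<open>s = \<sigma>\<^sub>k\<close> the next three functions are \<open>f\<^sub>k\<close>, \<open>g\<^sub>k\<close> and \<open>\<phi>\<^sub>k\<close>.\<close>

definition f_reg :: "('a \<Rightarrow> real) \<Rightarrow> ('a \<Rightarrow> real) \<Rightarrow> real \<Rightarrow> 'a \<Rightarrow> real" where
  "f_reg f1 f2 s x = s * f1 x + f2 x"

definition g_reg :: "('a \<Rightarrow> ereal) \<Rightarrow> ('a \<Rightarrow> ereal) \<Rightarrow> real \<Rightarrow> 'a \<Rightarrow> ereal" where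
  "g_reg g1 g2 s x = ereal s * g1 x + g2 x"

definition phi_reg ::
  "('a \<Rightarrow> real) \<Rightarrow> ('a \<Rightarrow> real) \<Rightarrow> ('a \<Rightarrow> ereal) \<Rightarrow> ('a \<Rightarrow> ereal) \<Rightarrow> real \<Rightarrow> 'a \<Rightarrow> ereal" where
  "phi_reg f1 f2 g1 g2 s = composite (f_reg f1 f2 s) (g_reg g1 g2 s)"

definition phi_bar ::
  "('a \<Rightarrow> real) \<Rightarrow> ('a \<Rightarrow> real) \<Rightarrow> ('a \<Rightarrow> ereal) \<Rightarrow> ('a \<Rightarrow> ereal) \<Rightarrow> real \<Rightarrow> 'a \<Rightarrow> ereal" where
  "phi_bar f1 f2 g1 g2 s x =
     ereal s * (composite f1 g1 x - inf_upper f1 f2 g1 g2)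
     + composite f2 g2 x - inf_lower f2 g2"


section \<open>The algorithm\<close>

text \<open>Division by zero in \<^typ>\<open>real\<close> yields \<open>0\<close>, which is the convention \<open>0/0 = 0\<close>
  for the two local estimates.\<close>

definition ell_est :: "('a::euclidean_space \<Rightarrow> real) \<Rightarrow> 'a \<Rightarrow> 'a \<Rightarrow> real" where
  "ell_est f x y = ((grad f x - grad f y) \<bullet> (x - y)) / (norm (x - y))\<^sup>2"

definition Lip_est :: "('a::euclidean_space \<Rightarrow> real) \<Rightarrow> 'a \<Rightarrow> 'a \<Rightarrow> real" where
  "Lip_est f x y = norm (grad f x - grad f y) / norm (x - y)"

definition prox_grad_step ::
  "('a::euclidean_space \<Rightarrow> real) \<Rightarrow> ('a \<Rightarrow> ereal) \<Rightarrow> real \<Rightarrow> 'a \<Rightarrow> 'a" where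
  "prox_grad_step f g a x = prox (\<lambda>w. ereal a * g w) (x - a *\<^sub>R grad f x)"

text \<open>All sequences are indexed by integers \<open>k \<ge> -1\<close>; their values below \<open>-1\<close> are irrelevant.
  The two alternatives with value \<open>\<infinity>\<close> implement the convention \<open>1/0 = \<infinity>\<close>;
  the first of them concerns \<open>\<rho>\<^sub>0\<close>, since \<open>\<alpha>\<close> at \<open>-1\<close> vanishes if \<open>\<ell>\<^sub>0 = 0\<close>.\<close>

definition alpha_hat ::
  "('a::euclidean_space \<Rightarrow> real) \<Rightarrow> ('a \<Rightarrow> real) \<Rightarrow> (int \<Rightarrow> real) \<Rightarrow> (int \<Rightarrow> real) \<Rightarrow> (int \<Rightarrow> 'a)
    \<Rightarrow> int \<Rightarrow> ereal" where
  "alpha_hat f1 f2 \<sigma> \<alpha> x k =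
     (let fk = f_reg f1 f2 (\<sigma> k);
          l = ell_est fk (x (k - 1)) (x k);
          L = Lip_est fk (x (k - 1)) (x k);
          l2 = ell_est f2 (x (k - 1)) (x k);
          q = \<sigma> k / \<sigma> (k - 1);
          \<rho> = \<sigma> k * \<alpha> k / (\<sigma> (k - 1) * \<alpha> (k - 1));
          d = (\<alpha> k)\<^sup>2 * L\<^sup>2 - \<alpha> k * l;
          t1 = (if \<sigma> (k - 1) * \<alpha> (k - 1) = 0 then \<infinity> else ereal (sqrt (q * (1 + \<rho>))));
          t2 = (if d \<le> 0 then \<infinity>
                else ereal (sqrt (1 - 4 * (1 - q) * \<alpha> k * l2) / (2 * sqrt (max 0 d))))
      in ereal (\<sigma> k / \<sigma> (k + 1) * \<alpha> k) * min t1 t2)"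

definition admissible_steps ::
  "('a::euclidean_space \<Rightarrow> real) \<Rightarrow> ('a \<Rightarrow> ereal) \<Rightarrow> real \<Rightarrow> real \<Rightarrow> real \<Rightarrow> 'a \<Rightarrow> real set" where
  "admissible_steps f g \<eta> \<nu> b x =
     {a \<in> range (\<lambda>i::nat. \<eta> ^ i * b). a * ell_est f x (prox_grad_step f g a x) \<le> \<nu>}"

definition adaBiM ::
  "('a::euclidean_space \<Rightarrow> real) \<Rightarrow> ('a \<Rightarrow> real) \<Rightarrow> ('a \<Rightarrow> ereal) \<Rightarrow> ('a \<Rightarrow> ereal)
    \<Rightarrow> real \<Rightarrow> real \<Rightarrow> real \<Rightarrow> (int \<Rightarrow> real) \<Rightarrow> (int \<Rightarrow> real) \<Rightarrow> (int \<Rightarrow> 'a) \<Rightarrow> bool" where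
  "adaBiM f1 f2 g1 g2 \<eta> \<nu> \<alpha>max \<sigma> \<alpha> x \<longleftrightarrow>
     (let l0 = ell_est (f_reg f1 f2 (\<sigma> 0)) (x (-1)) (x 0) in
        0 < \<eta> \<and> \<eta> < 1 \<and> 0 < \<nu> \<and> \<nu> < 1 \<and>
        0 < \<alpha> 0 \<and> 0 < \<sigma> 0 \<and> \<sigma> (-1) = \<sigma> 0 \<and>
        x 0 = prox_grad_step (f_reg f1 f2 (\<sigma> 0)) (g_reg g1 g2 (\<sigma> 0)) (\<alpha> 0) (x (-1)) \<and>
        0 < \<alpha>max \<and> (0 < l0 \<longrightarrow> 1 / l0 < \<alpha>max) \<and>
        \<alpha> (-1) = (if \<alpha> 0 * l0 \<ge> 1 / 2 then \<alpha> 0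
                   else \<alpha> 0 * ((\<alpha> 0 * l0)\<^sup>2 / (1 - (\<alpha> 0 * l0)\<^sup>2)))) \<and>
     (\<forall>k\<ge>0.
        \<sigma> (k + 1) \<in> {3 / 4 * \<sigma> k .. \<sigma> k} \<and>
        (let f = f_reg f1 f2 (\<sigma> (k + 1));
             g = g_reg g1 g2 (\<sigma> (k + 1));
             b = real_of_ereal (min (ereal \<alpha>max) (alpha_hat f1 f2 \<sigma> \<alpha> x k));
             A = admissible_steps f g \<eta> \<nu> b (x k)
         in \<alpha> (k + 1) \<in> A \<and> (\<forall>a\<in>A. a \<le> \<alpha> (k + 1)) \<and>
            x (k + 1) = prox_grad_step f g (\<alpha> (k + 1)) (x k)))"


section \<open>Quantities in the estimates\<close>

definition step_len :: "(int \<Rightarrow> 'a::real_normed_vector) \<Rightarrow> nat \<Rightarrow> real" where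
  "step_len x k = norm (x (int k + 1) - x (int k))"

definition max_step :: "(int \<Rightarrow> 'a::real_normed_vector) \<Rightarrow> real" where
  "max_step x = (SUP k. step_len x k)"

definition iter_region :: "real \<Rightarrow> (int \<Rightarrow> 'a::real_normed_vector) \<Rightarrow> 'a set" where
  "iter_region \<eta> x = {u + v | u v. u \<in> convex hull (range (\<lambda>k::nat. x (int k))) \<and>
                                  v \<in> cball 0 ((1 - \<eta>) / \<eta> * max_step x)}"

definition alpha_min :: "real \<Rightarrow> real \<Rightarrow> real \<Rightarrow> real" where
  "alpha_min \<eta> \<nu> L = 1 / (2 * L) * min (sqrt (1 - \<nu>)) (sqrt 3 * \<eta> * \<nu>)"

text \<open>The constant in the lower bound for the step sizes is a Lipschitz modulus \<open>L\<close> of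
  \<open>\<nabla>f\<^sub>0\<close> on the region spanned by the iterates. Two normalizations of the (arbitrarily
  enlargeable) modulus are needed. It has to dominate the very first local estimate, because
  the first step size depends on the starting point with index \<open>-1\<close>, which need not lie in that
  region. It must also be at least \<open>1/\<alpha>\<^sub>m\<^sub>a\<^sub>x\<close>, since no step size with index \<open>\<ge> 1\<close> exceeds
  \<open>\<alpha>\<^sub>m\<^sub>a\<^sub>x\<close>; this is automatic when \<open>\<ell>\<^sub>0 > 0\<close>, and it excludes \<open>L = 0\<close>.\<close>

definition valid_modulus ::
  "('a::euclidean_space \<Rightarrow> real) \<Rightarrow> real \<Rightarrow> real \<Rightarrow> (int \<Rightarrow> 'a) \<Rightarrow> real \<Rightarrow> bool" where
  "valid_modulus f0 \<eta> \<alpha>max x L \<longleftrightarrow>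
     L-lipschitz_on (iter_region \<eta> x) (grad f0) \<and>
     Lip_est f0 (x (-1)) (x 0) \<le> L \<and> 1 / \<alpha>max \<le> L"

text \<open>Two pitfalls of the rate for the subgradient residual. First, \<open>x\<^sub>k\<^sub>+\<^sub>1\<close> is produced by a
  proximal gradient step on \<open>\<phi>\<^sub>k\<^sub>+\<^sub>1\<close>, so the residual that is controlled is the distance of \<open>0\<close>
  to \<open>\<partial>\<phi>\<^sub>k\<^sub>+\<^sub>1(x\<^sub>k\<^sub>+\<^sub>1)\<close>; the same bound fails for \<open>\<partial>\<phi>\<^sub>k(x\<^sub>k\<^sub>+\<^sub>1)\<close>, e.g. if \<open>x\<^sub>k\<^sub>+\<^sub>1\<close> is a kink
  that minimizes \<open>\<phi>\<^sub>k\<^sub>+\<^sub>1\<close> but not \<open>\<phi>\<^sub>k\<close>. Second, the factor \<open>\<alpha>\<^sub>m\<^sub>a\<^sub>x/\<alpha>\<^sub>m\<^sub>i\<^sub>n\<close> is not invariant under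
  rescaling of the objectives, so that bound relies on \<open>\<alpha>\<^sub>m\<^sub>a\<^sub>x\<close> being large, \<open>\<alpha>\<^sub>m\<^sub>a\<^sub>x \<ge> 1\<close>.\<close>

end

theory Submission
  imports Defs
begin

text \<open>
  Write \<open>\<phi>\<^sub>k = \<sigma>\<^sub>k \<phi>1 + \<phi>2\<close>. Dividing by \<open>\<sigma>\<^sub>k\<close>, the method is a proximal gradient method
  on \<open>\<phi>1 + \<phi>2 / \<sigma>\<^sub>k\<close> with step sizes \<open>\<sigma>\<^sub>k \<alpha>\<^sub>k\<close>, so that \<open>\<rho>\<^sub>k\<close> is the ratio of two consecutive
  step sizes and the penalty on \<open>\<phi>2\<close> grows with \<open>k\<close>. Four ideas carry the proof.

  \<^bold>\<open>Descent.\<close> The line search keeps \<open>\<alpha>\<^sub>k \<ell>\<^sub>k \<le> \<nu>\<close>, and for convex \<open>f\<^sub>k\<close> this alone makes a step decrease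
  \<open>\<phi>\<^sub>k\<close> by \<open>(1 - \<nu>) / \<alpha>\<^sub>k\<close> times its squared length (\<open>prox_step_descent\<close>). Once \<open>\<phi>1\<close> is shifted
  to be nonnegative on the domain, lowering \<open>\<sigma>\<close> lowers the objective as well, and the decreases
  telescope (\<open>descent_sum\<close>). Hence the rate for the step lengths, which therefore
  tend to zero and have a maximum.

  \<^bold>\<open>Lyapunov function.\<close> Combining the subgradient inequalities of two consecutive steps gives
  \<open>two_step_inequality\<close>. The two terms in the minimum that defines the trial step size
  are exactly what its right-hand side needs, so that a function \<open>U\<close>, half the squared distance to a solution
  plus correction terms, does not increase over a step that starts where \<open>\<phi>1\<close> is at least a target
  value \<open>T\<close> (\<open>U_decrease\<close>). Where \<open>\<phi>1\<close> is below \<open>T\<close>, the iterate lies in a level set of both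
  objectives, which is bounded because the solution set is (\<open>level_set_bounded\<close>). Following \<open>U\<close>
  from the last visit below \<open>T\<close> bounds all iterates (\<open>X_bounded\<close>). Boundedness comes
  first, since the lower bound on the step sizes is derived from it.

  \<^bold>\<open>Step sizes.\<close> On the bounded region \<open>V\<close> the gradient of \<open>f\<^sub>0\<close> is Lipschitz, and \<open>f\<^sub>k\<close> inherits its
  modulus since \<open>f\<^sub>0 - f\<^sub>k\<close> is convex (\<open>Lipschitz_grad_convex_summand\<close>). The bound on \<open>\<alpha>\<^sub>k\<close> itself is not
  inductive, as the first term of the minimum may shrink \<open>\<alpha>\<^sub>k\<close> slightly; the stronger bound
  \<open>\<alpha>\<^sub>k sqrt (\<sigma>\<^sub>k / \<sigma>\<^sub>k\<^sub>-\<^sub>1) \<ge> \<alpha>\<^sub>m\<^sub>i\<^sub>n\<close> is, and the factor \<open>sqrt 3\<close> in \<open>\<alpha>\<^sub>m\<^sub>i\<^sub>n\<close> pays for it (\<open>a_ge_amin\<close>).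

  \<^bold>\<open>Convergence.\<close> With step sizes bounded below, the explicit subgradient \<open>residual\<close> of \<open>\<phi>\<^sub>k\<^sub>+\<^sub>1\<close> at
  \<open>x\<^sub>k\<^sub>+\<^sub>1\<close> is controlled by the step length; this yields the second rate, and \<open>\<phi>2 (x\<^sub>k)\<close> tends to its
  minimum. For a target \<open>T\<close> above the optimal value, \<open>U\<close> loses at least a fixed multiple of \<open>\<sigma>\<^sub>k\<close> at every
  step above \<open>T\<close>; as \<open>\<Sum>\<sigma>\<^sub>k = \<infinity>\<close>, the iterates return below \<open>T\<close> again and again
  (\<open>\<Phi>1_frequently_below\<close>). There they are close to the solution set by compactness
  (\<open>near_optimal_imp_near_S\<close>), and between such visits \<open>U\<close> prevents them from moving away.
\<close>

section \<open>Gradients of smooth convex functions\<close>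

text \<open>A linear functional on a Euclidean space is an inner product with a vector, read off on the
  basis; uniqueness of the derivative makes the description operator in \<^const>\<open>grad\<close> pick it.\<close>

lemma GDERIV_grad:
  fixes f :: "'a::euclidean_space \<Rightarrow> real"
  assumes "f differentiable (at x)"
  shows "GDERIV f x :> grad f x"
proof -
  obtain f' where f': "(f has_derivative f') (at x)"
    using assms by (auto simp: differentiable_def)
  interpret bounded_linear f' using f' by (rule has_derivative_bounded_linear)
  define D where "D = (\<Sum>b\<in>Basis. f' b *\<^sub>R b)"
  have "f' h = h \<bullet> D" for h
  proof -
    have "f' h = f' (\<Sum>b\<in>Basis. (h \<bullet> b) *\<^sub>R b)" by (simp add: euclidean_representation)
    also have "\<dots> = (\<Sum>b\<in>Basis. (h \<bullet> b) * f' b)" by (simp add: sum scaleR)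
    also have "\<dots> = h \<bullet> D" by (simp add: D_def inner_sum_right mult.commute)
    finally show ?thesis .
  qed
  then have "f' = (\<lambda>h. h \<bullet> D)" by auto
  then have D: "GDERIV f x :> D" using f' by (simp add: gderiv_def)
  moreover have "E = D" if "GDERIV f x :> E" for E
  proof -
    have "(\<lambda>h. h \<bullet> E) = (\<lambda>h. h \<bullet> D)"
      using that D unfolding gderiv_def by (rule has_derivative_unique)
    then show ?thesis by (metis vector_eq_ldot)
  qed
  ultimately show ?thesis unfolding grad_def by (rule theI)
qed

lemma grad_eqI:
  fixes f :: "'a::euclidean_space \<Rightarrow> real"
  assumes "GDERIV f x :> D"
  shows "grad f x = D"
proof -
  have "f differentiable (at x)" using assms by (auto simp: differentiable_def gderiv_def)
  then have "GDERIV f x :> grad f x" by (rule GDERIV_grad)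
  then have "(\<lambda>h. h \<bullet> grad f x) = (\<lambda>h. h \<bullet> D)"
    using assms unfolding gderiv_def by (rule has_derivative_unique)
  then show ?thesis by (metis vector_eq_ldot)
qed

lemma DERIV_along_line:
  fixes f :: "'a::euclidean_space \<Rightarrow> real"
  assumes "\<And>x. f differentiable (at x)"
  shows "((\<lambda>t. f (x + t *\<^sub>R d)) has_real_derivative d \<bullet> grad f (x + t *\<^sub>R d)) (at t)"
proof -
  have 1: "((\<lambda>t. x + t *\<^sub>R d) has_derivative (\<lambda>u. u *\<^sub>R d)) (at t)"
    by (auto intro!: derivative_eq_intros)
  have 2: "(f has_derivative (\<lambda>h. h \<bullet> grad f (x + t *\<^sub>R d))) (at (x + t *\<^sub>R d))"
    using GDERIV_grad[OF assms] by (simp add: gderiv_def)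
  have "((\<lambda>t. f (x + t *\<^sub>R d)) has_derivative (\<lambda>u. (u *\<^sub>R d) \<bullet> grad f (x + t *\<^sub>R d))) (at t)"
    by (rule has_derivative_compose[OF 1 2])
  moreover have "(\<lambda>u. (u *\<^sub>R d) \<bullet> grad f (x + t *\<^sub>R d)) = (*) (d \<bullet> grad f (x + t *\<^sub>R d))"
    by (auto simp: mult.commute)
  ultimately show ?thesis
    by (simp only: has_field_derivative_def)
qed

text \<open>Restricted to the line through \<open>x\<close> and \<open>y\<close>, this is the one-dimensional tangent inequality.\<close>

lemma convex_above_tangent:
  fixes f :: "'a::euclidean_space \<Rightarrow> real"
  assumes "convex_on UNIV f" "\<And>x. f differentiable (at x)"
  shows "f x + grad f x \<bullet> (y - x) \<le> f y"
proof -
  have "convex_on UNIV (\<lambda>t. f (x + t *\<^sub>R (y - x)))"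
  proof (rule convex_onI)
    fix t u v :: real assume "0 < t" "t < 1"
    have "x + ((1 - t) *\<^sub>R u + t *\<^sub>R v) *\<^sub>R (y - x)
      = (1 - t) *\<^sub>R (x + u *\<^sub>R (y - x)) + t *\<^sub>R (x + v *\<^sub>R (y - x))"
      by (simp add: algebra_simps)
    then show "f (x + ((1 - t) *\<^sub>R u + t *\<^sub>R v) *\<^sub>R (y - x))
       \<le> (1 - t) * f (x + u *\<^sub>R (y - x)) + t * f (x + v *\<^sub>R (y - x))"
      using convex_onD[OF assms(1), of t "x + u *\<^sub>R (y - x)" "x + v *\<^sub>R (y - x)"] \<open>0 < t\<close> \<open>t < 1\<close>
      by simp
  qed simp
  moreover have "((\<lambda>t. f (x + t *\<^sub>R (y - x))) has_real_derivative (y - x) \<bullet> grad f x) (at 0)"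
    using DERIV_along_line[OF assms(2), of x "y - x" 0] by simp
  ultimately have "f (x + 1 *\<^sub>R (y - x)) - f (x + 0 *\<^sub>R (y - x)) \<ge> ((y - x) \<bullet> grad f x) * (1 - 0)"
    by (intro convex_on_imp_above_tangent[where A = UNIV]) auto
  then show ?thesis by (simp add: inner_commute)
qed

lemma convex_grad_monotone:
  fixes f :: "'a::euclidean_space \<Rightarrow> real"
  assumes "convex_on UNIV f" "\<And>x. f differentiable (at x)"
  shows "0 \<le> (grad f x - grad f y) \<bullet> (x - y)"
  using convex_above_tangent[OF assms, of x y] convex_above_tangent[OF assms, of y x]
  by (simp add: inner_diff_right inner_diff_left)

lemma convex_loc_smooth_tangent:
  "convex_loc_smooth f \<Longrightarrow> f x + grad f x \<bullet> (y - x) \<le> f y"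
  by (rule convex_above_tangent) (auto simp: convex_loc_smooth_def)

lemma convex_loc_smooth_monotone:
  "convex_loc_smooth f \<Longrightarrow> 0 \<le> (grad f x - grad f y) \<bullet> (x - y)"
  by (rule convex_grad_monotone) (auto simp: convex_loc_smooth_def)

lemma locally_LipschitzE:
  assumes "locally_Lipschitz F"
  obtains u L where "u > 0" "L-lipschitz_on (cball x u) F"
  using assms unfolding locally_Lipschitz_def by blast

lemma locally_Lipschitz_imp_continuous:
  assumes "locally_Lipschitz F"
  shows "continuous_on UNIV F"
proof (intro continuous_at_imp_continuous_on ballI)
  fix x
  obtain u L where "u > 0" "L-lipschitz_on (cball x u) F"
    using assms by (rule locally_LipschitzE)
  then have "continuous_on (ball x u) F"
    by (meson ball_subset_cball continuous_on_subset lipschitz_on_continuous_on)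
  then show "isCont F x"
    using \<open>u > 0\<close> by (simp add: continuous_on_eq_continuous_at)
qed

lemma locally_Lipschitz_compact:
  assumes "locally_Lipschitz F" "compact K"
  obtains L where "L-lipschitz_on K F"
proof -
  have "local_lipschitz {0::real} K (\<lambda>_. F)"
  proof (rule local_lipschitzI)
    fix x
    obtain u L where "u > 0" "L-lipschitz_on (cball x u) F"
      using assms(1) by (rule locally_LipschitzE)
    then show "\<exists>u>0. \<exists>L. \<forall>t\<in>cball t u \<inter> {0}. L-lipschitz_on (cball x u \<inter> K) F" for t :: real
      by (meson inf_le1 lipschitz_on_subset)
  qed
  then show ?thesis
    using assms(2) that by (auto elim!: local_lipschitz_compact_implies_lipschitz)
qed

lemma grad_f_reg:
  fixes f1 f2 :: "'a::euclidean_space \<Rightarrow> real"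
  assumes "f1 differentiable (at x)" "f2 differentiable (at x)"
  shows "grad (f_reg f1 f2 s) x = s *\<^sub>R grad f1 x + grad f2 x"
proof (rule grad_eqI)
  have "GDERIV f1 x :> grad f1 x" "GDERIV f2 x :> grad f2 x"
    using assms by (auto intro: GDERIV_grad)
  then show "GDERIV (f_reg f1 f2 s) x :> s *\<^sub>R grad f1 x + grad f2 x"
    unfolding gderiv_def f_reg_def
    by (auto intro!: derivative_eq_intros simp: inner_add_right)
qed

lemma convex_loc_smooth_f_reg:
  fixes f1 f2 :: "'a::euclidean_space \<Rightarrow> real"
  assumes f1: "convex_loc_smooth f1" and f2: "convex_loc_smooth f2" and "0 \<le> s"
  shows "convex_loc_smooth (f_reg f1 f2 s)"
  unfolding convex_loc_smooth_def
proof (intro conjI allI)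
  have d: "f1 differentiable (at x)" "f2 differentiable (at x)" for x
    using assms by (auto simp: convex_loc_smooth_def)
  show "convex_on UNIV (f_reg f1 f2 s)"
    using assms unfolding f_reg_def convex_loc_smooth_def
    by (intro convex_on_add convex_on_cmul) auto
  show "f_reg f1 f2 s differentiable (at x)" for x
    unfolding f_reg_def using d by (intro derivative_intros) auto
  have g: "grad (f_reg f1 f2 s) = (\<lambda>x. s *\<^sub>R grad f1 x + grad f2 x)"
    using d by (auto simp: grad_f_reg)
  show "locally_Lipschitz (grad (f_reg f1 f2 s))"
    unfolding locally_Lipschitz_def g
  proof
    fix x
    obtain u L where u: "u > 0" "L-lipschitz_on (cball x u) (grad f1)"
      using f1 by (auto simp: convex_loc_smooth_def intro: locally_LipschitzE)
    obtain v M where v: "v > 0" "M-lipschitz_on (cball x v) (grad f2)"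
      using f2 by (auto simp: convex_loc_smooth_def intro: locally_LipschitzE)
    have "L-lipschitz_on (cball x (min u v)) (grad f1)" "M-lipschitz_on (cball x (min u v)) (grad f2)"
      using u v by (auto elim!: lipschitz_on_subset)
    then have "(s * L + M)-lipschitz_on (cball x (min u v)) (\<lambda>x. s *\<^sub>R grad f1 x + grad f2 x)"
      using \<open>0 \<le> s\<close> by (intro lipschitz_intros)
    then show "\<exists>u>0. \<exists>L. L-lipschitz_on (cball x u) (\<lambda>x. s *\<^sub>R grad f1 x + grad f2 x)"
      using u v by (intro exI[of _ "min u v"]) auto
  qed
qed

text \<open>The descent lemma: the function minus its claimed quadratic upper bound has nonpositive derivative
  along the segment from \<open>z\<close> to \<open>w\<close>.\<close>

lemma Lipschitz_grad_quadratic_bound: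
  fixes F :: "'a::euclidean_space \<Rightarrow> real"
  assumes "\<And>x. F differentiable (at x)" and L: "L-lipschitz_on N (grad F)" and "convex N"
    and "z \<in> N" "w \<in> N"
  shows "F w - F z - grad F z \<bullet> (w - z) \<le> L / 2 * (norm (w - z))\<^sup>2"
proof -
  define h where "h t = F (z + t *\<^sub>R (w - z)) - t * (grad F z \<bullet> (w - z)) - L / 2 * t\<^sup>2 * (norm (w - z))\<^sup>2" for t
  have "h 1 \<le> h 0"
  proof (rule DERIV_nonpos_imp_nonincreasing[where f = h and a = 0 and b = 1])
    fix t :: real assume t: "0 \<le> t" "t \<le> 1"
    let ?p = "z + t *\<^sub>R (w - z)"
    have "?p = (1 - t) *\<^sub>R z + t *\<^sub>R w" by (simp add: algebra_simps)
    then have "?p \<in> N" using assms t by (simp add: convexD)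
    then have "norm (grad F ?p - grad F z) \<le> L * norm (?p - z)"
      using lipschitz_onD[OF L, of ?p z] \<open>z \<in> N\<close> by (simp add: dist_norm)
    then have *: "norm (grad F ?p - grad F z) \<le> L * (t * norm (w - z))" using t by simp
    have "(w - z) \<bullet> (grad F ?p - grad F z) \<le> norm (w - z) * norm (grad F ?p - grad F z)"
      by (rule norm_cauchy_schwarz)
    also have "\<dots> \<le> norm (w - z) * (L * (t * norm (w - z)))"
      by (intro mult_left_mono *) auto
    finally have "(w - z) \<bullet> grad F ?p - grad F z \<bullet> (w - z) - L * t * (norm (w - z))\<^sup>2 \<le> 0"
      by (simp add: inner_diff_right inner_commute power2_eq_square algebra_simps)
    moreover have "(h has_real_derivative (w - z) \<bullet> grad F ?p - grad F z \<bullet> (w - z) - L * t * (norm (w - z))\<^sup>2) (at t)"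
      unfolding h_def
      by (auto intro!: derivative_eq_intros DERIV_along_line assms(1))
    ultimately show "\<exists>y. (h has_real_derivative y) (at t) \<and> y \<le> 0" by blast
  qed simp
  then show ?thesis by (simp add: h_def)
qed

text \<open>If the Bregman distances of \<open>A\<close> are dominated by those of \<open>F\<close>, as for \<open>F = A + B\<close> with convex \<open>B\<close>,
  then \<open>grad A\<close> has the modulus of \<open>grad F\<close>. Globally this follows from cocoercivity, that is from a
  gradient step of length \<open>1/L\<close>, which here might leave the set \<open>N\<close> on which the modulus is valid.
  For nearby points the gradients differ little and the step stays within \<open>\<delta>\<close>; a Lipschitz bound
  that holds locally along a segment holds on the whole segment.\<close>

lemma Lipschitz_grad_convex_summand:
  fixes F A :: "'a::euclidean_space \<Rightarrow> real"
  assumes F: "\<And>x. F differentiable (at x)" and L: "L-lipschitz_on N (grad F)" "0 < L" and N: "convex N"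
    and A: "convex_loc_smooth A"
    and rest: "\<And>z w. A w - A z - grad A z \<bullet> (w - z) \<le> F w - F z - grad F z \<bullet> (w - z)"
    and \<delta>: "0 < \<delta>" "\<And>p. p \<in> closed_segment a b \<Longrightarrow> cball p \<delta> \<subseteq> N"
  shows "norm (grad A a - grad A b) \<le> L * norm (a - b)"
proof -
  define \<gamma> where "\<gamma> t = a + t *\<^sub>R (b - a)" for t
  have seg: "\<gamma> t \<in> closed_segment a b" if "0 \<le> t" "t \<le> 1" for t
    using that unfolding closed_segment_def \<gamma>_def by (auto simp: algebra_simps intro!: exI[of _ t])
  have cont: "continuous_on UNIV (grad A)"
    using A by (auto simp: convex_loc_smooth_def intro: locally_Lipschitz_imp_continuous)
  have cont\<gamma>: "continuous_on UNIV (\<lambda>t. grad A (\<gamma> t))"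
    unfolding \<gamma>_def by (intro continuous_on_compose2[OF cont] continuous_intros) auto
  have half: "(norm (grad A z - grad A y))\<^sup>2 / (2 * L) \<le> A z - A y - grad A y \<bullet> (z - y)"
    if z: "cball z \<delta> \<subseteq> N" and small: "norm (grad A z - grad A y) \<le> L * \<delta>" for y z
  proof -
    define D where "D = grad A z - grad A y"
    define w where "w = z - (1 / L) *\<^sub>R D"
    have "norm D / L \<le> \<delta>" using small \<open>0 < L\<close> by (simp add: D_def field_simps)
    then have "w \<in> cball z \<delta>" using \<open>0 < L\<close> by (simp add: w_def dist_norm)
    then have "w \<in> N" "z \<in> N" using z \<delta> by auto
    have "0 \<le> A w - A y - grad A y \<bullet> (w - y)"
      using convex_loc_smooth_tangent[OF A, of y w] by simp
    also have "\<dots> = (A z - A y - grad A y \<bullet> (z - y)) + (A w - A z - grad A z \<bullet> (w - z)) + D \<bullet> (w - z)"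
      by (simp add: D_def inner_diff_left inner_diff_right)
    also have "A w - A z - grad A z \<bullet> (w - z) \<le> L / 2 * (norm (w - z))\<^sup>2"
      using rest[of w z] Lipschitz_grad_quadratic_bound[OF F L(1) N \<open>z \<in> N\<close> \<open>w \<in> N\<close>] by linarith
    also have "(norm (w - z))\<^sup>2 = (norm D)\<^sup>2 / L\<^sup>2"
      using \<open>0 < L\<close> by (simp add: w_def power_divide)
    also have "D \<bullet> (w - z) = - ((norm D)\<^sup>2 / L)"
      by (simp add: w_def power2_norm_eq_inner)
    finally have "0 \<le> A z - A y - grad A y \<bullet> (z - y) + L / 2 * ((norm D)\<^sup>2 / L\<^sup>2) + - ((norm D)\<^sup>2 / L)"
      by simp
    moreover have "L / 2 * ((norm D)\<^sup>2 / L\<^sup>2) = (norm D)\<^sup>2 / (2 * L)"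
      "(norm D)\<^sup>2 / L = 2 * ((norm D)\<^sup>2 / (2 * L))"
      using \<open>0 < L\<close> by (simp_all add: power2_eq_square)
    ultimately show ?thesis unfolding D_def by linarith
  qed
  have "L * norm (b - a) \<ge> 0" using \<open>0 < L\<close> by simp
  then have "(L * norm (b - a))-lipschitz_on {0..1} (\<lambda>t. grad A (\<gamma> t))"
  proof (rule locally_lipschitz_imp_lipschitz[rotated 2])
    show "continuous_on {0..1} (\<lambda>t. grad A (\<gamma> t))"
      using cont\<gamma> by (rule continuous_on_subset) simp
    fix t u :: real assume t: "t \<in> {0..<1}" and "t < u"
    have "isCont (\<lambda>t. grad A (\<gamma> t)) t" using cont\<gamma> by (simp add: continuous_on_eq_continuous_at)
    then obtain e where e: "0 < e" "\<And>v. dist v t < e \<Longrightarrow> dist (grad A (\<gamma> v)) (grad A (\<gamma> t)) < L * \<delta>"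
      using \<open>0 < L\<close> \<open>0 < \<delta>\<close> unfolding continuous_at_eps_delta by (meson mult_pos_pos)
    define v where "v = min (t + e / 2) (min u 1)"
    have v: "t < v" "v \<le> u" "v \<le> 1" "dist v t < e"
      using t \<open>t < u\<close> e by (auto simp: v_def dist_real_def)
    define D where "D = grad A (\<gamma> v) - grad A (\<gamma> t)"
    have small: "norm (grad A (\<gamma> v) - grad A (\<gamma> t)) \<le> L * \<delta>" "norm (grad A (\<gamma> t) - grad A (\<gamma> v)) \<le> L * \<delta>"
      using e(2)[OF v(4)] by (auto simp: dist_norm norm_minus_commute)
    have "(norm D)\<^sup>2 / (2 * L) \<le> A (\<gamma> v) - A (\<gamma> t) - grad A (\<gamma> t) \<bullet> (\<gamma> v - \<gamma> t)"
      "(norm D)\<^sup>2 / (2 * L) \<le> A (\<gamma> t) - A (\<gamma> v) - grad A (\<gamma> v) \<bullet> (\<gamma> t - \<gamma> v)"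
      using half[OF _ small(1)] half[OF _ small(2)] seg t v \<delta>(2)
      by (auto simp: D_def norm_minus_commute)
    then have "(norm D)\<^sup>2 / L \<le> D \<bullet> (\<gamma> v - \<gamma> t)"
      using \<open>0 < L\<close> by (simp add: D_def inner_diff_left inner_diff_right field_simps)
    also have "\<dots> \<le> norm D * norm (\<gamma> v - \<gamma> t)" by (rule norm_cauchy_schwarz)
    finally have "norm D * norm D \<le> norm D * (L * norm (\<gamma> v - \<gamma> t))"
      using \<open>0 < L\<close> by (simp add: field_simps power2_eq_square)
    then have "norm D \<le> L * norm (\<gamma> v - \<gamma> t)"
      using \<open>0 < L\<close> by (cases "norm D = 0") (auto simp: mult_le_cancel_left)
    also have "\<gamma> v - \<gamma> t = (v - t) *\<^sub>R (b - a)" by (simp add: \<gamma>_def algebra_simps)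
    finally have "dist (grad A (\<gamma> v)) (grad A (\<gamma> t)) \<le> L * norm (b - a) * (v - t)"
      using v by (simp add: D_def dist_norm mult_ac)
    then show "\<exists>v\<in>{t<..u}. dist (grad A (\<gamma> v)) (grad A (\<gamma> t)) \<le> L * norm (b - a) * (v - t)"
      using v by (intro bexI[of _ v]) auto
  qed
  from lipschitz_onD[OF this, of 0 1] show ?thesis
    by (simp add: \<gamma>_def dist_norm norm_minus_commute)
qed

section \<open>Lower semicontinuity and proximal steps\<close>

lemma lower_semicont_iff_eventually:
  "lower_semicont h \<longleftrightarrow> (\<forall>x c. c < h x \<longrightarrow> (\<forall>\<^sub>F y in nhds x. c < h y))"
proof -
  have "(\<forall>\<^sub>F y in at x. c < h y) \<longleftrightarrow> (\<forall>\<^sub>F y in nhds x. c < h y)" if "c < h x" for x c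
    using that by (auto simp: eventually_at_filter elim: eventually_mono)
  then show ?thesis unfolding lower_semicont_def le_Liminf_iff by blast
qed

lemma lower_semicont_eventually:
  "lower_semicont h \<Longrightarrow> c < h x \<Longrightarrow> (\<forall>\<^sub>F y in nhds x. c < h y)"
  by (simp add: lower_semicont_iff_eventually)

text \<open>The sequential form in which lower semicontinuity enters the compactness arguments.\<close>

lemma lower_semicont_limit_le:
  fixes z :: "nat \<Rightarrow> 'a::topological_space"
  assumes h: "lower_semicont h" and z: "z \<longlonglongrightarrow> l" and c: "c \<longlonglongrightarrow> d"
    and le: "\<And>n. h (z n) \<le> ereal (c n)"
  shows "h l \<le> ereal d"
proof (rule ccontr)
  assume "\<not> h l \<le> ereal d"
  then have "ereal d < h l" by simp
  then obtain e where e: "d < e" "ereal e < h l"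
    using ereal_dense2[of "ereal d" "h l"] by auto
  have "\<forall>\<^sub>F n in sequentially. ereal e < h (z n)"
    using eventually_compose_filterlim[OF lower_semicont_eventually[OF h e(2)] z] .
  moreover have "\<forall>\<^sub>F n in sequentially. c n < e"
    using c e(1) by (rule order_tendstoD)
  ultimately have "\<forall>\<^sub>F n in sequentially. False"
  proof eventually_elim
    case (elim n)
    then have "ereal e < ereal e" using less_le_trans[OF elim(1) le[of n]] by simp
    then show ?case by simp
  qed
  then show False by simp
qed

lemma lower_semicont_add:
  fixes h1 h2 :: "'a::topological_space \<Rightarrow> ereal"
  assumes h: "lower_semicont h1" "lower_semicont h2" and fin: "\<And>x. h1 x \<noteq> - \<infinity>" "\<And>x. h2 x \<noteq> - \<infinity>"
  shows "lower_semicont (\<lambda>x. h1 x + h2 x)"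
  unfolding lower_semicont_iff_eventually
proof (intro allI impI)
  fix x and c :: ereal assume c: "c < h1 x + h2 x"
  show "\<forall>\<^sub>F y in nhds x. c < h1 y + h2 y"
  proof (cases "c = - \<infinity>")
    case True
    have "h1 y + h2 y \<noteq> - \<infinity>" for y
      using fin[of y] by (cases "h1 y"; cases "h2 y") auto
    then show ?thesis by (simp add: True ereal_infty_less(2))
  next
    case False
    then obtain r where r: "c = ereal r" using c by (cases c) auto
    obtain c1 c2 where c12: "ereal c1 < h1 x" "ereal c2 < h2 x" "r \<le> c1 + c2"
    proof -
      consider a b where "h1 x = ereal a" "h2 x = ereal b" | "h1 x = \<infinity>" | "h2 x = \<infinity>"
        using fin[of x] by (cases "h1 x"; cases "h2 x") auto
      then show ?thesis
      proof cases
        case 1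
        then have "r < a + b" using c r by simp
        then show ?thesis using 1 by (intro that[of "a - (a + b - r) / 2" "b - (a + b - r) / 2"]) auto
      next
        case 2
        obtain b where "ereal b < h2 x" using fin(2)[of x]
          by (cases "h2 x") (auto intro: that[of "real_of_ereal (h2 x) - 1"] that[of 0])
        then show ?thesis using 2 by (intro that[of "r - b" b]) auto
      next
        case 3
        obtain b where "ereal b < h1 x" using fin(1)[of x]
          by (cases "h1 x") (auto intro: that[of "real_of_ereal (h1 x) - 1"] that[of 0])
        then show ?thesis using 3 by (intro that[of b "r - b"]) auto
      qed
    qed
    have "\<forall>\<^sub>F y in nhds x. ereal c1 < h1 y" "\<forall>\<^sub>F y in nhds x. ereal c2 < h2 y"
      using h c12 by (auto intro: lower_semicont_eventually)
    then show ?thesis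
    proof eventually_elim
      case (elim y)
      have "c \<le> ereal c1 + ereal c2" using c12 r by simp
      also have "\<dots> < h1 y + h2 y" using elim by (intro ereal_add_strict_mono2) auto
      finally show ?case .
    qed
  qed
qed

lemma lower_semicont_cmult:
  fixes h :: "'a::perfect_space \<Rightarrow> ereal"
  assumes "lower_semicont h" "0 \<le> s"
  shows "lower_semicont (\<lambda>x. ereal s * h x)"
  unfolding lower_semicont_def
proof
  fix x
  have "Liminf (at x) (\<lambda>x. ereal s * h x) = ereal s * Liminf (at x) h"
    using assms by (intro Liminf_ereal_mult_left) auto
  then show "ereal s * h x \<le> Liminf (at x) (\<lambda>x. ereal s * h x)"
    using assms by (auto simp: lower_semicont_def intro!: ereal_mult_left_mono)
qed

lemma lower_semicont_continuous:
  fixes f :: "'a::t2_space \<Rightarrow> real"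
  assumes "continuous_on UNIV f"
  shows "lower_semicont (\<lambda>x. ereal (f x))"
  unfolding lower_semicont_iff_eventually
proof (intro allI impI)
  fix x c assume c: "c < ereal (f x)"
  have "isCont f x" using assms by (simp add: continuous_on_eq_continuous_at)
  then have "((\<lambda>y. ereal (f y)) \<longlongrightarrow> ereal (f x)) (nhds x)"
    unfolding isCont_def tendsto_at_iff_tendsto_nhds by (rule tendsto_ereal)
  then show "\<forall>\<^sub>F y in nhds x. c < ereal (f y)" using c by (rule order_tendstoD)
qed

lemma lower_semicont_attains_min:
  fixes h :: "'a::metric_space \<Rightarrow> ereal"
  assumes h: "lower_semicont h" and K: "compact K" "K \<noteq> {}"
  obtains p where "p \<in> K" "\<And>y. y \<in> K \<Longrightarrow> h p \<le> h y"
proof -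
  obtain u where u: "\<And>n. u n \<in> h ` K" "u \<longlonglongrightarrow> Inf (h ` K)"
    using Inf_as_limit[of "h ` K"] K by auto
  then have "\<forall>n. \<exists>w. w \<in> K \<and> u n = h w" by auto
  then obtain z where z: "\<And>n. z n \<in> K" "\<And>n. u n = h (z n)" by metis
  obtain p r where p: "p \<in> K" "strict_mono r" "(z \<circ> r) \<longlonglongrightarrow> p"
    using K(1)[unfolded compact_def, rule_format, of z] z(1) by blast
  have "h p \<le> Inf (h ` K)"
  proof (rule ccontr)
    assume "\<not> ?thesis"
    then obtain c where c: "Inf (h ` K) < c" "c < h p" using dense by (metis not_le)
    have "\<forall>\<^sub>F n in sequentially. c < h ((z \<circ> r) n)"
      using eventually_compose_filterlim[OF lower_semicont_eventually[OF h c(2)] p(3)] .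
    moreover have "\<forall>\<^sub>F n in sequentially. (u \<circ> r) n < c"
      using LIMSEQ_subseq_LIMSEQ[OF u(2) p(2)] c(1) by (rule order_tendstoD)
    ultimately have "\<forall>\<^sub>F n in sequentially. False"
      by eventually_elim (use z(2) in auto)
    then show False by simp
  qed
  then have "h p \<le> h y" if "y \<in> K" for y using that by (meson INF_lower order_trans)
  then show ?thesis using that[OF p(1)] by blast
qed

text \<open>Existence of the proximal point by elementary means: \<open>h\<close> has a minimum \<open>m\<close> on the unit ball around a
  point of its domain, and convexity along rays turns this into a lower bound for \<open>h\<close> that is affine in the
  distance. The quadratic term dominates such a bound, so the minimization can be confined to
  a compact ball.\<close>

lemma prox_objective_attains_min:
  fixes h :: "'a::euclidean_space \<Rightarrow> ereal"
  assumes h: "proper h" "lower_semicont h" "ext_convex h"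
  obtains p where "\<And>w. h p + ereal ((norm (p - z))\<^sup>2 / 2) \<le> h w + ereal ((norm (w - z))\<^sup>2 / 2)"
proof -
  define \<Psi> where "\<Psi> w = h w + ereal ((norm (w - z))\<^sup>2 / 2)" for w
  have fin: "h w \<noteq> - \<infinity>" for w using h by (simp add: proper_def)
  obtain y where "h y < \<infinity>" using h by (auto simp: proper_def ext_dom_def)
  then obtain H where H: "h y = ereal H" using fin[of y] by (cases "h y") auto
  obtain q where q: "q \<in> cball y 1" "\<And>w. w \<in> cball y 1 \<Longrightarrow> h q \<le> h w"
    using lower_semicont_attains_min[OF h(2), of "cball y 1"] by auto
  have "h q \<le> ereal H" using q(2)[of y] H by simp
  then obtain m where m: "h q = ereal m" "m \<le> H" using fin[of q] by (cases "h q") auto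
  define c where "c = norm (y - z)"
  define R where "R = 1 + 2 * (c + (H - m))"
  have "R \<ge> 1" using m by (simp add: R_def c_def)
  have far: "\<Psi> y \<le> \<Psi> w" if w: "norm (w - y) > R" for w
  proof (cases "h w = \<infinity>")
    case True
    then show ?thesis by (simp add: \<Psi>_def)
  next
    case False
    then obtain W where W: "h w = ereal W" using fin[of w] by (cases "h w") auto
    define \<rho> where "\<rho> = norm (w - y)"
    have \<rho>: "\<rho> > R" "\<rho> > 1" using w \<open>R \<ge> 1\<close> by (auto simp: \<rho>_def)
    (* the point of the unit sphere around y in the direction of w *)
    define v where "v = (1 - 1 / \<rho>) *\<^sub>R y + (1 / \<rho>) *\<^sub>R w"
    have "v - y = (1 / \<rho>) *\<^sub>R (w - y)" by (simp add: v_def algebra_simps)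
    then have "norm (v - y) = 1" using \<rho> by (simp add: \<rho>_def[symmetric])
    then have "v \<in> cball y 1" by (simp add: dist_norm norm_minus_commute)
    then have "ereal m \<le> h v" using q(2) m by simp
    also have "\<dots> \<le> ereal (1 - 1 / \<rho>) * h y + ereal (1 / \<rho>) * h w"
      unfolding v_def using h(3) \<rho> by (auto simp: ext_convex_def)
    also have "\<dots> = ereal ((1 - 1 / \<rho>) * H + 1 / \<rho> * W)" by (simp add: H W)
    finally have "m \<le> (1 - 1 / \<rho>) * H + 1 / \<rho> * W" by simp
    then have "\<rho> * m \<le> \<rho> * ((1 - 1 / \<rho>) * H + 1 / \<rho> * W)" using \<rho> by (intro mult_left_mono) auto
    also have "\<dots> = (\<rho> - 1) * H + W" using \<rho> by (simp add: field_simps)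
    finally have W': "W \<ge> \<rho> * (m - H) + H" by (simp add: algebra_simps)
    have "\<rho> \<le> norm (w - z) + c" unfolding \<rho>_def c_def
      using norm_triangle_ineq4[of "w - z" "y - z"] by simp
    moreover have "c \<le> \<rho>" using \<rho> m(2) by (simp add: R_def c_def)
    ultimately have "(\<rho> - c)\<^sup>2 \<le> (norm (w - z))\<^sup>2" by (intro power_mono) auto
    moreover have "\<rho> * (2 * (c + (H - m))) \<le> \<rho> * \<rho>" using \<rho> by (intro mult_left_mono) (auto simp: R_def)
    ultimately have "H + c\<^sup>2 / 2 \<le> W + (norm (w - z))\<^sup>2 / 2"
      using W' by (simp add: power2_eq_square algebra_simps)
    then show ?thesis by (simp add: \<Psi>_def H W c_def)
  qed
  have "lower_semicont \<Psi>" unfolding \<Psi>_def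
    using h(2) fin by (intro lower_semicont_add lower_semicont_continuous continuous_intros) auto
  then obtain p where p: "p \<in> cball y R" "\<And>w. w \<in> cball y R \<Longrightarrow> \<Psi> p \<le> \<Psi> w"
    using lower_semicont_attains_min[of \<Psi> "cball y R"] \<open>R \<ge> 1\<close> by auto
  have "\<Psi> p \<le> \<Psi> w" for w
  proof (cases "norm (w - y) > R")
    case True
    have "\<Psi> p \<le> \<Psi> y" using p \<open>R \<ge> 1\<close> by auto
    then show ?thesis using far[OF True] by simp
  next
    case False
    then show ?thesis using p(2)[of w] by (simp add: dist_norm norm_minus_commute)
  qed
  then show ?thesis unfolding \<Psi>_def by (rule that)
qed

lemma prox_minimizes:
  fixes h :: "'a::euclidean_space \<Rightarrow> ereal"
  assumes h: "proper h" "lower_semicont h" "ext_convex h"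
  shows "h (prox h z) + ereal ((norm (prox h z - z))\<^sup>2 / 2) \<le> h w + ereal ((norm (w - z))\<^sup>2 / 2)"
proof -
  obtain p where p: "\<And>w. h p + ereal ((norm (p - z))\<^sup>2 / 2) \<le> h w + ereal ((norm (w - z))\<^sup>2 / 2)"
    by (rule prox_objective_attains_min[OF h, of z]) blast
  show ?thesis unfolding prox_def
    by (rule arg_minI[where x = p]) (use p in \<open>auto simp: not_less\<close>)
qed

lemma prox_in_ext_dom:
  fixes h :: "'a::euclidean_space \<Rightarrow> ereal"
  assumes h: "proper h" "lower_semicont h" "ext_convex h"
  shows "h (prox h z) < \<infinity>"
proof -
  obtain y where "h y < \<infinity>" using h by (auto simp: proper_def ext_dom_def)
  then have "h y + ereal ((norm (y - z))\<^sup>2 / 2) < \<infinity>" by simp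
  then have "h (prox h z) + ereal ((norm (prox h z - z))\<^sup>2 / 2) < \<infinity>"
    using prox_minimizes[OF h, of z y] by (rule le_less_trans[rotated])
  then show ?thesis by simp
qed

text \<open>Optimality of the proximal point: compare with the points \<open>(1 - t) p + t y\<close>, divide by \<open>t\<close> and
  let \<open>t\<close> tend to zero.\<close>

lemma prox_residual_subdiff:
  fixes h :: "'a::euclidean_space \<Rightarrow> ereal"
  assumes h: "proper h" "lower_semicont h" "ext_convex h"
  shows "z - prox h z \<in> subdiff h (prox h z)"
  unfolding subdiff_def mem_Collect_eq
proof
  fix y
  let ?p = "prox h z"
  have fin: "h w \<noteq> - \<infinity>" for w using h by (simp add: proper_def)
  show "h ?p + ereal ((z - ?p) \<bullet> (y - ?p)) \<le> h y"
  proof (cases "h y = \<infinity>")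
    case False
    then obtain b where b: "h y = ereal b" using fin[of y] by (cases "h y") auto
    obtain a where a: "h ?p = ereal a" using fin[of ?p] prox_in_ext_dom[OF h, of z] by (cases "h ?p") auto
    define N where "N = (norm (y - ?p))\<^sup>2"
    have ineq: "a + (z - ?p) \<bullet> (y - ?p) \<le> b + t / 2 * N" if t: "0 < t" "t < 1" for t
    proof -
      let ?q = "(1 - t) *\<^sub>R ?p + t *\<^sub>R y"
      have "ereal (a + (norm (?p - z))\<^sup>2 / 2) \<le> h ?q + ereal ((norm (?q - z))\<^sup>2 / 2)"
        using prox_minimizes[OF h, of z ?q] a by simp
      also have "h ?q \<le> ereal (1 - t) * h ?p + ereal t * h y"
        using h(3) t by (auto simp: ext_convex_def)
      also have "\<dots> = ereal ((1 - t) * a + t * b)" by (simp add: a b)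
      finally have 1: "a + (norm (?p - z))\<^sup>2 / 2 \<le> (1 - t) * a + t * b + (norm (?q - z))\<^sup>2 / 2"
        by (simp add: add_mono)
      have "(norm (a + t *\<^sub>R b))\<^sup>2 = (norm a)\<^sup>2 + 2 * t * (a \<bullet> b) + t\<^sup>2 * (norm b)\<^sup>2" for a b :: 'a
        unfolding power2_norm_eq_inner
        by (simp add: inner_add_left inner_add_right inner_commute power2_eq_square)
      from this[of "?p - z" "y - ?p"]
      have "(norm (?q - z))\<^sup>2 = (norm (?p - z))\<^sup>2 + 2 * t * ((?p - z) \<bullet> (y - ?p)) + t\<^sup>2 * N"
        by (simp add: N_def algebra_simps)
      then have "t * (a + (z - ?p) \<bullet> (y - ?p)) \<le> t * (b + t / 2 * N)"
        using 1 by (simp add: inner_diff_left power2_eq_square algebra_simps)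
      then show ?thesis using t by simp
    qed
    have "((\<lambda>t. b + t / 2 * N) \<longlongrightarrow> b + 0 / 2 * N) (at_right 0)"
      by (intro tendsto_intros) simp
    moreover have "\<forall>\<^sub>F t in at_right 0. a + (z - ?p) \<bullet> (y - ?p) \<le> b + t / 2 * N"
      using ineq by (intro eventually_at_rightI[of 0 1]) auto
    ultimately have "a + (z - ?p) \<bullet> (y - ?p) \<le> b"
      using tendsto_lowerbound[of "\<lambda>t. b + t / 2 * N" b "at_right 0" "a + (z - ?p) \<bullet> (y - ?p)"] by simp
    then show ?thesis by (simp add: a b)
  qed simp
qed

lemma proper_g_reg:
  assumes "proper g1" "proper g2" "0 < s" "g1 y < \<infinity>" "g2 y < \<infinity>"
  shows "proper (g_reg g1 g2 s)"
  unfolding proper_def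
proof
  have f: "g1 x \<noteq> - \<infinity>" "g2 x \<noteq> - \<infinity>" for x using assms by (auto simp: proper_def)
  show "\<forall>x. g_reg g1 g2 s x \<noteq> - \<infinity>"
  proof
    fix x show "g_reg g1 g2 s x \<noteq> - \<infinity>"
      using f[of x] \<open>0 < s\<close> by (cases "g1 x"; cases "g2 x") (auto simp: g_reg_def)
  qed
  have "g_reg g1 g2 s y < \<infinity>"
    using f[of y] assms by (cases "g1 y"; cases "g2 y") (auto simp: g_reg_def)
  then show "ext_dom (g_reg g1 g2 s) \<noteq> {}" by (auto simp: ext_dom_def)
qed

lemma lower_semicont_g_reg:
  fixes g1 g2 :: "'a::euclidean_space \<Rightarrow> ereal"
  assumes "proper g1" "proper g2" "lower_semicont g1" "lower_semicont g2" "0 < s"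
  shows "lower_semicont (g_reg g1 g2 s)"
  unfolding g_reg_def
proof (intro lower_semicont_add lower_semicont_cmult)
  fix x
  have f: "g1 x \<noteq> - \<infinity>" "g2 x \<noteq> - \<infinity>" using assms by (auto simp: proper_def)
  then show "ereal s * g1 x \<noteq> - \<infinity>" "g2 x \<noteq> - \<infinity>" using \<open>0 < s\<close> by (cases "g1 x"; auto)+
qed (use assms in auto)

lemma ereal_distrib_not_MInfty:
  assumes "a \<noteq> - \<infinity>" "b \<noteq> - \<infinity>" "0 \<le> u"
  shows "ereal u * (a + b) = ereal u * a + ereal u * b"
  using assms by (cases "u = 0"; cases a; cases b) (auto simp: distrib_left)

lemma ereal_cmult_not_MInfty:
  assumes "a \<noteq> - \<infinity>" "0 \<le> u"
  shows "ereal u * a \<noteq> - \<infinity>"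
  using assms by (cases "u = 0"; cases a) auto

lemma ext_convex_cmult:
  assumes h: "ext_convex h" "proper h" and "0 < s"
  shows "ext_convex (\<lambda>x. ereal s * h x)"
  unfolding ext_convex_def
proof (intro allI impI)
  fix x y and u v :: real assume uv: "0 \<le> u" "0 \<le> v" "u + v = 1"
  have f: "h x \<noteq> - \<infinity>" "h y \<noteq> - \<infinity>" using h by (auto simp: proper_def)
  have "ereal s * h (u *\<^sub>R x + v *\<^sub>R y) \<le> ereal s * (ereal u * h x + ereal v * h y)"
    using h uv \<open>0 < s\<close> by (intro ereal_mult_left_mono) (auto simp: ext_convex_def)
  also have "\<dots> = ereal u * (ereal s * h x) + ereal v * (ereal s * h y)"
    using f uv \<open>0 < s\<close>
    by (simp add: ereal_distrib_not_MInfty ereal_cmult_not_MInfty mult.left_commute)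
  finally show "ereal s * h (u *\<^sub>R x + v *\<^sub>R y) \<le> ereal u * (ereal s * h x) + ereal v * (ereal s * h y)" .
qed

lemma ext_convex_g_reg:
  fixes g1 g2 :: "'a::euclidean_space \<Rightarrow> ereal"
  assumes g: "ext_convex g1" "ext_convex g2" "proper g1" "proper g2" and "0 < s"
  shows "ext_convex (g_reg g1 g2 s)"
  unfolding ext_convex_def g_reg_def
proof (intro allI impI)
  fix x y :: 'a and u v :: real assume uv: "0 \<le> u" "0 \<le> v" "u + v = 1"
  let ?z = "u *\<^sub>R x + v *\<^sub>R y"
  have f: "g1 x \<noteq> - \<infinity>" "g1 y \<noteq> - \<infinity>" "g2 x \<noteq> - \<infinity>" "g2 y \<noteq> - \<infinity>"
    using g by (auto simp: proper_def)
  have "ereal s * g1 ?z + g2 ?z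
    \<le> (ereal u * (ereal s * g1 x) + ereal v * (ereal s * g1 y)) + (ereal u * g2 x + ereal v * g2 y)"
    using ext_convex_cmult[OF g(1,3) \<open>0 < s\<close>] g(2) uv by (intro add_mono) (auto simp: ext_convex_def)
  also have "\<dots> = ereal u * (ereal s * g1 x + g2 x) + ereal v * (ereal s * g1 y + g2 y)"
    using f uv \<open>0 < s\<close>
    by (simp add: ereal_distrib_not_MInfty ereal_cmult_not_MInfty add_ac)
  finally show "ereal s * g1 ?z + g2 ?z \<le> ereal u * (ereal s * g1 x + g2 x) + ereal v * (ereal s * g1 y + g2 y)" .
qed

lemma proper_cmult:
  assumes "proper h" "0 < s"
  shows "proper (\<lambda>x. ereal s * h x)"
proof -
  have "ereal s * h x < \<infinity>" if "h x < \<infinity>" for x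
    using that assms by (cases "h x") auto
  then show ?thesis
    using assms ereal_cmult_not_MInfty[of _ s] by (fastforce simp: proper_def ext_dom_def)
qed

lemma prox_grad_step_optimality:
  fixes g :: "'a::euclidean_space \<Rightarrow> ereal" and f :: "'a \<Rightarrow> real" and x :: 'a
  assumes g: "proper g" "lower_semicont g" "ext_convex g" and "0 < a"
  defines "p \<equiv> prox_grad_step f g a x"
  shows "g p < \<infinity>" "(1 / a) *\<^sub>R (x - p) - grad f x \<in> subdiff g p"
proof -
  let ?h = "\<lambda>w. ereal a * g w"
  have h: "proper ?h" "lower_semicont ?h" "ext_convex ?h"
    using assms by (auto intro: proper_cmult lower_semicont_cmult ext_convex_cmult)
  have fin: "g w \<noteq> - \<infinity>" for w using g by (simp add: proper_def)
  have p: "p = prox ?h (x - a *\<^sub>R grad f x)" by (simp add: p_def prox_grad_step_def)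
  have "ereal a * g p < \<infinity>" unfolding p by (rule prox_in_ext_dom[OF h])
  then show "g p < \<infinity>" using \<open>0 < a\<close> by (cases "g p") auto
  have s: "x - a *\<^sub>R grad f x - p \<in> subdiff ?h p" unfolding p by (rule prox_residual_subdiff[OF h])
  show "(1 / a) *\<^sub>R (x - p) - grad f x \<in> subdiff g p" unfolding subdiff_def mem_Collect_eq
  proof
    fix y
    define v where "v = (1 / a) *\<^sub>R (x - p) - grad f x"
    have av: "x - a *\<^sub>R grad f x - p = a *\<^sub>R v" using \<open>0 < a\<close> by (simp add: v_def scaleR_diff_right)
    have ineq: "ereal a * g p + ereal (a * (v \<bullet> (y - p))) \<le> ereal a * g y"
      using s unfolding subdiff_def av by simp
    have "G + v \<bullet> (y - p) \<le> H" if "g p = ereal G" "g y = ereal H" for G H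
    proof -
      have "a * (G + v \<bullet> (y - p)) \<le> a * H" using ineq that by (simp add: distrib_left)
      then show ?thesis using \<open>0 < a\<close> by simp
    qed
    then show "g p + ereal (((1 / a) *\<^sub>R (x - p) - grad f x) \<bullet> (y - p)) \<le> g y"
      using fin[of p] fin[of y] \<open>g p < \<infinity>\<close> unfolding v_def[symmetric]
      by (cases "g p"; cases "g y") auto
  qed
qed

section \<open>The bilevel problem and its level sets\<close>

locale bilevel_problem =
  fixes f1 f2 :: "'a::euclidean_space \<Rightarrow> real" and g1 g2 :: "'a \<Rightarrow> ereal"
  assumes basic: "basic_assumption f1 f2 g1 g2"
begin

text \<open>Real-valued forms of the problem data. They are meaningful on the common domain \<open>D\<close> only:
  \<^const>\<open>real_of_ereal\<close> sends \<open>\<infinity>\<close> to \<open>0\<close>.\<close>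

definition D :: "'a set" where "D = {x. g1 x < \<infinity> \<and> g2 x < \<infinity>}"
definition G :: "real \<Rightarrow> 'a \<Rightarrow> real" where "G s x = s * real_of_ereal (g1 x) + real_of_ereal (g2 x)"
definition \<Phi>1 :: "'a \<Rightarrow> real" where "\<Phi>1 x = f1 x + real_of_ereal (g1 x)"
definition \<Phi>2 :: "'a \<Rightarrow> real" where "\<Phi>2 x = f2 x + real_of_ereal (g2 x)"

abbreviation "S \<equiv> bilevel_solutions f1 f2 g1 g2"
abbreviation "f s \<equiv> f_reg f1 f2 s"

text \<open>The optimal values of the two levels; any solution yields the same two numbers (\<open>S_value\<close>).\<close>

definition "v1 = \<Phi>1 (SOME z. z \<in> S)"
definition "v2 = \<Phi>2 (SOME z. z \<in> S)"
definition "m1 = real_of_ereal (inf_upper f1 f2 g1 g2)"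

lemma smooth: "convex_loc_smooth f1" "convex_loc_smooth f2"
  and nonsmooth: "proper g1" "lower_semicont g1" "ext_convex g1" "proper g2" "lower_semicont g2" "ext_convex g2"
  and S_nonempty: "S \<noteq> {}" and S_bounded: "bounded S"
  and inf_upper_lower_bound: "inf_upper f1 f2 g1 g2 > - \<infinity>"
  using basic by (auto simp: basic_assumption_def)

lemma smooth_f: "0 \<le> s \<Longrightarrow> convex_loc_smooth (f s)"
  using smooth by (rule convex_loc_smooth_f_reg)

lemma g_not_MInfty: "g1 x \<noteq> - \<infinity>" "g2 x \<noteq> - \<infinity>"
  using nonsmooth by (auto simp: proper_def)

lemma g_eq: assumes "x \<in> D" shows "g1 x = ereal (real_of_ereal (g1 x))" "g2 x = ereal (real_of_ereal (g2 x))"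
  using assms g_not_MInfty[of x] by (cases "g1 x"; cases "g2 x"; auto simp: D_def)+

lemma composite_eq:
  assumes "x \<in> D"
  shows "composite f1 g1 x = ereal (\<Phi>1 x)" "composite f2 g2 x = ereal (\<Phi>2 x)"
  using g_eq[OF assms] unfolding composite_def \<Phi>1_def \<Phi>2_def by (metis plus_ereal.simps(1))+

lemma D_iff: "x \<in> D \<longleftrightarrow> composite f1 g1 x < \<infinity> \<and> composite f2 g2 x < \<infinity>"
  using g_not_MInfty[of x] by (cases "g1 x"; cases "g2 x") (auto simp: D_def composite_def)

lemma g_reg_eq:
  assumes "x \<in> D"
  shows "g_reg g1 g2 s x = ereal (G s x)"
  using g_eq[OF assms] unfolding g_reg_def G_def by (metis plus_ereal.simps(1) times_ereal.simps(1))

lemma g_reg_finite_iff: "0 < s \<Longrightarrow> g_reg g1 g2 s x < \<infinity> \<longleftrightarrow> x \<in> D"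
  using g_not_MInfty[of x] by (cases "g1 x"; cases "g2 x") (auto simp: D_def g_reg_def)

lemma \<Phi>_eq: "f s x + G s x = s * \<Phi>1 x + \<Phi>2 x"
  by (simp add: f_reg_def G_def \<Phi>1_def \<Phi>2_def algebra_simps)

lemma phi_reg_eq: "x \<in> D \<Longrightarrow> phi_reg f1 f2 g1 g2 s x = ereal (s * \<Phi>1 x + \<Phi>2 x)"
  by (simp add: phi_reg_def composite_def g_reg_eq flip: \<Phi>_eq)

lemma phi_reg_finite_iff: "0 < s \<Longrightarrow> phi_reg f1 f2 g1 g2 s x < \<infinity> \<longleftrightarrow> x \<in> D"
  using g_reg_finite_iff[of s x] by (simp add: phi_reg_def composite_def)

lemma S_in_D: "z \<in> S \<Longrightarrow> z \<in> D"
  by (auto simp: bilevel_solutions_def lower_solutions_def argmin_set_def D_iff)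

lemma S_minimizes_lower: assumes "z \<in> S" "x \<in> D" shows "\<Phi>2 z \<le> \<Phi>2 x"
proof -
  have "composite f2 g2 z \<le> composite f2 g2 x"
    using assms by (auto simp: bilevel_solutions_def lower_solutions_def argmin_set_def)
  then show ?thesis using assms by (simp add: composite_eq S_in_D)
qed

lemma lower_solutions_iff:
  assumes "x \<in> D" "z \<in> S"
  shows "x \<in> lower_solutions f2 g2 \<longleftrightarrow> \<Phi>2 x \<le> \<Phi>2 z"
proof
  have "z \<in> lower_solutions f2 g2" using assms by (auto simp: bilevel_solutions_def argmin_set_def)
  then have z: "composite f2 g2 z \<le> composite f2 g2 y" for y
    by (auto simp: lower_solutions_def argmin_set_def)
  show "\<Phi>2 x \<le> \<Phi>2 z" if "x \<in> lower_solutions f2 g2"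
  proof -
    have "composite f2 g2 x \<le> composite f2 g2 z" using that by (auto simp: lower_solutions_def argmin_set_def)
    then show ?thesis using assms by (simp add: composite_eq S_in_D)
  qed
  show "x \<in> lower_solutions f2 g2" if "\<Phi>2 x \<le> \<Phi>2 z"
  proof -
    have "composite f2 g2 x \<le> composite f2 g2 z" using that assms by (simp add: composite_eq S_in_D)
    moreover have "composite f2 g2 x < \<infinity>" using assms D_iff by blast
    ultimately show ?thesis using z unfolding lower_solutions_def argmin_set_def by (auto intro: order_trans)
  qed
qed

lemma S_minimizes_upper:
  assumes "z \<in> S" "x \<in> D" "\<Phi>2 x \<le> \<Phi>2 z"
  shows "\<Phi>1 z \<le> \<Phi>1 x"
proof -
  have "x \<in> lower_solutions f2 g2" using assms lower_solutions_iff by blast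
  then have "composite f1 g1 z \<le> composite f1 g1 x"
    using assms by (auto simp: bilevel_solutions_def argmin_set_def)
  then show ?thesis using assms by (simp add: composite_eq S_in_D)
qed

lemma S_value: assumes "z \<in> S" shows "\<Phi>1 z = v1" "\<Phi>2 z = v2"
proof -
  define y where "y = (SOME z. z \<in> S)"
  have y: "y \<in> S" unfolding y_def using assms by (rule someI)
  have "\<Phi>2 z = \<Phi>2 y" using S_minimizes_lower[OF assms] S_minimizes_lower[OF y] assms y S_in_D by (meson antisym)
  moreover have "\<Phi>1 z = \<Phi>1 y"
    using S_minimizes_upper[OF assms, of y] S_minimizes_upper[OF y, of z] assms y S_in_D \<open>\<Phi>2 z = \<Phi>2 y\<close> by (auto intro: antisym)
  ultimately show "\<Phi>1 z = v1" "\<Phi>2 z = v2" by (simp_all add: v1_def v2_def y_def)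
qed

lemma \<Phi>2_ge: assumes "x \<in> D" shows "v2 \<le> \<Phi>2 x"
proof -
  obtain z where "z \<in> S" using S_nonempty by auto
  then show ?thesis using S_minimizes_lower[of z x] S_value[of z] assms by simp
qed

lemma S_iff: "x \<in> S \<longleftrightarrow> x \<in> D \<and> \<Phi>1 x \<le> v1 \<and> \<Phi>2 x \<le> v2"
proof
  assume x: "x \<in> D \<and> \<Phi>1 x \<le> v1 \<and> \<Phi>2 x \<le> v2"
  obtain z where z: "z \<in> S" using S_nonempty by auto
  have "x \<in> lower_solutions f2 g2" using x z lower_solutions_iff S_value by auto
  moreover have "composite f1 g1 x < \<infinity>" using x D_iff by auto
  moreover have "composite f1 g1 x \<le> composite f1 g1 y" if "y \<in> lower_solutions f2 g2" for y
  proof -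
    have "composite f1 g1 x \<le> composite f1 g1 z" using x z S_value S_in_D by (auto simp: composite_eq)
    also have "\<dots> \<le> composite f1 g1 y" using z that by (auto simp: bilevel_solutions_def argmin_set_def)
    finally show ?thesis .
  qed
  ultimately show "x \<in> S" by (auto simp: bilevel_solutions_def argmin_set_def)
qed (use S_in_D S_value in auto)

lemma inf_upper_eq: "inf_upper f1 f2 g1 g2 = ereal m1"
proof -
  obtain z where z: "z \<in> S" using S_nonempty by auto
  have "z \<in> ext_dom (composite f2 g2)" using S_in_D[OF z] D_iff by (auto simp: ext_dom_def)
  then have "inf_upper f1 f2 g1 g2 \<le> composite f1 g1 z" unfolding inf_upper_def by (rule INF_lower)
  then have "inf_upper f1 f2 g1 g2 \<le> ereal (\<Phi>1 z)" using S_in_D[OF z] by (simp add: composite_eq)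
  then show ?thesis using inf_upper_lower_bound unfolding m1_def
    by (cases "inf_upper f1 f2 g1 g2") auto
qed

lemma \<Phi>1_ge: assumes "x \<in> D" shows "m1 \<le> \<Phi>1 x"
proof -
  have "x \<in> ext_dom (composite f2 g2)" using assms D_iff by (auto simp: ext_dom_def)
  then have "inf_upper f1 f2 g1 g2 \<le> composite f1 g1 x" unfolding inf_upper_def by (rule INF_lower)
  then show ?thesis using assms by (simp add: composite_eq inf_upper_eq)
qed

lemma inf_lower_eq: "inf_lower f2 g2 = ereal v2"
proof -
  obtain z where z: "z \<in> S" using S_nonempty by auto
  have "composite f2 g2 z \<le> composite f2 g2 y" for y
    using z by (auto simp: bilevel_solutions_def lower_solutions_def argmin_set_def)
  then have "inf_lower f2 g2 = composite f2 g2 z"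
    unfolding inf_lower_def by (intro antisym INF_lower INF_greatest) auto
  then show ?thesis using z by (simp add: composite_eq S_in_D S_value)
qed

definition \<phi>bar :: "real \<Rightarrow> 'a \<Rightarrow> real" where
  "\<phi>bar s x = s * (\<Phi>1 x - m1) + (\<Phi>2 x - v2)"

lemma phi_bar_eq: "x \<in> D \<Longrightarrow> phi_bar f1 f2 g1 g2 s x = ereal (\<phi>bar s x)"
  by (simp add: phi_bar_def \<phi>bar_def composite_eq inf_upper_eq inf_lower_eq)

lemma \<phi>bar_nonneg: "x \<in> D \<Longrightarrow> 0 \<le> s \<Longrightarrow> 0 \<le> \<phi>bar s x"
  using \<Phi>1_ge[of x] \<Phi>2_ge[of x] by (simp add: \<phi>bar_def)

lemma \<phi>bar_mono: "x \<in> D \<Longrightarrow> s \<le> t \<Longrightarrow> \<phi>bar s x \<le> \<phi>bar t x"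
  using \<Phi>1_ge[of x] by (simp add: \<phi>bar_def mult_right_mono)

lemma f_continuous: "continuous_on UNIV f1" "continuous_on UNIV f2"
  using smooth by (auto simp: convex_loc_smooth_def continuous_on_eq_continuous_at
      intro: differentiable_imp_continuous_within)

lemma \<Phi>_limit_le:
  assumes u: "\<And>n. u n \<in> D" "u \<longlonglongrightarrow> l"
    and 1: "\<And>n. \<Phi>1 (u n) \<le> c n" "c \<longlonglongrightarrow> c'"
    and 2: "\<And>n. \<Phi>2 (u n) \<le> d n" "d \<longlonglongrightarrow> d'"
  shows "l \<in> D" "\<Phi>1 l \<le> c'" "\<Phi>2 l \<le> d'"
proof -
  have f: "(\<lambda>n. f1 (u n)) \<longlonglongrightarrow> f1 l" "(\<lambda>n. f2 (u n)) \<longlonglongrightarrow> f2 l"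
    using f_continuous u(2) by (auto intro: continuous_on_tendsto_compose)
  have "g1 (u n) \<le> ereal (c n - f1 (u n))" for n
    using g_eq(1)[OF u(1)[of n]] 1(1)[of n] unfolding \<Phi>1_def by (metis add.commute ereal_less_eq(3) le_diff_eq)
  then have g1: "g1 l \<le> ereal (c' - f1 l)"
    by (intro lower_semicont_limit_le[OF nonsmooth(2) u(2), where c = "\<lambda>n. c n - f1 (u n)"] tendsto_diff 1 f)
  have "g2 (u n) \<le> ereal (d n - f2 (u n))" for n
    using g_eq(2)[OF u(1)[of n]] 2(1)[of n] unfolding \<Phi>2_def by (metis add.commute ereal_less_eq(3) le_diff_eq)
  then have g2: "g2 l \<le> ereal (d' - f2 l)"
    by (intro lower_semicont_limit_le[OF nonsmooth(5) u(2), where c = "\<lambda>n. d n - f2 (u n)"] tendsto_diff 2 f)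
  show "l \<in> D" using g1 g2 by (auto simp: D_def intro: le_less_trans)
  then show "\<Phi>1 l \<le> c'" "\<Phi>2 l \<le> d'" using g1 g2 g_eq[of l] unfolding \<Phi>1_def \<Phi>2_def
    by (metis add.commute ereal_less_eq(3) le_diff_eq)+
qed

lemma convex_combination:
  assumes "x \<in> D" "y \<in> D" "0 \<le> t" "t \<le> 1"
  defines "z \<equiv> (1 - t) *\<^sub>R x + t *\<^sub>R y"
  shows "z \<in> D" "\<Phi>1 z \<le> (1 - t) * \<Phi>1 x + t * \<Phi>1 y" "\<Phi>2 z \<le> (1 - t) * \<Phi>2 x + t * \<Phi>2 y"
proof -
  note g = g_eq[OF assms(1)] g_eq[OF assms(2)]
  define a1 b1 a2 b2 where "a1 = real_of_ereal (g1 x)" "b1 = real_of_ereal (g1 y)"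
    "a2 = real_of_ereal (g2 x)" "b2 = real_of_ereal (g2 y)"
  note ab = g[folded this]
  have "g1 z \<le> ereal (1 - t) * g1 x + ereal t * g1 y" "g2 z \<le> ereal (1 - t) * g2 x + ereal t * g2 y"
    unfolding z_def using nonsmooth(3,6) assms(3,4) by (auto simp: ext_convex_def)
  then have le: "g1 z \<le> ereal ((1 - t) * a1 + t * b1)" "g2 z \<le> ereal ((1 - t) * a2 + t * b2)"
    by (simp_all add: ab)
  then show "z \<in> D" by (auto simp: D_def intro: le_less_trans)
  then have le': "real_of_ereal (g1 z) \<le> (1 - t) * a1 + t * b1" "real_of_ereal (g2 z) \<le> (1 - t) * a2 + t * b2"
    using le g_eq[of z] by (metis ereal_less_eq(3))+
  have f: "f1 z \<le> (1 - t) * f1 x + t * f1 y" "f2 z \<le> (1 - t) * f2 x + t * f2 y"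
    unfolding z_def using smooth assms(3,4) by (auto simp: convex_loc_smooth_def intro!: convex_onD)
  show "\<Phi>1 z \<le> (1 - t) * \<Phi>1 x + t * \<Phi>1 y" "\<Phi>2 z \<le> (1 - t) * \<Phi>2 x + t * \<Phi>2 y"
    using le' f by (simp_all add: \<Phi>1_def \<Phi>2_def ab algebra_simps)
qed

text \<open>Relaxing the lower level does not destroy boundedness. Suppose points \<open>y n\<close> of the set escape to infinity, and
  shrink them towards a solution \<open>z\<close> onto a sphere that encloses all solutions. By convexity the
  excess of \<open>\<Phi>2\<close> is scaled by the vanishing factor \<open>t n\<close>, so a limit point on the sphere would be a
  solution.\<close>

lemma level_set_bounded: "bounded {x \<in> D. \<Phi>1 x \<le> v1 \<and> \<Phi>2 x \<le> c}"
proof -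
  obtain z where z: "z \<in> S" using S_nonempty by auto
  note zv = S_value[OF z] S_in_D[OF z]
  obtain R where R: "0 < R" "\<And>x. x \<in> S \<Longrightarrow> norm (x - z) < R"
  proof -
    obtain B where "S \<subseteq> ball z B" "0 < B" using S_bounded bounded_subset_ballD by blast
    have "norm (x - z) < B" if "x \<in> S" for x
      using subsetD[OF \<open>S \<subseteq> ball z B\<close> that] by (simp add: dist_norm norm_minus_commute)
    then show ?thesis using that[of B] \<open>0 < B\<close> by blast
  qed
  show ?thesis
  proof (rule ccontr)
    assume unb: "\<not> ?thesis"
    have "\<exists>y\<in>D. \<Phi>1 y \<le> v1 \<and> \<Phi>2 y \<le> c \<and> R * Suc n \<le> norm (y - z)" for n :: nat
    proof (rule ccontr)
      assume "\<not> ?thesis"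
      then have "{x \<in> D. \<Phi>1 x \<le> v1 \<and> \<Phi>2 x \<le> c} \<subseteq> cball z (R * Suc n)"
        by (auto simp: dist_norm norm_minus_commute not_le less_imp_le)
      then show False using unb bounded_cball bounded_subset by blast
    qed
    then obtain y where y: "\<And>n. y n \<in> D" "\<And>n. \<Phi>1 (y n) \<le> v1" "\<And>n. \<Phi>2 (y n) \<le> c"
      "\<And>n::nat. R * Suc n \<le> norm (y n - z)" by metis
    define t where "t n = R / norm (y n - z)" for n
    define w where "w n = (1 - t n) *\<^sub>R z + t n *\<^sub>R y n" for n
    have pos: "0 < norm (y n - z)" for n
    proof -
      have "0 < R * Suc n" using \<open>0 < R\<close> by simp
      then show ?thesis using y(4)[of n] by linarith
    qed
    have t: "0 \<le> t n" "t n \<le> 1 / Suc n" for n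
    proof -
      show "0 \<le> t n" using \<open>0 < R\<close> by (simp add: t_def)
      show "t n \<le> 1 / Suc n" using y(4)[of n] pos[of n] by (simp add: t_def field_simps)
    qed
    have t1: "t n \<le> 1" for n using t(2)[of n] by (rule order_trans) simp
    have w: "w n \<in> D" "\<Phi>1 (w n) \<le> v1" "\<Phi>2 (w n) \<le> v2 + \<bar>c - v2\<bar> * (1 / Suc n)" for n
    proof -
      note cc = convex_combination[OF zv(3) y(1)[of n] t(1)[of n] t1[of n], folded w_def]
      show "w n \<in> D" by (rule cc)
      have "t n * \<Phi>1 (y n) \<le> t n * v1" using y(2) t by (intro mult_left_mono) auto
      then show "\<Phi>1 (w n) \<le> v1" using cc(2) zv by (simp add: algebra_simps)
      have "t n * (\<Phi>2 (y n) - v2) \<le> t n * \<bar>c - v2\<bar>" using y(3)[of n] t by (intro mult_left_mono) auto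
      also have "\<dots> \<le> 1 / Suc n * \<bar>c - v2\<bar>" using t by (intro mult_right_mono) auto
      finally show "\<Phi>2 (w n) \<le> v2 + \<bar>c - v2\<bar> * (1 / Suc n)" using cc(3) zv by (simp add: algebra_simps)
    qed
    have nw: "norm (w n - z) = R" for n
    proof -
      have "w n - z = t n *\<^sub>R (y n - z)" by (simp add: w_def algebra_simps)
      then show ?thesis using pos[of n] \<open>0 < R\<close> by (simp add: t_def)
    qed
    then have "w n \<in> sphere z R" for n by (simp add: dist_norm norm_minus_commute)
    then obtain l r where l: "l \<in> sphere z R" "strict_mono r" "(w \<circ> r) \<longlonglongrightarrow> l"
      using compact_sphere[of z R, unfolded compact_def, rule_format, of w] by blast
    have lim: "(\<lambda>n. v2 + \<bar>c - v2\<bar> * (1 / Suc (r n))) \<longlonglongrightarrow> v2 + \<bar>c - v2\<bar> * 0"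
      using LIMSEQ_subseq_LIMSEQ[OF LIMSEQ_inverse_real_of_nat l(2)]
      by (intro tendsto_intros) (simp add: o_def inverse_eq_divide)
    have "l \<in> D" "\<Phi>1 l \<le> v1" "\<Phi>2 l \<le> v2 + \<bar>c - v2\<bar> * 0"
      using \<Phi>_limit_le[of "w \<circ> r" l "\<lambda>_. v1" v1, OF _ l(3) _ _ _ lim] w by auto
    then have "l \<in> S" by (simp add: S_iff)
    then show False using R(2)[of l] l(1) by (simp add: dist_norm norm_minus_commute)
  qed
qed

lemma near_optimal_imp_near_S:
  assumes "0 < \<delta>"
  obtains \<epsilon> where "0 < \<epsilon>"
    "\<And>x. x \<in> D \<Longrightarrow> norm x \<le> R \<Longrightarrow> \<Phi>1 x \<le> v1 + \<epsilon> \<Longrightarrow> \<Phi>2 x \<le> v2 + \<epsilon> \<Longrightarrow> infdist x S < \<delta>"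
proof (rule ccontr)
  assume no: "\<not> thesis"
  have "\<exists>x\<in>D. norm x \<le> R \<and> \<Phi>1 x \<le> v1 + 1 / Suc n \<and> \<Phi>2 x \<le> v2 + 1 / Suc n \<and> \<delta> \<le> infdist x S" for n :: nat
  proof (rule ccontr)
    assume "\<not> ?thesis"
    then show False using no that[of "1 / Suc n"] by (force simp: not_le)
  qed
  then obtain x where x: "\<And>n. x n \<in> D" "\<And>n. norm (x n) \<le> R" "\<And>n::nat. \<Phi>1 (x n) \<le> v1 + 1 / Suc n"
    "\<And>n::nat. \<Phi>2 (x n) \<le> v2 + 1 / Suc n" "\<And>n. \<delta> \<le> infdist (x n) S" by metis
  have "x n \<in> cball 0 R" for n using x by simp
  then obtain l r where l: "strict_mono r" "(x \<circ> r) \<longlonglongrightarrow> l"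
    using compact_cball[of 0 R, unfolded compact_def, rule_format, of x] by blast
  have lim: "(\<lambda>n. v + 1 / Suc (r n)) \<longlonglongrightarrow> v + 0" for v :: real
    using LIMSEQ_subseq_LIMSEQ[OF LIMSEQ_inverse_real_of_nat l(1)]
    by (intro tendsto_intros) (simp add: o_def inverse_eq_divide)
  have "l \<in> D" "\<Phi>1 l \<le> v1 + 0" "\<Phi>2 l \<le> v2 + 0"
    using \<Phi>_limit_le[of "x \<circ> r" l "\<lambda>n. v1 + 1 / Suc (r n)" "v1 + 0" "\<lambda>n. v2 + 1 / Suc (r n)" "v2 + 0",
        OF _ l(2) _ lim _ lim] x by auto
  then have "infdist l S = 0" by (simp add: S_iff)
  moreover have "(\<lambda>n. infdist ((x \<circ> r) n) S) \<longlonglongrightarrow> infdist l S"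
    using l(2) by (intro tendsto_infdist)
  ultimately have "(\<lambda>n. infdist ((x \<circ> r) n) S) \<longlonglongrightarrow> 0" by simp
  then have "\<delta> \<le> 0" by (rule tendsto_lowerbound) (use x in auto)
  then show False using assms by simp
qed

lemma prox_step:
  fixes h :: "'a \<Rightarrow> real" and x :: 'a
  assumes "0 < s" "0 < a"
  defines "p \<equiv> prox_grad_step h (g_reg g1 g2 s) a x"
  shows "p \<in> D" "u \<in> D \<Longrightarrow> G s p + ((1 / a) *\<^sub>R (x - p) - grad h x) \<bullet> (u - p) \<le> G s u"
proof -
  obtain z where "z \<in> D" using S_nonempty S_in_D by auto
  then have z: "g1 z < \<infinity>" "g2 z < \<infinity>" by (auto simp: D_def)
  have "proper (g_reg g1 g2 s)" "lower_semicont (g_reg g1 g2 s)" "ext_convex (g_reg g1 g2 s)"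
    using nonsmooth assms(1) z by (auto intro: proper_g_reg lower_semicont_g_reg ext_convex_g_reg)
  note opt = prox_grad_step_optimality[OF this \<open>0 < a\<close>, where f = h and x = x, folded p_def]
  show "p \<in> D" using opt(1) assms(1) g_reg_finite_iff[of s p] by blast
  show "G s p + ((1 / a) *\<^sub>R (x - p) - grad h x) \<bullet> (u - p) \<le> G s u" if "u \<in> D"
  proof -
    have "g_reg g1 g2 s p + ereal (((1 / a) *\<^sub>R (x - p) - grad h x) \<bullet> (u - p)) \<le> g_reg g1 g2 s u"
      using opt(2) unfolding subdiff_def by blast
    then show ?thesis using that \<open>p \<in> D\<close> by (simp add: g_reg_eq)
  qed
qed

text \<open>The residual replaces \<open>grad (f s) x\<close> in the optimality condition by the gradient at the new point, and
  is thereby a subgradient of the whole objective there.\<close>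

lemma prox_step_residual:
  fixes x :: 'a
  assumes "0 < s" "0 < a"
  defines "p \<equiv> prox_grad_step (f s) (g_reg g1 g2 s) a x"
  defines "r \<equiv> (1 / a) *\<^sub>R (x - p) - (grad (f s) x - grad (f s) p)"
  shows "u \<in> D \<Longrightarrow> s * \<Phi>1 p + \<Phi>2 p + r \<bullet> (u - p) \<le> s * \<Phi>1 u + \<Phi>2 u"
    and "r \<in> subdiff (phi_reg f1 f2 g1 g2 s) p"
proof -
  note ps = prox_step[OF assms(1,2), where h = "f s" and x = x, folded p_def]
  have *: "s * \<Phi>1 p + \<Phi>2 p + r \<bullet> (u - p) \<le> s * \<Phi>1 u + \<Phi>2 u" if "u \<in> D" for u
    using ps(2)[OF that] convex_loc_smooth_tangent[OF smooth_f, of s p u] assms(1)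
    by (simp add: r_def inner_diff_left flip: \<Phi>_eq)
  then show "u \<in> D \<Longrightarrow> s * \<Phi>1 p + \<Phi>2 p + r \<bullet> (u - p) \<le> s * \<Phi>1 u + \<Phi>2 u" .
  show "r \<in> subdiff (phi_reg f1 f2 g1 g2 s) p"
    unfolding subdiff_def mem_Collect_eq
  proof
    fix u
    show "phi_reg f1 f2 g1 g2 s p + ereal (r \<bullet> (u - p)) \<le> phi_reg f1 f2 g1 g2 s u"
    proof (cases "u \<in> D")
      case True
      then show ?thesis using *[OF True] ps(1) by (simp add: phi_reg_eq)
    next
      case False
      then have "phi_reg f1 f2 g1 g2 s u = \<infinity>" using phi_reg_finite_iff[of s u] assms(1) by auto
      then show ?thesis by simp
    qed
  qed
qed

text \<open>How far the proximal point moves when the step size is increased from \<open>a\<close> to \<open>b\<close>. This is the reason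
  why the rejected trial points stay in the region on which the Lipschitz modulus is available.\<close>

lemma prox_step_path:
  fixes h :: "'a \<Rightarrow> real" and x :: 'a
  assumes "0 < s" "0 < a" "a \<le> b"
  defines "p \<equiv> prox_grad_step h (g_reg g1 g2 s) a x"
  defines "q \<equiv> prox_grad_step h (g_reg g1 g2 s) b x"
  shows "norm (q - p) \<le> (b / a - 1) * norm (x - p)"
proof -
  have "0 < b" using assms by linarith
  note P = prox_step[OF \<open>0 < s\<close> \<open>0 < a\<close>, where h = h and x = x, folded p_def]
  note Q = prox_step[OF \<open>0 < s\<close> \<open>0 < b\<close>, where h = h and x = x, folded q_def]
  have "0 \<le> ((1 / b) *\<^sub>R (x - q) - (1 / a) *\<^sub>R (x - p)) \<bullet> (q - p)"
    using P(2)[OF Q(1)] Q(2)[OF P(1)] by (simp add: inner_diff_left inner_diff_right)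
  then have "0 \<le> b * (((1 / b) *\<^sub>R (x - q) - (1 / a) *\<^sub>R (x - p)) \<bullet> (q - p))"
    using \<open>0 < b\<close> by simp
  also have "\<dots> = ((x - p) - (q - p)) \<bullet> (q - p) - (b / a) * ((x - p) \<bullet> (q - p))"
    using \<open>0 < b\<close> by (simp add: inner_diff_left right_diff_distrib)
  finally have "(norm (q - p))\<^sup>2 \<le> - ((b / a - 1) * ((x - p) \<bullet> (q - p)))"
    by (simp add: power2_norm_eq_inner inner_diff_left algebra_simps)
  also have "\<dots> = (b / a - 1) * (- (x - p) \<bullet> (q - p))"
    by (simp only: inner_minus_left mult_minus_right)
  also have "\<dots> \<le> (b / a - 1) * (norm (x - p) * norm (q - p))"
    using assms norm_cauchy_schwarz[of "- (x - p)" "q - p"]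
    by (intro mult_left_mono) (auto simp: norm_minus_commute)
  finally have "norm (q - p) * norm (q - p) \<le> ((b / a - 1) * norm (x - p)) * norm (q - p)"
    by (simp add: power2_eq_square mult.assoc)
  then show ?thesis using assms
    by (cases "norm (q - p) = 0") (auto simp: mult_le_cancel_right)
qed

end

section \<open>Inequalities for one and two proximal gradient steps\<close>

lemma ell_est_mult: "ell_est h x y * (norm (x - y))\<^sup>2 = (grad h x - grad h y) \<bullet> (x - y)"
  by (cases "x = y") (auto simp: ell_est_def)

lemma Lip_est_mult: "Lip_est h x y * norm (x - y) = norm (grad h x - grad h y)"
  by (cases "x = y") (auto simp: Lip_est_def)

lemma ell_est_nonneg: "convex_loc_smooth h \<Longrightarrow> 0 \<le> ell_est h x y"
  by (simp add: ell_est_def convex_loc_smooth_monotone)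

lemma Lip_est_nonneg: "0 \<le> Lip_est h x y"
  by (simp add: Lip_est_def)

lemma ell_est_le_Lip_est: "ell_est h x y \<le> Lip_est h x y"
proof (cases "x = y")
  case False
  have "(grad h x - grad h y) \<bullet> (x - y) \<le> norm (grad h x - grad h y) * norm (x - y)"
    by (rule norm_cauchy_schwarz)
  then show ?thesis using False by (simp add: ell_est_def Lip_est_def field_simps power2_eq_square)
qed (simp add: ell_est_def Lip_est_def)

context bilevel_problem
begin

lemma grad_f: "grad (f s) x = s *\<^sub>R grad f1 x + grad f2 x"
  using smooth by (intro grad_f_reg) (auto simp: convex_loc_smooth_def)

text \<open>Raising the parameter adds a multiple of \<open>f1\<close>, whose gradient is monotone.\<close>

lemma ell_est_mono:
  assumes "s \<le> t"
  shows "ell_est (f s) x y \<le> ell_est (f t) x y"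
proof -
  have "(grad (f t) x - grad (f t) y) \<bullet> (x - y)
    = (grad (f s) x - grad (f s) y) \<bullet> (x - y) + (t - s) * ((grad f1 x - grad f1 y) \<bullet> (x - y))"
    by (simp add: grad_f inner_diff_left inner_add_left algebra_simps)
  then show ?thesis using assms convex_loc_smooth_monotone[OF smooth(1), of x y]
    unfolding ell_est_def by (intro divide_right_mono) auto
qed

lemma ell_est_f2_le:
  assumes "0 \<le> s"
  shows "ell_est f2 x y \<le> ell_est (f s) x y"
proof -
  have "f 0 = f2" by (auto simp: f_reg_def)
  then show ?thesis using ell_est_mono[OF assms, of x y] by simp
qed

text \<open>Testing the residual with the previous point gives \<open>(1 / a - \<ell>)\<close> times the squared step length,
  where \<open>\<ell>\<close> is the local estimate, so the line search condition is all that is needed.\<close>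

lemma prox_step_descent:
  assumes "0 < s" "0 < a" "x \<in> D" and \<nu>: "a * ell_est (f s) x p \<le> \<nu>"
    and p: "p = prox_grad_step (f s) (g_reg g1 g2 s) a x"
  shows "s * \<Phi>1 p + \<Phi>2 p + (1 - \<nu>) / a * (norm (p - x))\<^sup>2 \<le> s * \<Phi>1 x + \<Phi>2 x"
proof -
  have "s * \<Phi>1 p + \<Phi>2 p + ((1 / a) *\<^sub>R (x - p) - (grad (f s) x - grad (f s) p)) \<bullet> (x - p) \<le> s * \<Phi>1 x + \<Phi>2 x"
    unfolding p by (rule prox_step_residual(1)[OF assms(1,2,3)])
  moreover have "((1 / a) *\<^sub>R (x - p) - (grad (f s) x - grad (f s) p)) \<bullet> (x - p)
    = (1 / a - ell_est (f s) x p) * (norm (x - p))\<^sup>2"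
  proof -
    have "((1 / a) *\<^sub>R (x - p) - (grad (f s) x - grad (f s) p)) \<bullet> (x - p)
      = (1 / a) * ((x - p) \<bullet> (x - p)) - (grad (f s) x - grad (f s) p) \<bullet> (x - p)"
      by (simp only: inner_diff_left inner_scaleR_left)
    then show ?thesis
      by (simp only: ell_est_mult[symmetric] power2_norm_eq_inner left_diff_distrib)
  qed
  moreover have "(1 - \<nu>) / a * (norm (x - p))\<^sup>2 \<le> (1 / a - ell_est (f s) x p) * (norm (x - p))\<^sup>2"
    using \<nu> \<open>0 < a\<close> by (intro mult_right_mono) (auto simp: field_simps)
  ultimately show ?thesis by (simp add: norm_minus_commute)
qed

text \<open>The basic estimate behind the Lyapunov function, for consecutive steps \<open>y \<mapsto> z \<mapsto> w\<close> with
  parameters \<open>s \<ge> t\<close>. The optimality condition of the second step is tested with a solution \<open>u\<close>. The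
  resulting model value at \<open>w\<close> is split as \<open>t / s\<close> times the objective with parameter \<open>s\<close>, plus
  \<open>1 - t / s\<close> times the lower objective. For the first part the optimality condition of the first
  step, tested with \<open>w\<close>, applies; the second part costs the term with \<open>ell_est f2 z w\<close>. The mixed
  product that remains is split by Young's inequality, and a multiple of the
  first step's residual inequality tested with \<open>y\<close> absorbs most of it, which leaves \<open>a\<^sup>2 L\<^sup>2 - a \<ell>\<close>
  as the coefficient of the squared length of the first step. The target \<open>T\<close> is arbitrary:
  its contributions cancel.\<close>

lemma two_step_inequality:
  assumes t: "0 < t" "t \<le> s" and a: "0 < a" and b: "0 < b" and y: "y \<in> D" and u: "u \<in> S"
    and z: "z = prox_grad_step (f s) (g_reg g1 g2 s) a y"
    and w: "w = prox_grad_step (f t) (g_reg g1 g2 t) b z"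
    and \<rho>: "\<rho> = t * b / (s * a)"
  shows "(norm (w - u))\<^sup>2 / 2 + (1 / 4 - (1 - t / s) * b * ell_est f2 z w) * (norm (w - z))\<^sup>2
      + t * b * (1 + \<rho>) * (\<Phi>1 z - T + (\<Phi>2 z - v2) / s) + t * b * (T - v1)
    \<le> (norm (z - u))\<^sup>2 / 2
      + \<rho>\<^sup>2 * (a\<^sup>2 * (Lip_est (f s) y z)\<^sup>2 - a * ell_est (f s) y z) * (norm (z - y))\<^sup>2
      + t * b * \<rho> * (\<Phi>1 y - T + (\<Phi>2 y - v2) / s)"
proof -
  have "0 < s" using t by linarith
  define \<theta> where "\<theta> = t / s"
  have \<theta>: "0 \<le> \<theta>" "\<theta> \<le> 1" "t = \<theta> * s" using t \<open>0 < s\<close> by (auto simp: \<theta>_def)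
  define \<Delta> where "\<Delta> = grad (f s) y - grad (f s) z"
  define r where "r = (1 / a) *\<^sub>R (y - z) - \<Delta>"
  define h where "h = a *\<^sub>R r"
  define N where "N = (norm (w - z))\<^sup>2"
  define d where "d = w - z"
  have uD: "u \<in> D" "\<Phi>1 u = v1" "\<Phi>2 u = v2" using u S_in_D S_value by auto
  have zD: "z \<in> D" unfolding z using \<open>0 < s\<close> a by (rule prox_step)
  have wD: "w \<in> D" unfolding w using t(1) b by (rule prox_step)
  have I1: "G t w + ((1 / b) *\<^sub>R (z - w) - grad (f t) z) \<bullet> (u - w) \<le> G t u"
    unfolding w by (rule prox_step(2)[OF t(1) b uD(1)])
  have C1: "f t z + grad (f t) z \<bullet> (u - z) \<le> f t u"
    using t(1) by (intro convex_loc_smooth_tangent smooth_f) auto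
  have I2: "G s z + ((1 / a) *\<^sub>R (y - z) - grad (f s) y) \<bullet> (w - z) \<le> G s w"
    unfolding z by (rule prox_step(2)[OF \<open>0 < s\<close> a wD])
  have I3: "s * \<Phi>1 z + \<Phi>2 z + r \<bullet> (y - z) \<le> s * \<Phi>1 y + \<Phi>2 y"
    unfolding r_def \<Delta>_def z by (rule prox_step_residual(1)[OF \<open>0 < s\<close> a y])
  have C2: "f2 w + grad f2 w \<bullet> (z - w) \<le> f2 z"
    by (rule convex_loc_smooth_tangent[OF smooth(2)])
  have gw: "real_of_ereal (g2 w) = \<Phi>2 w - f2 w" by (simp add: \<Phi>2_def)
  have J0: "G t w + f t z + grad (f t) z \<bullet> d + (1 / b) * ((z - w) \<bullet> (u - w)) \<le> t * v1 + v2"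
    using I1 C1 \<Phi>_eq[of t u] uD unfolding d_def
    by (simp add: inner_diff_left inner_diff_right diff_divide_distrib)
  have J1: "s * \<Phi>1 z + \<Phi>2 z + r \<bullet> d \<le> f s z + G s w + grad (f s) z \<bullet> d"
    using I2 \<Phi>_eq[of s z] by (simp add: d_def r_def \<Delta>_def inner_diff_left)
  have J2: "\<Phi>2 w - ell_est f2 z w * N \<le> f2 z + grad f2 z \<bullet> d + real_of_ereal (g2 w)"
    using C2 ell_est_mult[of f2 z w] unfolding gw
    by (simp add: d_def N_def norm_minus_commute[of w z] inner_diff_left inner_diff_right)
  have J2': "v2 - ell_est f2 z w * N \<le> f2 z + grad f2 z \<bullet> d + real_of_ereal (g2 w)"
    using J2 \<Phi>2_ge[OF wD] by linarith
  have "\<theta> * (s * \<Phi>1 z + \<Phi>2 z + r \<bullet> d) + (1 - \<theta>) * (v2 - ell_est f2 z w * N)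
    \<le> \<theta> * (f s z + G s w + grad (f s) z \<bullet> d) + (1 - \<theta>) * (f2 z + grad f2 z \<bullet> d + real_of_ereal (g2 w))"
    by (rule add_mono[OF mult_left_mono[OF J1] mult_left_mono[OF J2']]) (use \<theta> in auto)
  also have "\<dots> = G t w + f t z + grad (f t) z \<bullet> d"
    unfolding \<theta>(3) G_def f_reg_def grad_f by (simp add: inner_add_left algebra_simps)
  finally have "\<theta> * (s * \<Phi>1 z + \<Phi>2 z + r \<bullet> d) + (1 - \<theta>) * (v2 - ell_est f2 z w * N)
      + (1 / b) * ((z - w) \<bullet> (u - w)) \<le> t * v1 + v2"
    using J0 by linarith
  then have "b * (\<theta> * (s * \<Phi>1 z + \<Phi>2 z + r \<bullet> d) + (1 - \<theta>) * (v2 - ell_est f2 z w * N)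
      + (1 / b) * ((z - w) \<bullet> (u - w))) \<le> b * (t * v1 + v2)"
    using b by (intro mult_left_mono) auto
  then have K: "b * \<theta> * (s * \<Phi>1 z + \<Phi>2 z - v2) + b * \<theta> * (r \<bullet> d) - b * (1 - \<theta>) * ell_est f2 z w * N
      + (z - w) \<bullet> (u - w) \<le> b * t * v1"
    using b by (simp add: algebra_simps)
  have \<rho>_eq: "b * \<theta> = \<rho> * a" using a \<open>0 < s\<close> by (simp add: \<rho> \<theta>_def)
  have "0 \<le> \<rho>" using t a b \<open>0 < s\<close> by (simp add: \<rho>)
  have bs: "b * \<theta> * s = t * b" using \<theta>(3) by simp
  have P: "b * \<theta> * (s * \<Phi>1 p + \<Phi>2 p - v2) = t * b * (\<Phi>1 p + (\<Phi>2 p - v2) / s)" for p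
  proof -
    have "s * \<Phi>1 p + \<Phi>2 p - v2 = s * (\<Phi>1 p + (\<Phi>2 p - v2) / s)"
      using \<open>0 < s\<close> by (simp add: distrib_left)
    then show ?thesis unfolding bs[symmetric] by (simp only: mult.assoc)
  qed
  have Y: "b * \<theta> * (r \<bullet> d) \<ge> - (\<rho>\<^sup>2 * (norm h)\<^sup>2) - N / 4"
  proof -
    (* Young's inequality, with the weights that leave a quarter of the squared length of the second step *)
    have "0 \<le> (norm (\<rho> *\<^sub>R h + (1 / 2) *\<^sub>R d))\<^sup>2" by simp
    also have "\<dots> = \<rho>\<^sup>2 * (norm h)\<^sup>2 + \<rho> * (h \<bullet> d) + N / 4"
      unfolding N_def d_def[symmetric] power2_norm_eq_inner
      by (simp add: inner_add_left inner_add_right inner_commute power2_eq_square algebra_simps)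
    finally show ?thesis unfolding \<rho>_eq by (simp add: h_def mult_ac)
  qed
  have "\<rho> * (b * \<theta>) * (s * \<Phi>1 z + \<Phi>2 z + r \<bullet> (y - z)) \<le> \<rho> * (b * \<theta>) * (s * \<Phi>1 y + \<Phi>2 y)"
    using I3 \<open>0 \<le> \<rho>\<close> b \<theta> by (intro mult_left_mono) auto
  then have "\<rho> * (b * \<theta> * (s * \<Phi>1 z + \<Phi>2 z - v2)) + \<rho>\<^sup>2 * (h \<bullet> (y - z))
    \<le> \<rho> * (b * \<theta> * (s * \<Phi>1 y + \<Phi>2 y - v2))"
    unfolding h_def \<rho>_eq by (simp add: power2_eq_square algebra_simps)
  then have M: "\<rho> * (t * b * (\<Phi>1 z + (\<Phi>2 z - v2) / s)) + \<rho>\<^sup>2 * (h \<bullet> (y - z))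
    \<le> \<rho> * (t * b * (\<Phi>1 y + (\<Phi>2 y - v2) / s))"
    unfolding P .
  have H: "(norm h)\<^sup>2 - h \<bullet> (y - z) = (a\<^sup>2 * (Lip_est (f s) y z)\<^sup>2 - a * ell_est (f s) y z) * (norm (z - y))\<^sup>2"
  proof -
    have h: "h = (y - z) - a *\<^sub>R \<Delta>" using a by (simp add: h_def r_def scaleR_diff_right)
    have "(norm h)\<^sup>2 - h \<bullet> (y - z) = a\<^sup>2 * (\<Delta> \<bullet> \<Delta>) - a * (\<Delta> \<bullet> (y - z))"
      unfolding h power2_norm_eq_inner
      by (simp add: inner_diff_left inner_diff_right inner_commute power2_eq_square algebra_simps)
    also have "\<Delta> \<bullet> \<Delta> = (Lip_est (f s) y z)\<^sup>2 * (norm (z - y))\<^sup>2"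
      unfolding \<Delta>_def power2_norm_eq_inner[symmetric] Lip_est_mult[symmetric]
      by (simp add: power_mult_distrib norm_minus_commute)
    also have "\<Delta> \<bullet> (y - z) = ell_est (f s) y z * (norm (z - y))\<^sup>2"
      unfolding \<Delta>_def ell_est_mult[symmetric] by (simp add: norm_minus_commute)
    finally show ?thesis by (simp add: algebra_simps)
  qed
  have E: "(z - w) \<bullet> (u - w) = (norm (w - u))\<^sup>2 / 2 + N / 2 - (norm (z - u))\<^sup>2 / 2"
    unfolding N_def power2_norm_eq_inner
    by (simp add: inner_diff_left inner_diff_right inner_commute field_simps)
  have "\<rho>\<^sup>2 * (norm h)\<^sup>2 - \<rho>\<^sup>2 * (h \<bullet> (y - z))
    = \<rho>\<^sup>2 * (a\<^sup>2 * (Lip_est (f s) y z)\<^sup>2 - a * ell_est (f s) y z) * (norm (z - y))\<^sup>2"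
    unfolding mult.assoc H[symmetric] by (simp add: algebra_simps)
  then have "t * b * (\<Phi>1 z + (\<Phi>2 z - v2) / s) + \<rho> * (t * b * (\<Phi>1 z + (\<Phi>2 z - v2) / s))
      - b * (1 - \<theta>) * ell_est f2 z w * N + (norm (w - u))\<^sup>2 / 2 + N / 4 - (norm (z - u))\<^sup>2 / 2
    \<le> b * t * v1 + \<rho> * (t * b * (\<Phi>1 y + (\<Phi>2 y - v2) / s))
      + \<rho>\<^sup>2 * (a\<^sup>2 * (Lip_est (f s) y z)\<^sup>2 - a * ell_est (f s) y z) * (norm (z - y))\<^sup>2"
    using K[unfolded P E] Y M by linarith
  then show ?thesis unfolding N_def[symmetric] \<theta>_def[symmetric]
    by (simp add: algebra_simps add_divide_distrib diff_divide_distrib)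
qed

end

section \<open>Runs of the algorithm\<close>

text \<open>The passage from the extended-real definition of the trial step size, in which either term of the
  minimum may be infinite, to real inequalities.\<close>

lemma capped_step:
  fixes t1 t2 :: ereal
  assumes "0 < c" "0 < A" "0 < t1" "0 < t2"
  defines "b \<equiv> real_of_ereal (min (ereal A) (ereal c * min t1 t2))"
  shows "0 < b" "b \<le> A" "ereal b \<le> ereal c * t1" "ereal b \<le> ereal c * t2"
    "b = A \<or> ereal b = ereal c * t1 \<or> ereal b = ereal c * t2"
proof -
  define m where "m = ereal c * min t1 t2"
  have "0 < m" using assms by (auto simp: m_def min_def ereal_zero_less_0_iff)
  have b: "ereal b = min (ereal A) m"
    unfolding b_def m_def[symmetric] using \<open>0 < m\<close> by (cases m) (auto simp: min_def)
  have le: "m \<le> ereal c * t1" "m \<le> ereal c * t2"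
    using assms by (auto simp: m_def intro!: ereal_mult_left_mono)
  have "0 < min (ereal A) m" using \<open>0 < m\<close> \<open>0 < A\<close> by simp
  then show "0 < b" unfolding b[symmetric] by simp
  have "ereal b \<le> ereal A" unfolding b by simp
  then show "b \<le> A" by simp
  have "ereal b \<le> m" unfolding b by simp
  then show "ereal b \<le> ereal c * t1" "ereal b \<le> ereal c * t2" using le by (auto intro: order_trans)
  have "m = ereal c * t1 \<or> m = ereal c * t2" by (auto simp: m_def min_def)
  moreover have "ereal b = ereal A \<or> ereal b = m" unfolding b by (auto simp: min_def)
  ultimately show "b = A \<or> ereal b = ereal c * t1 \<or> ereal b = ereal c * t2" by auto
qed

locale adaBiM_run = bilevel_problem f1 f2 g1 g2
  for f1 f2 :: "'a::euclidean_space \<Rightarrow> real" and g1 g2 :: "'a \<Rightarrow> ereal" +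
  fixes \<eta> \<nu> \<alpha>max :: real and \<sigma> \<alpha> :: "int \<Rightarrow> real" and x :: "int \<Rightarrow> 'a"
  assumes run: "adaBiM f1 f2 g1 g2 \<eta> \<nu> \<alpha>max \<sigma> \<alpha> x"
begin

text \<open>The sequences reindexed by natural numbers. The local estimates \<open>l n\<close>, \<open>Lk n\<close> and \<open>l2 n\<close> and the ratio
  \<open>\<rho> n\<close> belong to the step from \<open>X n\<close> to \<open>X (Suc n)\<close>, so they are the quantities with index \<open>n + 1\<close> of
  the algorithm. The number \<open>d n\<close> is the one under the root in the denominator of the trial step size, and
  \<open>cap n\<close> is the value from which the backtracking for \<open>a (Suc n)\<close> starts.\<close>

definition X :: "nat \<Rightarrow> 'a" where "X n = x (int n)"
definition a :: "nat \<Rightarrow> real" where "a n = \<alpha> (int n)"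
definition s :: "nat \<Rightarrow> real" where "s n = \<sigma> (int n)"
definition l :: "nat \<Rightarrow> real" where "l n = ell_est (f (s (Suc n))) (X n) (X (Suc n))"
definition Lk :: "nat \<Rightarrow> real" where "Lk n = Lip_est (f (s (Suc n))) (X n) (X (Suc n))"
definition l2 :: "nat \<Rightarrow> real" where "l2 n = ell_est f2 (X n) (X (Suc n))"
definition \<rho> :: "nat \<Rightarrow> real" where "\<rho> n = s (Suc n) * a (Suc n) / (s n * a n)"
definition d :: "nat \<Rightarrow> real" where "d n = (a (Suc n))\<^sup>2 * (Lk n)\<^sup>2 - a (Suc n) * l n"
definition step :: "nat \<Rightarrow> real \<Rightarrow> 'a" where
  "step n b = prox_grad_step (f (s (Suc n))) (g_reg g1 g2 (s (Suc n))) b (X n)"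
definition cap :: "nat \<Rightarrow> real" where
  "cap n = real_of_ereal (min (ereal \<alpha>max) (alpha_hat f1 f2 \<sigma> \<alpha> x (int n)))"

abbreviation "l_init \<equiv> ell_est (f (s 0)) (x (-1)) (X 0)"
abbreviation "L_init \<equiv> Lip_est (f (s 0)) (x (-1)) (X 0)"
abbreviation "a_init \<equiv> \<alpha> (-1)"

lemma params: "0 < \<eta>" "\<eta> < 1" "0 < \<nu>" "\<nu> < 1" "0 < \<alpha>max" "0 < a 0" "0 < s 0" "\<sigma> (-1) = s 0"
  and X_0: "X 0 = prox_grad_step (f (s 0)) (g_reg g1 g2 (s 0)) (a 0) (x (-1))"
  and a_init_eq: "a_init = (if a 0 * l_init \<ge> 1 / 2 then a 0 else a 0 * ((a 0 * l_init)\<^sup>2 / (1 - (a 0 * l_init)\<^sup>2)))"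
proof -
  note init = run[unfolded adaBiM_def Let_def, THEN conjunct1]
  show "0 < \<eta>" "\<eta> < 1" "0 < \<nu>" "\<nu> < 1" "0 < \<alpha>max" "0 < a 0" "0 < s 0" "\<sigma> (-1) = s 0"
    and "X 0 = prox_grad_step (f (s 0)) (g_reg g1 g2 (s 0)) (a 0) (x (-1))"
    and "a_init = (if a 0 * l_init \<ge> 1 / 2 then a 0 else a 0 * ((a 0 * l_init)\<^sup>2 / (1 - (a 0 * l_init)\<^sup>2)))"
    unfolding X_def a_def s_def of_nat_0 using init by blast+
qed

lemma iteration:
  "s (Suc n) \<in> {3 / 4 * s n .. s n}"
  "a (Suc n) \<in> admissible_steps (f (s (Suc n))) (g_reg g1 g2 (s (Suc n))) \<eta> \<nu> (cap n) (X n)"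
  "b \<in> admissible_steps (f (s (Suc n))) (g_reg g1 g2 (s (Suc n))) \<eta> \<nu> (cap n) (X n) \<Longrightarrow> b \<le> a (Suc n)"
  "X (Suc n) = step n (a (Suc n))"
proof -
  have Suc: "int n + 1 = int (Suc n)" by simp
  have it: "\<forall>k\<ge>0. \<sigma> (k + 1) \<in> {3 / 4 * \<sigma> k .. \<sigma> k} \<and>
        (let f = f_reg f1 f2 (\<sigma> (k + 1));
             g = g_reg g1 g2 (\<sigma> (k + 1));
             b = real_of_ereal (min (ereal \<alpha>max) (alpha_hat f1 f2 \<sigma> \<alpha> x k));
             A = admissible_steps f g \<eta> \<nu> b (x k)
         in \<alpha> (k + 1) \<in> A \<and> (\<forall>a\<in>A. a \<le> \<alpha> (k + 1)) \<and>
            x (k + 1) = prox_grad_step f g (\<alpha> (k + 1)) (x k))"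
    using run unfolding adaBiM_def by blast
  have "0 \<le> int n" by simp
  from it[rule_format, OF this, unfolded Suc Let_def]
  show "s (Suc n) \<in> {3 / 4 * s n .. s n}"
  "a (Suc n) \<in> admissible_steps (f (s (Suc n))) (g_reg g1 g2 (s (Suc n))) \<eta> \<nu> (cap n) (X n)"
  "b \<in> admissible_steps (f (s (Suc n))) (g_reg g1 g2 (s (Suc n))) \<eta> \<nu> (cap n) (X n) \<Longrightarrow> b \<le> a (Suc n)"
  "X (Suc n) = step n (a (Suc n))"
    unfolding X_def a_def s_def cap_def step_def by blast+
qed

lemma s_pos: "0 < s n"
proof (induction n)
  case (Suc n)
  then show ?case using iteration(1)[of n] by auto
qed (simp add: params)

lemma s_Suc: "s (Suc n) \<le> s n" "3 / 4 * s n \<le> s (Suc n)"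
  using iteration(1)[of n] by auto

lemma s_ratio: "3 / 4 \<le> s (Suc n) / s n" "s (Suc n) / s n \<le> 1"
  using s_Suc[of n] s_pos[of n] by (simp_all add: pos_le_divide_eq)

lemma s_decreasing: "decseq s"
  using s_Suc by (intro decseq_SucI)

lemma s_le_s0: "s n \<le> s 0"
  using s_decreasing by (simp add: decseqD)

lemma smooth_s: "convex_loc_smooth (f (s n))"
  using s_pos by (intro smooth_f) (simp add: less_imp_le)

lemma l_nonneg: "0 \<le> l n"
  unfolding l_def using smooth_s by (rule ell_est_nonneg)

lemma l_init_nonneg: "0 \<le> l_init"
  using smooth_s by (rule ell_est_nonneg)

lemma l2_nonneg: "0 \<le> l2 n"
  unfolding l2_def using smooth(2) by (rule ell_est_nonneg)

lemma l2_le_l: "l2 n \<le> l n"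
  unfolding l_def l2_def using s_pos by (intro ell_est_f2_le) (rule less_imp_le)

lemma step_bound: "a (Suc n) * l n \<le> \<nu>"
  using iteration(2,4)[of n] by (auto simp: admissible_steps_def l_def step_def)

lemma step_le_cap: "0 < cap n \<Longrightarrow> 0 < a (Suc n) \<and> a (Suc n) \<le> cap n"
proof -
  assume c: "0 < cap n"
  obtain i :: nat where i: "a (Suc n) = \<eta> ^ i * cap n"
    using iteration(2)[of n] by (auto simp: admissible_steps_def)
  have "\<eta> ^ i \<le> 1" "0 < \<eta> ^ i" using params by (auto intro: power_le_one)
  then show ?thesis using c unfolding i by (auto simp: mult_le_cancel_right1)
qed

text \<open>The accepted step size is the largest admissible one, so undoing its last reduction by \<open>\<eta>\<close> gives a
  step size that failed the test.\<close>

lemma backtracking: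
  assumes c: "0 < cap n"
  obtains "a (Suc n) = cap n"
  | "\<nu> < a (Suc n) / \<eta> * ell_est (f (s (Suc n))) (X n) (step n (a (Suc n) / \<eta>))"
proof (cases "a (Suc n) = cap n")
  case False
  obtain i :: nat where i: "a (Suc n) = \<eta> ^ i * cap n"
    using iteration(2)[of n] by (auto simp: admissible_steps_def)
  then obtain j where j: "i = Suc j" using False by (cases i) auto
  have e: "a (Suc n) / \<eta> = \<eta> ^ j * cap n" using params by (simp add: i j)
  have "0 < a (Suc n)" using step_le_cap[OF c] by simp
  then have "a (Suc n) < a (Suc n) / \<eta>" using params by (simp add: field_simps)
  then have "a (Suc n) / \<eta> \<notin> admissible_steps (f (s (Suc n))) (g_reg g1 g2 (s (Suc n))) \<eta> \<nu> (cap n) (X n)"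
    using iteration(3)[of "a (Suc n) / \<eta>" n] by auto
  then show ?thesis using that(2) e by (auto simp: admissible_steps_def step_def not_le)
qed (rule that(1))

text \<open>Since \<open>\<sigma>\<close> loses at most a quarter per iteration, the quantity subtracted under the root in the
  numerator of the trial step size is at most \<open>a (Suc n) * l n\<close>, and hence at most \<open>\<nu>\<close>.\<close>

lemma damping_le: 
  assumes "0 \<le> a (Suc n)"
  shows "4 * (1 - s (Suc n) / s n) * a (Suc n) * l2 n \<le> \<nu>"
proof -
  have "4 * (1 - q) \<le> 1" if "3 / 4 \<le> q" for q :: real using that by simp
  from this[OF s_ratio(1)] have "4 * (1 - s (Suc n) / s n) * (a (Suc n) * l2 n) \<le> 1 * (a (Suc n) * l2 n)"
    by (rule mult_right_mono) (use assms l2_nonneg in auto)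
  also have "\<dots> \<le> a (Suc n) * l n" using assms l2_le_l by (simp add: mult_left_mono)
  also have "\<dots> \<le> \<nu>" by (rule step_bound)
  finally show ?thesis by (simp add: mult.assoc)
qed

text \<open>The radicand in the numerator of the second term of the minimum that defines \<open>cap (Suc n)\<close>, and the
  prefactor of that minimum.\<close>

definition "damp n = 1 - 4 * (1 - s (Suc n) / s n) * a (Suc n) * l2 n"
definition "factor n = s (Suc n) / s (Suc (Suc n)) * a (Suc n)"

text \<open>From the second trial step on, \<open>\<alpha>\<close> with the preceding index is positive and the first term of
  the minimum is finite; the very first trial step is treated separately in \<open>cap_0\<close>.\<close>

lemma cap_Suc:
  assumes "0 < a n" "0 < a (Suc n)"
  shows "0 < cap (Suc n)" "cap (Suc n) \<le> \<alpha>max"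
    "cap (Suc n) \<le> factor n * sqrt (s (Suc n) / s n * (1 + \<rho> n))"
    "0 < d n \<Longrightarrow> cap (Suc n) \<le> factor n * (sqrt (damp n) / (2 * sqrt (d n)))"
    "cap (Suc n) = \<alpha>max \<or> cap (Suc n) = factor n * sqrt (s (Suc n) / s n * (1 + \<rho> n))
      \<or> 0 < d n \<and> cap (Suc n) = factor n * (sqrt (damp n) / (2 * sqrt (d n)))"
proof -
  define t1 where "t1 = ereal (sqrt (s (Suc n) / s n * (1 + \<rho> n)))"
  define t2 where "t2 = (if d n \<le> 0 then \<infinity> else ereal (sqrt (damp n) / (2 * sqrt (d n))))"
  have pos: "0 < s n" "0 < s (Suc n)" "0 < s (Suc (Suc n))" by (rule s_pos)+
  have "0 < factor n" using pos assms by (simp add: factor_def)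
  have "0 < \<rho> n" using pos assms by (simp add: \<rho>_def)
  then have "0 < t1" using pos by (simp add: t1_def)
  have "0 < damp n" using damping_le[of n] assms params by (simp add: damp_def)
  then have "0 < t2" by (simp add: t2_def)
  have ah: "alpha_hat f1 f2 \<sigma> \<alpha> x (int (Suc n)) = ereal (factor n) * min t1 t2"
  proof -
    have i: "int (Suc n) - 1 = int n" "int (Suc n) + 1 = int (Suc (Suc n))" by auto
    show ?thesis using assms pos
      unfolding alpha_hat_def Let_def i
      unfolding X_def[symmetric] a_def[symmetric] s_def[symmetric]
      unfolding l_def[symmetric] Lk_def[symmetric] l2_def[symmetric] d_def[symmetric] \<rho>_def[symmetric]
        damp_def[symmetric] factor_def[symmetric]
      by (simp add: t1_def t2_def max_def)
  qed
  note cs = capped_step[OF \<open>0 < factor n\<close> params(5) \<open>0 < t1\<close> \<open>0 < t2\<close>, folded ah, folded cap_def]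
  show "0 < cap (Suc n)" "cap (Suc n) \<le> \<alpha>max" using cs(1,2) .
  show "cap (Suc n) \<le> factor n * sqrt (s (Suc n) / s n * (1 + \<rho> n))"
    using cs(3) by (simp add: t1_def)
  show "cap (Suc n) \<le> factor n * (sqrt (damp n) / (2 * sqrt (d n)))" if "0 < d n"
    using cs(4) that by (simp add: t2_def)
  have "d n \<le> 0 \<Longrightarrow> ereal (cap (Suc n)) \<noteq> ereal (factor n) * t2"
    using \<open>0 < factor n\<close> by (simp add: t2_def)
  then show "cap (Suc n) = \<alpha>max \<or> cap (Suc n) = factor n * sqrt (s (Suc n) / s n * (1 + \<rho> n))
      \<or> 0 < d n \<and> cap (Suc n) = factor n * (sqrt (damp n) / (2 * sqrt (d n)))"
    using cs(5) by (cases "d n \<le> 0") (auto simp: t1_def t2_def)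
qed

definition "d_init = (a 0)\<^sup>2 * L_init\<^sup>2 - a 0 * l_init"

lemma a_init_nonneg: "0 \<le> a_init"
proof (cases "a 0 * l_init \<ge> 1 / 2")
  case False
  have "0 \<le> a 0 * l_init" using params l_init_nonneg by simp
  then have "(a 0 * l_init)\<^sup>2 \<le> 1" using False by (intro power_le_one) auto
  then show ?thesis using False params by (simp add: a_init_eq)
qed (use params in \<open>simp add: a_init_eq\<close>)

lemma cap_0:
  shows "0 < cap 0" "cap 0 \<le> \<alpha>max"
    "cap 0 = \<alpha>max \<or> a_init \<noteq> 0 \<and> cap 0 = s 0 / s 1 * a 0 * sqrt (1 + a 0 / a_init)
      \<or> 0 < d_init \<and> cap 0 = s 0 / s 1 * a 0 * (1 / (2 * sqrt d_init))"
proof -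
  define t1 where "t1 = (if a_init = 0 then \<infinity> else ereal (sqrt (1 + a 0 / a_init)))"
  define t2 where "t2 = (if d_init \<le> 0 then \<infinity> else ereal (1 / (2 * sqrt d_init)))"
  define c where "c = s 0 / s 1 * a 0"
  have pos: "0 < s 0" "0 < s 1" by (rule s_pos)+
  have "0 < c" using pos params by (simp add: c_def)
  have "0 < 1 + a 0 / a_init" using a_init_nonneg params(6) by (simp add: add_pos_nonneg)
  then have "0 < t1" by (simp add: t1_def)
  have "0 < t2" by (simp add: t2_def)
  have ah: "alpha_hat f1 f2 \<sigma> \<alpha> x (int 0) = ereal c * min t1 t2"
  proof -
    have i: "int 0 - 1 = - 1" "int 0 + 1 = int 1" by auto
    show ?thesis using pos
      unfolding alpha_hat_def Let_def i params(8)
      unfolding X_def[symmetric] a_def[symmetric] s_def[symmetric] d_init_def[symmetric] c_def[symmetric]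
      by (simp add: t1_def t2_def max_def)
  qed
  note cs = capped_step[OF \<open>0 < c\<close> params(5) \<open>0 < t1\<close> \<open>0 < t2\<close>, folded ah, folded cap_def]
  show "0 < cap 0" "cap 0 \<le> \<alpha>max" using cs(1,2) .
  have "d_init \<le> 0 \<Longrightarrow> ereal (cap 0) \<noteq> ereal c * t2" "a_init = 0 \<Longrightarrow> ereal (cap 0) \<noteq> ereal c * t1"
    using \<open>0 < c\<close> by (simp_all add: t1_def t2_def)
  then show "cap 0 = \<alpha>max \<or> a_init \<noteq> 0 \<and> cap 0 = s 0 / s 1 * a 0 * sqrt (1 + a 0 / a_init)
      \<or> 0 < d_init \<and> cap 0 = s 0 / s 1 * a 0 * (1 / (2 * sqrt d_init))"
    using cs(5) unfolding c_def[symmetric] by (cases "d_init \<le> 0"; cases "a_init = 0") (auto simp: t1_def t2_def)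
qed

lemma a_pos: "0 < a n"
proof -
  have "0 < a n \<and> 0 < a (Suc n)"
  proof (induction n)
    case 0
    show ?case using params(6) cap_0(1) step_le_cap by blast
  next
    case (Suc n)
    then show ?case using cap_Suc(1)[of n] step_le_cap by blast
  qed
  then show ?thesis ..
qed

lemma cap_pos: "0 < cap n"
  using cap_0(1) cap_Suc(1)[OF a_pos a_pos] by (cases n) auto

lemma cap_le: "cap n \<le> \<alpha>max"
  using cap_0(2) cap_Suc(2)[OF a_pos a_pos] by (cases n) auto

lemma a_le_cap: "a (Suc n) \<le> cap n"
  using step_le_cap[OF cap_pos] by blast

lemma a_le_\<alpha>max: "a (Suc n) \<le> \<alpha>max"
  using a_le_cap cap_le by (rule order_trans)

lemma \<rho>_pos: "0 < \<rho> n"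
  using s_pos a_pos by (simp add: \<rho>_def)

text \<open>The two terms of the minimum in the form in which the Lyapunov argument uses them: dividing \<open>a\<close> by
  \<open>factor\<close> turns the bounds on the step sizes into bounds on their ratio.\<close>

lemma \<rho>_power2_le:
  "(\<rho> (Suc n))\<^sup>2 \<le> s (Suc n) / s n * (1 + \<rho> n)"
  "(\<rho> (Suc n))\<^sup>2 * d n \<le> damp n / 4"
proof -
  note pos = s_pos[of n] s_pos[of "Suc n"] s_pos[of "Suc (Suc n)"] a_pos[of "Suc n"]
  have "0 < factor n" using pos by (simp add: factor_def)
  have r: "\<rho> (Suc n) = a (Suc (Suc n)) / factor n"
    using pos by (simp add: \<rho>_def factor_def field_simps)
  have 1: "\<rho> (Suc n) \<le> c" if "cap (Suc n) \<le> factor n * c" for c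
    using a_le_cap[of "Suc n"] that \<open>0 < factor n\<close> unfolding r by (simp add: field_simps)
  have nn: "0 \<le> \<rho> (Suc n)" "0 \<le> s (Suc n) / s n * (1 + \<rho> n)" "0 \<le> damp n"
    using \<rho>_pos[of n] \<rho>_pos[of "Suc n"] pos damping_le[of n] params by (auto simp: damp_def)
  show "(\<rho> (Suc n))\<^sup>2 \<le> s (Suc n) / s n * (1 + \<rho> n)"
    using 1[OF cap_Suc(3)[OF a_pos a_pos]] nn by (metis real_sqrt_pow2 power_mono)
  show "(\<rho> (Suc n))\<^sup>2 * d n \<le> damp n / 4"
  proof (cases "0 < d n")
    case True
    have "(\<rho> (Suc n))\<^sup>2 \<le> (sqrt (damp n) / (2 * sqrt (d n)))\<^sup>2"
      using 1[OF cap_Suc(4)[OF a_pos a_pos True]] nn by (intro power_mono) auto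
    also have "\<dots> = damp n / (4 * d n)" using True nn by (simp add: power_divide power_mult_distrib)
    finally show ?thesis using True by (simp add: field_simps)
  next
    case False
    then have "(\<rho> (Suc n))\<^sup>2 * d n \<le> 0" by (simp add: mult_nonneg_nonpos)
    then show ?thesis using nn by linarith
  qed
qed

text \<open>The recursion \<open>\<rho>\<^sub>k\<^sub>+\<^sub>1\<^sup>2 \<le> 1 + \<rho>\<^sub>k\<close> preserves every bound \<open>R\<close> with \<open>1 + R \<le> R\<^sup>2\<close>, for example every
  \<open>R \<ge> 2\<close>.\<close>

lemma \<rho>_bounded: obtains R where "\<And>n. \<rho> n \<le> R" "0 \<le> R"
proof -
  define R where "R = max 2 (\<rho> 0)"
  have "\<rho> n \<le> R" for n
  proof (induction n)
    case (Suc n)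
    have q: "0 \<le> s (Suc n) / s n" "s (Suc n) / s n \<le> 1" using s_Suc[of n] s_pos[of n] s_pos[of "Suc n"] by auto
    have "(\<rho> (Suc n))\<^sup>2 \<le> s (Suc n) / s n * (1 + \<rho> n)" by (rule \<rho>_power2_le)
    also have "\<dots> \<le> 1 * (1 + R)" using q Suc \<rho>_pos[of n] by (intro mult_mono) auto
    also have "\<dots> \<le> R\<^sup>2"
    proof -
      have "2 * R \<le> R * R" by (intro mult_right_mono) (auto simp: R_def)
      moreover have "2 \<le> R" by (simp add: R_def)
      then have "1 * (1 + R) \<le> 2 * R" by simp
      ultimately show ?thesis unfolding power2_eq_square by (meson order_trans)
    qed
    finally show ?case by (rule power2_le_imp_le) (simp add: R_def)
  qed (simp add: R_def)
  then show ?thesis using that[of R] by (simp add: R_def)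
qed

lemma X_in_D: "X n \<in> D"
proof (cases n)
  case 0
  then show ?thesis using X_0 prox_step(1)[OF params(7,6)] by simp
next
  case (Suc m)
  then show ?thesis using iteration(4)[of m] prox_step(1)[OF s_pos a_pos] by (simp add: step_def)
qed

definition \<delta> :: "nat \<Rightarrow> real" where "\<delta> n = norm (X (Suc n) - X n)"

lemma descent:
  "\<phi>bar (s (Suc n)) (X (Suc n)) + (1 - \<nu>) / a (Suc n) * (\<delta> n)\<^sup>2 \<le> \<phi>bar (s n) (X n)"
proof -
  have "s (Suc n) * \<Phi>1 (X (Suc n)) + \<Phi>2 (X (Suc n)) + (1 - \<nu>) / a (Suc n) * (norm (X (Suc n) - X n))\<^sup>2
    \<le> s (Suc n) * \<Phi>1 (X n) + \<Phi>2 (X n)"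
    using step_bound[of n] iteration(4)[of n]
    by (intro prox_step_descent s_pos a_pos X_in_D) (auto simp: l_def step_def)
  then have "\<phi>bar (s (Suc n)) (X (Suc n)) + (1 - \<nu>) / a (Suc n) * (\<delta> n)\<^sup>2 \<le> \<phi>bar (s (Suc n)) (X n)"
    by (simp add: \<phi>bar_def \<delta>_def algebra_simps)
  then show ?thesis using \<phi>bar_mono[OF X_in_D s_Suc(1), of n n] by linarith
qed

lemma descent_sum:
  "\<phi>bar (s K) (X K) + (\<Sum>k<K. (1 - \<nu>) / a (Suc k) * (\<delta> k)\<^sup>2) \<le> \<phi>bar (s 0) (X 0)"
proof (induction K)
  case (Suc K)
  then show ?case using descent[of K] by simp
qed simp

lemma \<phi>bar_X_nonneg: "0 \<le> \<phi>bar (s n) (X n)"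
  using X_in_D s_pos by (intro \<phi>bar_nonneg) (auto simp: less_imp_le)

lemma descent_sum': "(\<Sum>k\<le>K. (\<delta> k)\<^sup>2 / a (Suc k)) \<le> \<phi>bar (s 0) (X 0) / (1 - \<nu>)"
proof -
  have "(\<Sum>k<Suc K. (1 - \<nu>) / a (Suc k) * (\<delta> k)\<^sup>2) \<le> \<phi>bar (s 0) (X 0)"
    using descent_sum[of "Suc K"] \<phi>bar_X_nonneg[of "Suc K"] by linarith
  also have "(\<Sum>k<Suc K. (1 - \<nu>) / a (Suc k) * (\<delta> k)\<^sup>2) = (1 - \<nu>) * (\<Sum>k\<le>K. (\<delta> k)\<^sup>2 / a (Suc k))"
    unfolding sum_distrib_left lessThan_Suc_atMost by (rule sum.cong) auto
  finally show ?thesis using params by (simp add: field_simps)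
qed

lemma \<delta>_sum_le: "(\<Sum>k\<le>K. (\<delta> k)\<^sup>2) \<le> \<alpha>max * (\<phi>bar (s 0) (X 0) / (1 - \<nu>))"
proof -
  have "(\<delta> k)\<^sup>2 \<le> \<alpha>max * ((\<delta> k)\<^sup>2 / a (Suc k))" for k
    using mult_right_mono[OF a_le_\<alpha>max[of k], of "(\<delta> k)\<^sup>2"] a_pos[of "Suc k"] by (simp add: field_simps)
  then have "(\<Sum>k\<le>K. (\<delta> k)\<^sup>2) \<le> (\<Sum>k\<le>K. \<alpha>max * ((\<delta> k)\<^sup>2 / a (Suc k)))" by (rule sum_mono)
  also have "\<dots> = \<alpha>max * (\<Sum>k\<le>K. (\<delta> k)\<^sup>2 / a (Suc k))" by (simp add: sum_distrib_left)
  also have "\<dots> \<le> \<alpha>max * (\<phi>bar (s 0) (X 0) / (1 - \<nu>))"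
    using descent_sum' params by (intro mult_left_mono) auto
  finally show ?thesis .
qed

lemma \<delta>_summable: "summable (\<lambda>n. (\<delta> n)\<^sup>2)"
proof (rule summableI_nonneg_bounded)
  fix K
  have "(\<Sum>k<K. (\<delta> k)\<^sup>2) \<le> (\<Sum>k\<le>K. (\<delta> k)\<^sup>2)" by (rule sum_mono2) auto
  then show "(\<Sum>k<K. (\<delta> k)\<^sup>2) \<le> \<alpha>max * (\<phi>bar (s 0) (X 0) / (1 - \<nu>))"
    using \<delta>_sum_le[of K] by linarith
qed simp

lemma \<delta>_tendsto_0: "\<delta> \<longlonglongrightarrow> 0"
proof -
  have "(\<lambda>n. sqrt ((\<delta> n)\<^sup>2)) \<longlonglongrightarrow> sqrt 0"
    by (intro tendsto_real_sqrt summable_LIMSEQ_zero \<delta>_summable)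
  moreover have "sqrt ((\<delta> n)\<^sup>2) = \<delta> n" for n by (simp add: \<delta>_def)
  ultimately show ?thesis by simp
qed

end

section \<open>A Lyapunov function and boundedness of the iterates\<close>

lemma nonneg_null_sequence_attains_max:
  fixes u :: "nat \<Rightarrow> real"
  assumes nn: "\<And>n. 0 \<le> u n" and u: "u \<longlonglongrightarrow> 0"
  obtains k where "\<And>n. u n \<le> u k"
proof (cases "\<forall>n. u n = 0")
  case True
  then show ?thesis by (intro that[of 0]) simp
next
  case False
  then obtain m where "u m \<noteq> 0" by blast
  then have "0 < u m" using nn[of m] by simp
  with u have "\<forall>\<^sub>F n in sequentially. u n < u m" by (rule order_tendstoD(2))
  then obtain N where N: "\<And>n. N \<le> n \<Longrightarrow> u n < u m" by (auto simp: eventually_sequentially)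
  have "Max (u ` {..max N m}) \<in> u ` {..max N m}" by (rule Max_in) auto
  then obtain k where "u k = Max (u ` {..max N m})" by force
  then have k: "u n \<le> u k" if "n \<in> {..max N m}" for n using that by simp
  have "u n \<le> u k" for n
  proof (cases "n \<le> max N m")
    case True
    then show ?thesis by (intro k) simp
  next
    case False
    then have "u n < u m" by (intro N) simp
    also have "u m \<le> u k" by (intro k) simp
    finally show ?thesis by simp
  qed
  then show ?thesis by (rule that)
qed

context adaBiM_run
begin

text \<open>The Lyapunov function \<open>U\<close> for the target value \<open>T\<close>. Truncating the upper-level excess at zero in \<open>Q\<close>
  keeps \<open>U\<close> nonnegative and lets \<open>U_decrease\<close> cover a step whose predecessor \<open>X n\<close> is below the target, so
  that an excursion above \<open>T\<close> can be followed from the last iterate below \<open>T\<close>.\<close>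

definition Q :: "real \<Rightarrow> nat \<Rightarrow> real" where
  "Q T n = max 0 (\<Phi>1 (X n) - T) + (\<Phi>2 (X n) - v2) / s n"

definition U :: "real \<Rightarrow> 'a \<Rightarrow> nat \<Rightarrow> real" where
  "U T u n = (norm (X (Suc n) - u))\<^sup>2 / 2 + damp n / 4 * (\<delta> n)\<^sup>2 + s (Suc n) * a (Suc n) * (1 + \<rho> n) * Q T n"

lemma Q_nonneg: "0 \<le> Q T n"
  using \<Phi>2_ge[OF X_in_D, of n] s_pos[of n] by (simp add: Q_def)

lemma damp_bounds: "0 < damp n" "damp n \<le> 1"
proof -
  show "0 < damp n" using damping_le[of n] a_pos[of "Suc n"] params by (simp add: damp_def)
  have "0 \<le> 4 * (1 - s (Suc n) / s n) * a (Suc n) * l2 n"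
    using s_ratio[of n] a_pos[of "Suc n"] l2_nonneg[of n] by simp
  then show "damp n \<le> 1" by (simp add: damp_def)
qed

lemma U_ge: "(norm (X (Suc n) - u))\<^sup>2 / 2 \<le> U T u n"
  using Q_nonneg[of T n] damp_bounds(1)[of n] s_pos[of "Suc n"] a_pos[of "Suc n"] \<rho>_pos[of n]
  by (simp add: U_def)

text \<open>The first bound in \<open>\<rho>_power2_le\<close> absorbs the term with the old objective value, after the
  change from \<open>s n\<close> to \<open>s (Suc n)\<close> has cost the factor \<open>\<kappa>\<close>; the second one absorbs the term with the
  old squared step length. At the point \<open>X (Suc n)\<close> above the target, the truncation in \<open>Q\<close> is inactive.\<close>

lemma U_decrease:
  assumes u: "u \<in> S" and T: "T \<le> \<Phi>1 (X (Suc n))"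
  shows "U T u (Suc n) + s (Suc (Suc n)) * a (Suc (Suc n)) * (T - v1) \<le> U T u n"
proof -
  define t where "t = s (Suc (Suc n))"
  define b where "b = a (Suc (Suc n))"
  define P where "P = \<Phi>1 (X n) - T + (\<Phi>2 (X n) - v2) / s (Suc n)"
  define \<kappa> where "\<kappa> = s n / s (Suc n)"
  note pos = s_pos[of n] s_pos[of "Suc n"] s_pos[of "Suc (Suc n)"] a_pos[of "Suc n"] a_pos[of "Suc (Suc n)"]
    \<rho>_pos[of n] \<rho>_pos[of "Suc n"]
  have two: "(norm (X (Suc (Suc n)) - u))\<^sup>2 / 2 + (1 / 4 - (1 - t / s (Suc n)) * b * l2 (Suc n)) * (\<delta> (Suc n))\<^sup>2
      + t * b * (1 + \<rho> (Suc n)) * (\<Phi>1 (X (Suc n)) - T + (\<Phi>2 (X (Suc n)) - v2) / s (Suc n)) + t * b * (T - v1)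
    \<le> (norm (X (Suc n) - u))\<^sup>2 / 2 + (\<rho> (Suc n))\<^sup>2 * d n * (\<delta> n)\<^sup>2 + t * b * \<rho> (Suc n) * P"
    unfolding \<delta>_def d_def l_def Lk_def l2_def P_def
    by (rule two_step_inequality[where s = "s (Suc n)" and a = "a (Suc n)"])
       (use pos s_Suc X_in_D u iteration(4) in \<open>simp_all add: t_def b_def step_def \<rho>_def\<close>)
  have z: "\<Phi>1 (X (Suc n)) - T + (\<Phi>2 (X (Suc n)) - v2) / s (Suc n) = Q T (Suc n)"
    using T by (simp add: Q_def)
  have damp: "1 / 4 - (1 - t / s (Suc n)) * b * l2 (Suc n) = damp (Suc n) / 4"
    by (simp add: damp_def t_def b_def)
  have "(\<rho> (Suc n))\<^sup>2 * d n * (\<delta> n)\<^sup>2 \<le> damp n / 4 * (\<delta> n)\<^sup>2"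
    using \<rho>_power2_le(2)[of n] by (rule mult_right_mono) simp
  moreover have "t * b * \<rho> (Suc n) * P \<le> s (Suc n) * a (Suc n) * (1 + \<rho> n) * Q T n"
  proof -
    have "1 \<le> \<kappa>" using pos s_Suc[of n] by (simp add: \<kappa>_def)
    have "\<Phi>1 (X n) - T \<le> \<kappa> * max 0 (\<Phi>1 (X n) - T)"
      using mult_right_mono[OF \<open>1 \<le> \<kappa>\<close>, of "max 0 (\<Phi>1 (X n) - T)"] by simp
    then have "P \<le> \<kappa> * Q T n"
      using pos by (simp add: P_def Q_def \<kappa>_def distrib_left)
    then have "(\<rho> (Suc n))\<^sup>2 * P \<le> (\<rho> (Suc n))\<^sup>2 * (\<kappa> * Q T n)"
      by (rule mult_left_mono) simp
    also have "\<dots> \<le> (s (Suc n) / s n * (1 + \<rho> n)) * (\<kappa> * Q T n)"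
      using \<rho>_power2_le(1)[of n] Q_nonneg[of T n] \<open>1 \<le> \<kappa>\<close> by (intro mult_right_mono) auto
    also have "\<dots> = (1 + \<rho> n) * Q T n" using pos by (simp add: \<kappa>_def)
    finally have "s (Suc n) * a (Suc n) * ((\<rho> (Suc n))\<^sup>2 * P) \<le> s (Suc n) * a (Suc n) * ((1 + \<rho> n) * Q T n)"
      using pos by (intro mult_left_mono) auto
    moreover have "t * b = \<rho> (Suc n) * (s (Suc n) * a (Suc n))"
      using pos by (simp add: \<rho>_def t_def b_def)
    ultimately show ?thesis by (simp add: power2_eq_square mult_ac)
  qed
  ultimately show ?thesis
    using two[unfolded damp z] unfolding U_def t_def b_def by linarith
qed

lemma U_excursion:
  assumes u: "u \<in> S" and T: "v1 \<le> T" and jk: "j \<le> k"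
    and above: "\<And>i. j < i \<Longrightarrow> i \<le> k \<Longrightarrow> T \<le> \<Phi>1 (X i)"
  shows "U T u k \<le> U T u j"
  using jk above
proof (induction k rule: dec_induct)
  case (step k)
  have "U T u (Suc k) + s (Suc (Suc k)) * a (Suc (Suc k)) * (T - v1) \<le> U T u k"
    using step by (intro U_decrease u) auto
  moreover have "0 \<le> s (Suc (Suc k)) * a (Suc (Suc k)) * (T - v1)"
    using T s_pos[of "Suc (Suc k)"] a_pos[of "Suc (Suc k)"] by simp
  moreover have "U T u k \<le> U T u j" using step by simp
  ultimately show ?case by linarith
qed simp

text \<open>At a visit below the target only the lower-level excess enters \<open>Q\<close>. Its weight \<open>1 / s j\<close>, which is
  unbounded, is compensated by the factor \<open>s (Suc j)\<close> of the step size.\<close>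

lemma U_below_target:
  assumes R: "\<And>n. \<rho> n \<le> R" and T: "\<Phi>1 (X j) < T"
  shows "U T u j \<le> (norm (X (Suc j) - u))\<^sup>2 / 2 + (\<delta> j)\<^sup>2 / 4 + \<alpha>max * (1 + R) * (\<Phi>2 (X j) - v2)"
proof -
  note pos = s_pos[of j] s_pos[of "Suc j"] a_pos[of "Suc j"] \<rho>_pos[of j] \<Phi>2_ge[OF X_in_D, of j]
  have "damp j / 4 * (\<delta> j)\<^sup>2 \<le> 1 / 4 * (\<delta> j)\<^sup>2"
    using damp_bounds(2)[of j] by (intro mult_right_mono) auto
  moreover have "s (Suc j) * a (Suc j) * (1 + \<rho> j) * Q T j \<le> \<alpha>max * (1 + R) * (\<Phi>2 (X j) - v2)"
  proof -
    have "s (Suc j) * a (Suc j) * (1 + \<rho> j) * Q T j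
      = (s (Suc j) / s j) * (a (Suc j) * ((1 + \<rho> j) * (\<Phi>2 (X j) - v2)))"
      using T by (simp add: Q_def)
    also have "\<dots> \<le> 1 * (\<alpha>max * ((1 + R) * (\<Phi>2 (X j) - v2)))"
      using pos s_ratio(2)[of j] a_le_\<alpha>max[of j] R[of j] params(5)
      by (intro mult_mono mult_right_mono add_left_mono) auto
    finally show ?thesis by (simp add: mult.assoc)
  qed
  ultimately show ?thesis unfolding U_def by linarith
qed

lemma last_visit_below:
  obtains j where "j \<le> k" "\<Phi>1 (X j) < T" "\<And>i. j < i \<Longrightarrow> i \<le> k \<Longrightarrow> T \<le> \<Phi>1 (X i)"
  | "\<And>i. i \<le> k \<Longrightarrow> T \<le> \<Phi>1 (X i)"
proof (cases "\<exists>j\<le>k. \<Phi>1 (X j) < T")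
  case True
  define j where "j = (GREATEST j. j \<le> k \<and> \<Phi>1 (X j) < T)"
  have j: "j \<le> k \<and> \<Phi>1 (X j) < T"
    unfolding j_def
    by (rule GreatestI_ex_nat[where P = "\<lambda>j. j \<le> k \<and> \<Phi>1 (X j) < T" and b = k]) (use True in auto)
  have "T \<le> \<Phi>1 (X i)" if "j < i" "i \<le> k" for i
  proof (rule ccontr)
    assume "\<not> ?thesis"
    then have "i \<le> k \<and> \<Phi>1 (X i) < T" using that(2) by simp
    then have "i \<le> j"
      unfolding j_def
      by (rule Greatest_le_nat[where P = "\<lambda>j. j \<le> k \<and> \<Phi>1 (X j) < T" and b = k]) auto
    then show False using that(1) by simp
  qed
  then show ?thesis using that(1)[of j] j by blast
next
  case False
  then have "\<And>i. i \<le> k \<Longrightarrow> T \<le> \<Phi>1 (X i)" by force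
  then show ?thesis by (rule that(2))
qed

lemma \<Phi>2_X_le: "\<Phi>2 (X n) - v2 \<le> \<phi>bar (s 0) (X 0)"
proof -
  have "0 \<le> (\<Sum>k<n. (1 - \<nu>) / a (Suc k) * (\<delta> k)\<^sup>2)"
    using params a_pos by (intro sum_nonneg) (auto simp: less_imp_le)
  then have "\<phi>bar (s n) (X n) \<le> \<phi>bar (s 0) (X 0)" using descent_sum[of n] by linarith
  moreover have "0 \<le> s n * (\<Phi>1 (X n) - m1)" using \<Phi>1_ge[OF X_in_D] s_pos[of n] by simp
  ultimately show ?thesis by (simp add: \<phi>bar_def)
qed

lemma \<delta>_nonneg: "0 \<le> \<delta> n"
  by (simp add: \<delta>_def)

text \<open>With the optimal value as target, every iterate is compared either with the last one below the target,
  which lies in a bounded level set, or with the start.\<close>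

lemma X_bounded: "bounded (range X)"
proof -
  obtain u where u: "u \<in> S" using S_nonempty by auto
  obtain R where R: "\<And>n. \<rho> n \<le> R" "0 \<le> R" using \<rho>_bounded by blast
  obtain m where m: "\<And>n. \<delta> n \<le> \<delta> m"
    using nonneg_null_sequence_attains_max[OF \<delta>_nonneg \<delta>_tendsto_0] by blast
  define C where "C = \<phi>bar (s 0) (X 0)"
  obtain M where M: "\<And>x. x \<in> D \<Longrightarrow> \<Phi>1 x \<le> v1 \<Longrightarrow> \<Phi>2 x \<le> v2 + C \<Longrightarrow> norm (x - u) \<le> M"
  proof -
    obtain B where "{x \<in> D. \<Phi>1 x \<le> v1 \<and> \<Phi>2 x \<le> v2 + C} \<subseteq> ball u B"
      using level_set_bounded[of "v2 + C"] bounded_subset_ballD by blast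
    then have "norm (x - u) \<le> B" if "x \<in> D" "\<Phi>1 x \<le> v1" "\<Phi>2 x \<le> v2 + C" for x
      using that by (force simp: dist_norm norm_minus_commute)
    then show ?thesis using that by blast
  qed
  define W where "W = (M + \<delta> m)\<^sup>2 / 2 + (\<delta> m)\<^sup>2 / 4 + \<alpha>max * (1 + R) * C"
  have U_le: "U v1 u k \<le> max (U v1 u 0) W" for k
  proof (cases rule: last_visit_below[of k v1])
    case (1 j)
    have e: "\<Phi>2 (X j) - v2 \<le> C" unfolding C_def by (rule \<Phi>2_X_le)
    have "norm (X j - u) \<le> M" using 1 e by (intro M X_in_D) auto
    then have "norm (X (Suc j) - u) \<le> M + \<delta> m"
      using norm_triangle_ineq[of "X (Suc j) - X j" "X j - u"] m[of j] by (simp add: \<delta>_def)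
    then have "(norm (X (Suc j) - u))\<^sup>2 \<le> (M + \<delta> m)\<^sup>2" by (intro power_mono) auto
    moreover have "(\<delta> j)\<^sup>2 \<le> (\<delta> m)\<^sup>2" using m \<delta>_nonneg by (intro power_mono) auto
    moreover have "\<alpha>max * (1 + R) * (\<Phi>2 (X j) - v2) \<le> \<alpha>max * (1 + R) * C"
      using e R params by (intro mult_left_mono) auto
    ultimately have "U v1 u j \<le> W"
      using U_below_target[OF R(1) 1(2), of u] unfolding W_def by linarith
    moreover have "U v1 u k \<le> U v1 u j" using 1 by (intro U_excursion u) auto
    ultimately show ?thesis by simp
  next
    case 2
    have "U v1 u k \<le> U v1 u 0" using 2 by (intro U_excursion u) auto
    then show ?thesis by simp
  qed
  have "(norm (X (Suc k) - u))\<^sup>2 \<le> 2 * max (U v1 u 0) W" for k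
  proof -
    have "(norm (X (Suc k) - u))\<^sup>2 / 2 \<le> max (U v1 u 0) W"
      using U_ge[of k u v1] U_le[of k] by (rule order_trans)
    then show ?thesis by (simp only: pos_divide_le_eq zero_less_numeral mult.commute)
  qed
  then have "norm (X (Suc k) - u) \<le> sqrt (2 * max (U v1 u 0) W)" for k
    by (rule real_le_rsqrt)
  then have "dist u (X n) \<le> max (norm (X 0 - u)) (sqrt (2 * max (U v1 u 0) W))" for n
    by (cases n) (auto simp: dist_norm norm_minus_commute le_max_iff_disj)
  then show ?thesis by (auto simp: bounded_def)
qed

end

section \<open>Lower bound on the step sizes\<close>

text \<open>Convexity of \<open>f t - f s\<close>, in the form required by \<open>Lipschitz_grad_convex_summand\<close>.\<close>

lemma (in bilevel_problem) Bregman_mono: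
  assumes "s \<le> t"
  shows "f s w - f s z - grad (f s) z \<bullet> (w - z) \<le> f t w - f t z - grad (f t) z \<bullet> (w - z)"
proof -
  have "0 \<le> (t - s) * (f1 w - f1 z - grad f1 z \<bullet> (w - z))"
    using assms convex_loc_smooth_tangent[OF smooth(1), of z w] by simp
  then show ?thesis by (simp add: f_reg_def grad_f inner_add_left algebra_simps)
qed

context adaBiM_run
begin

lemma step_len_eq: "step_len x = \<delta>"
proof
  fix n
  have "int n + 1 = int (Suc n)" by simp
  then show "step_len x n = \<delta> n" unfolding step_len_def \<delta>_def X_def by presburger
qed

lemma max_step_attained:
  obtains k where "max_step x = \<delta> k" "\<And>n. \<delta> n \<le> \<delta> k"
proof -
  obtain k where k: "\<And>n. \<delta> n \<le> \<delta> k"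
    using nonneg_null_sequence_attains_max[OF \<delta>_nonneg \<delta>_tendsto_0] by blast
  then have "max_step x = \<delta> k"
    unfolding max_step_def step_len_eq by (intro cSup_eq_maximum) auto
  then show ?thesis using k that by blast
qed

lemma \<delta>_le_max_step: "\<delta> n \<le> max_step x"
  by (rule max_step_attained) simp

text \<open>The region \<open>V\<close> contains a ball of radius \<open>radius\<close> around every point of the convex hull of the iterates. The
  value of the radius is that of \<open>prox_step_path\<close> for step sizes with ratio \<open>1 / \<eta>\<close>.\<close>

definition V :: "'a set" where "V = iter_region \<eta> x"
definition radius :: real where "radius = (1 - \<eta>) / \<eta> * max_step x"

lemma V_eq: "V = (\<Union>u\<in>convex hull (range X). \<Union>v\<in>cball 0 radius. {u + v})"
  unfolding V_def iter_region_def radius_def X_def by blast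

lemma radius_nonneg: "0 \<le> radius"
  using params \<delta>_le_max_step[of 0] \<delta>_nonneg[of 0] by (simp add: radius_def)

lemma in_V:
  assumes "u \<in> convex hull (range X)" "norm (w - u) \<le> radius"
  shows "w \<in> V"
proof -
  have "w - u \<in> cball 0 radius" using assms(2) by simp
  then have "u + (w - u) \<in> V" unfolding V_eq using assms(1) by blast
  then show ?thesis by simp
qed

lemma X_in_hull: "X n \<in> convex hull (range X)"
  by (rule hull_inc) simp

lemma X_in_V: "X n \<in> V"
  using in_V[OF X_in_hull[of n], of "X n"] radius_nonneg by simp

lemma V_convex: "convex V"
  unfolding V_eq by (intro convex_sums convex_convex_hull convex_cball)

lemma V_bounded: "bounded V"
  unfolding V_eq by (intro bounded_sums bounded_convex_hull X_bounded bounded_cball)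

lemma valid_modulus_exists: obtains L where "valid_modulus (f (s 0)) \<eta> \<alpha>max x L"
proof -
  have "locally_Lipschitz (grad (f (s 0)))" using smooth_s[of 0] by (simp add: convex_loc_smooth_def)
  moreover have "compact (closure V)" using V_bounded by (simp add: compact_closure)
  ultimately obtain L where L: "L-lipschitz_on (closure V) (grad (f (s 0)))"
    by (rule locally_Lipschitz_compact)
  (* a modulus may be enlarged until it meets the two normalizations *)
  define M where "M = max L (max (Lip_est (f (s 0)) (x (-1)) (x 0)) (1 / \<alpha>max))"
  have "M-lipschitz_on V (grad (f (s 0)))"
    using L closure_subset by (rule lipschitz_on_mono) (simp add: M_def)
  then have "valid_modulus (f (s 0)) \<eta> \<alpha>max x M"
    unfolding valid_modulus_def V_def[symmetric] by (auto simp: M_def max_def)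
  then show ?thesis by (rule that)
qed

context
  fixes L assumes valid: "valid_modulus (f (s 0)) \<eta> \<alpha>max x L"
begin

lemma modulus: "L-lipschitz_on V (grad (f (s 0)))" "L_init \<le> L" "1 / \<alpha>max \<le> L" "0 < L"
proof -
  have "X 0 = x 0" by (simp add: X_def)
  then show "L-lipschitz_on V (grad (f (s 0)))" "L_init \<le> L" "1 / \<alpha>max \<le> L"
    using valid by (auto simp: valid_modulus_def V_def)
  moreover have "0 < 1 / \<alpha>max" using params by simp
  ultimately show "0 < L" by linarith
qed

text \<open>If the points differ, then the radius is positive, and the segment between them has a
  neighbourhood inside \<open>V\<close>.\<close>

lemma Lk_le: "Lk n \<le> L"
proof (cases "X n = X (Suc n)")
  case True
  then show ?thesis using modulus(4) by (simp add: Lk_def Lip_est_def)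
next
  case False
  then have "0 < \<delta> n" by (simp add: \<delta>_def)
  then have "0 < max_step x" using \<delta>_le_max_step[of n] by linarith
  then have "0 < radius" using params by (simp add: radius_def)
  have "norm (grad (f (s (Suc n))) (X n) - grad (f (s (Suc n))) (X (Suc n))) \<le> L * norm (X n - X (Suc n))"
  proof (rule Lipschitz_grad_convex_summand[OF _ modulus(1,4) V_convex smooth_s _ \<open>0 < radius\<close>])
    show "f (s 0) differentiable (at p)" for p
      using smooth_s[of 0] by (simp add: convex_loc_smooth_def)
    show "f (s (Suc n)) w - f (s (Suc n)) z - grad (f (s (Suc n))) z \<bullet> (w - z)
      \<le> f (s 0) w - f (s 0) z - grad (f (s 0)) z \<bullet> (w - z)" for z w
      by (rule Bregman_mono[OF s_le_s0])
    show "cball p radius \<subseteq> V" if "p \<in> closed_segment (X n) (X (Suc n))" for p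
    proof -
      have "p \<in> convex hull (range X)"
        using that closed_segment_subset[OF X_in_hull X_in_hull convex_convex_hull] by blast
      then show ?thesis by (auto intro!: in_V simp: dist_norm norm_minus_commute)
    qed
  qed
  then show ?thesis using False by (simp add: Lk_def Lip_est_def divide_le_eq)
qed

text \<open>The rejected trial point still lies in \<open>V\<close>, so its local estimate is at most \<open>L\<close>, and a step size that is
  rejected there exceeds \<open>\<nu> / L\<close>.\<close>

lemma backtracked_step_ge:
  assumes "a (Suc n) \<noteq> cap n"
  shows "\<eta> * \<nu> / L \<le> a (Suc n)"
proof (rule backtracking[OF cap_pos[of n]])
  let ?b = "a (Suc n) / \<eta>"
  let ?y = "step n ?b"
  assume rej: "\<nu> < ?b * ell_est (f (s (Suc n))) (X n) ?y"
  have pos: "0 < a (Suc n)" "0 < ?b" using a_pos params by auto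
  have "a (Suc n) \<le> ?b" using pos params by (simp add: field_simps)
  then have "norm (?y - X (Suc n)) \<le> (?b / a (Suc n) - 1) * norm (X n - X (Suc n))"
    unfolding iteration(4)[of n] unfolding step_def
    by (rule prox_step_path[OF s_pos a_pos])
  also have "\<dots> = (1 - \<eta>) / \<eta> * \<delta> n"
    using pos params by (simp add: \<delta>_def norm_minus_commute field_simps)
  also have "\<dots> \<le> radius"
    unfolding radius_def using \<delta>_le_max_step params by (intro mult_left_mono) auto
  finally have y: "?y \<in> V" by (rule in_V[OF X_in_hull])
  have "ell_est (f (s (Suc n))) (X n) ?y \<le> ell_est (f (s 0)) (X n) ?y"
    by (rule ell_est_mono[OF s_le_s0])
  also have "\<dots> \<le> Lip_est (f (s 0)) (X n) ?y" by (rule ell_est_le_Lip_est)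
  also have "\<dots> \<le> L"
    using lipschitz_onD[OF modulus(1) X_in_V y, of n] modulus(4) by (simp add: Lip_est_def dist_norm divide_le_eq)
  finally have "?b * ell_est (f (s (Suc n))) (X n) ?y \<le> ?b * L" using pos by (intro mult_left_mono) auto
  then have "\<nu> < ?b * L" using rej by linarith
  then show ?thesis using params modulus(4) by (simp add: field_simps)
qed (use assms in simp)

abbreviation "amin \<equiv> alpha_min \<eta> \<nu> L"

lemma sqrt3_half:
  assumes "3 / 4 \<le> q"
  shows "sqrt 3 / 2 \<le> sqrt q"
proof -
  have "sqrt (3 / 4) \<le> sqrt q" using assms by (rule real_sqrt_le_mono)
  then show ?thesis by (simp add: real_sqrt_divide)
qed

lemma amin_bounds:
  "0 < amin" "amin \<le> sqrt (1 - \<nu>) / (2 * L)" "amin \<le> sqrt 3 / 2 * (\<eta> * \<nu> / L)"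
  "amin \<le> sqrt 3 / 2 * (1 / L)" "amin \<le> 1 / (2 * L)"
proof -
  have m: "amin \<le> 1 / (2 * L) * sqrt (1 - \<nu>)" "amin \<le> 1 / (2 * L) * (sqrt 3 * \<eta> * \<nu>)"
    unfolding alpha_min_def using modulus(4) by (intro mult_left_mono; simp)+
  show "0 < amin" unfolding alpha_min_def using modulus(4) params by (auto simp: min_def)
  show 1: "amin \<le> sqrt (1 - \<nu>) / (2 * L)" using m(1) by simp
  show 2: "amin \<le> sqrt 3 / 2 * (\<eta> * \<nu> / L)" using m(2) by (simp add: field_simps)
  have "sqrt (1 - \<nu>) \<le> 1" using params by simp
  then have "sqrt (1 - \<nu>) / (2 * L) \<le> 1 / (2 * L)" using modulus(4) by (intro divide_right_mono) auto
  then show "amin \<le> 1 / (2 * L)" using 1 by linarith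
  have "\<eta> * \<nu> \<le> 1" using params by (simp add: mult_le_one)
  then have "\<eta> * \<nu> / L \<le> 1 / L" using modulus(4) by (intro divide_right_mono) auto
  then have "sqrt 3 / 2 * (\<eta> * \<nu> / L) \<le> sqrt 3 / 2 * (1 / L)" by (intro mult_left_mono) auto
  then show "amin \<le> sqrt 3 / 2 * (1 / L)" using 2 by linarith
qed

text \<open>The prefactor \<open>\<sigma>\<^sub>k / \<sigma>\<^sub>k\<^sub>+\<^sub>1\<close> of the trial step size outweighs the factor \<open>sqrt (\<sigma>\<^sub>k\<^sub>+\<^sub>1 / \<sigma>\<^sub>k)\<close> of the
  induction invariant.\<close>

lemma ratio_scaling:
  assumes "0 < t" "t \<le> u" "0 \<le> c"
  shows "c \<le> u / t * c * sqrt (t / u)"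
proof -
  have "sqrt (t / u) * sqrt (t / u) = t / u" using assms by simp
  then have "u / t * sqrt (t / u) * sqrt (t / u) = u / t * (t / u)" by (simp only: mult.assoc)
  then have "u / t * sqrt (t / u) * sqrt (t / u) = 1" using assms by simp
  moreover have "0 < sqrt (t / u)" "sqrt (t / u) \<le> 1" using assms by auto
  ultimately have "1 \<le> u / t * sqrt (t / u)"
    using assms by (metis divide_nonneg_pos less_imp_le mult_left_le mult_nonneg_nonneg order_less_le_trans real_sqrt_ge_zero)
  from mult_right_mono[OF this \<open>0 \<le> c\<close>] show ?thesis by (simp add: mult_ac)
qed

lemma \<alpha>max_ge_amin: "amin \<le> \<alpha>max * sqrt (s (Suc n) / s n)"
proof -
  have "amin \<le> 1 / L * (sqrt 3 / 2)" using amin_bounds(4) by (simp add: mult.commute)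
  also have "\<dots> \<le> \<alpha>max * sqrt (s (Suc n) / s n)"
    using modulus(3,4) params(5) sqrt3_half[OF s_ratio(1)]
    by (intro mult_mono) (auto simp: field_simps)
  finally show ?thesis .
qed

text \<open>Dropping \<open>b * m\<close> under the root leaves \<open>b * l'\<close>, and the step size cancels.\<close>

lemma curvature_step_ge:
  assumes b: "0 < b" and d: "0 < b\<^sup>2 * l'\<^sup>2 - b * m" and m: "0 \<le> m" and l': "0 \<le> l'" "l' \<le> L"
  shows "1 / (2 * L) \<le> b / (2 * sqrt (b\<^sup>2 * l'\<^sup>2 - b * m))"
proof -
  have "sqrt (b\<^sup>2 * l'\<^sup>2 - b * m) \<le> sqrt ((b * l')\<^sup>2)"
    using b m by (intro real_sqrt_le_mono) (simp add: power_mult_distrib)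
  also have "\<dots> \<le> b * L" using b l' by (simp add: mult_left_mono)
  finally have "2 * sqrt (b\<^sup>2 * l'\<^sup>2 - b * m) \<le> 2 * (b * L)" by simp
  then have "b / (2 * (b * L)) \<le> b / (2 * sqrt (b\<^sup>2 * l'\<^sup>2 - b * m))"
    using b d modulus(4) by (intro divide_left_mono) auto
  then show ?thesis using b by simp
qed

lemma step_ge_if_cap_ge:
  assumes "amin \<le> cap n * sqrt (s (Suc n) / s n)"
  shows "amin \<le> a (Suc n) * sqrt (s (Suc n) / s n)"
proof (cases "a (Suc n) = cap n")
  case False
  have "amin \<le> \<eta> * \<nu> / L * (sqrt 3 / 2)" using amin_bounds(3) by (simp add: mult.commute)
  also have "\<dots> \<le> a (Suc n) * sqrt (s (Suc n) / s n)"
    using backtracked_step_ge[OF False] params modulus(4) sqrt3_half[OF s_ratio(1)] a_pos[of "Suc n"]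
    by (intro mult_mono) auto
  finally show ?thesis .
qed (use assms in simp)

text \<open>The start of the induction explains the choice of \<open>\<alpha>\<close> at index \<open>-1\<close>. Either \<open>\<alpha>\<^sub>0 \<ell>\<^sub>0 \<ge> 1/2\<close>, so that \<open>\<alpha>\<^sub>0\<close>
  is already large enough, or \<open>1 + \<rho>\<^sub>0 = 1 / (\<alpha>\<^sub>0 \<ell>\<^sub>0)\<^sup>2\<close>, and the first term of the minimum
  restores \<open>1 / \<ell>\<^sub>0\<close> no matter how small \<open>\<alpha>\<^sub>0\<close> was.\<close>

lemma cap_0_ge: "amin \<le> cap 0 * sqrt (s (Suc 0) / s 0)"
  using cap_0(3)
proof (elim disjE conjE)
  assume "cap 0 = \<alpha>max"
  then show ?thesis using \<alpha>max_ge_amin[of 0] by simp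
next
  assume a_init: "a_init \<noteq> 0" and c: "cap 0 = s 0 / s 1 * a 0 * sqrt (1 + a 0 / a_init)"
  have l_init: "l_init \<le> L" using ell_est_le_Lip_est modulus(2) by (rule order_trans)
  have "1 / (2 * L) \<le> a 0 * sqrt (1 + a 0 / a_init)"
  proof (cases "a 0 * l_init \<ge> 1 / 2")
    case True
    have "1 / 2 \<le> a 0 * L" using True mult_left_mono[OF l_init, of "a 0"] params(6) by linarith
    then have "1 / (2 * L) \<le> a 0 * 1" using modulus(4) by (simp add: field_simps)
    also have "\<dots> \<le> a 0 * sqrt (1 + a 0 / a_init)"
      using params(6) a_init_nonneg by (intro mult_left_mono) auto
    finally show ?thesis .
  next
    case False
    define u where "u = (a 0 * l_init)\<^sup>2"
    have a_init_small: "a_init = a 0 * (u / (1 - u))" using False by (simp add: a_init_eq u_def)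
    then have "u \<noteq> 0" "u \<noteq> 1" using a_init by auto
    then have "0 < a 0 * l_init" using params(6) l_init_nonneg by (auto simp: u_def)
    then have "0 < l_init" using params(6) by (simp add: zero_less_mult_iff)
    have "1 + a 0 / a_init = 1 / u" using \<open>u \<noteq> 0\<close> \<open>u \<noteq> 1\<close> params(6) unfolding a_init_small by (simp add: field_simps)
    then have "a 0 * sqrt (1 + a 0 / a_init) = a 0 * (1 / (a 0 * l_init))"
      using \<open>0 < a 0 * l_init\<close> by (simp add: real_sqrt_divide u_def)
    also have "\<dots> = 1 / l_init" using params(6) by simp
    finally have "a 0 * sqrt (1 + a 0 / a_init) = 1 / l_init" .
    moreover have "1 / (2 * L) \<le> 1 / l_init" using \<open>0 < l_init\<close> l_init modulus(4) by (intro divide_left_mono) auto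
    ultimately show ?thesis by simp
  qed
  also have "\<dots> \<le> s 0 / s (Suc 0) * (a 0 * sqrt (1 + a 0 / a_init)) * sqrt (s (Suc 0) / s 0)"
    using params(6) a_init_nonneg by (intro ratio_scaling s_pos s_Suc) auto
  finally show ?thesis using amin_bounds(5) by (simp add: c mult.assoc)
next
  assume d: "0 < d_init" and c: "cap 0 = s 0 / s 1 * a 0 * (1 / (2 * sqrt d_init))"
  have "1 / (2 * L) \<le> a 0 / (2 * sqrt d_init)"
    using curvature_step_ge[of "a 0" L_init l_init] d params(6) l_init_nonneg Lip_est_nonneg[of "f (s 0)" "x (-1)" "X 0"] modulus(2)
    by (simp add: d_init_def)
  also have "\<dots> \<le> s 0 / s (Suc 0) * (a 0 / (2 * sqrt d_init)) * sqrt (s (Suc 0) / s 0)"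
    using params(6) d by (intro ratio_scaling s_pos s_Suc) auto
  finally show ?thesis using amin_bounds(5) by (simp add: c)
qed

text \<open>The first term of the minimum reproduces the factor \<open>sqrt (s (Suc n) / s n)\<close> of the invariant, which is why
  the invariant contains it.\<close>

lemma cap_Suc_ge:
  assumes IH: "amin \<le> a (Suc n) * sqrt (s (Suc n) / s n)"
  shows "amin \<le> cap (Suc n) * sqrt (s (Suc (Suc n)) / s (Suc n))"
  using cap_Suc(5)[OF a_pos a_pos, of n]
proof (elim disjE conjE)
  assume "cap (Suc n) = \<alpha>max"
  then show ?thesis using \<alpha>max_ge_amin[of "Suc n"] by simp
next
  assume c: "cap (Suc n) = factor n * sqrt (s (Suc n) / s n * (1 + \<rho> n))"
  note pos = s_pos[of n] s_pos[of "Suc n"] a_pos[of "Suc n"] \<rho>_pos[of n]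
  have "sqrt (s (Suc n) / s n) \<le> sqrt (s (Suc n) / s n * (1 + \<rho> n))"
    using pos by (intro real_sqrt_le_mono) (simp add: distrib_left)
  then have "a (Suc n) * sqrt (s (Suc n) / s n) \<le> a (Suc n) * sqrt (s (Suc n) / s n * (1 + \<rho> n))"
    using pos by (intro mult_left_mono) auto
  also have "\<dots> \<le> s (Suc n) / s (Suc (Suc n)) * (a (Suc n) * sqrt (s (Suc n) / s n * (1 + \<rho> n)))
      * sqrt (s (Suc (Suc n)) / s (Suc n))"
    using pos by (intro ratio_scaling s_pos s_Suc) auto
  finally show ?thesis using IH by (simp add: c factor_def mult.assoc)
next
  assume d: "0 < d n" and c: "cap (Suc n) = factor n * (sqrt (damp n) / (2 * sqrt (d n)))"
  note pos = s_pos[of n] s_pos[of "Suc n"] a_pos[of "Suc n"]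
  have Lk: "0 \<le> Lk n" by (simp add: Lk_def Lip_est_nonneg)
  have "1 - \<nu> \<le> damp n" using damping_le[of n] pos by (simp add: damp_def)
  then have "sqrt (1 - \<nu>) * (1 / (2 * L)) \<le> sqrt (damp n) * (a (Suc n) / (2 * sqrt (d n)))"
    using curvature_step_ge[of "a (Suc n)" "Lk n" "l n"] d pos l_nonneg Lk Lk_le[of n] damp_bounds(1)[of n] modulus(4)
    by (intro mult_mono) (auto simp: d_def)
  also have "\<dots> \<le> s (Suc n) / s (Suc (Suc n)) * (sqrt (damp n) * (a (Suc n) / (2 * sqrt (d n))))
      * sqrt (s (Suc (Suc n)) / s (Suc n))"
    using pos d damp_bounds(1)[of n] by (intro ratio_scaling s_pos s_Suc) auto
  finally show ?thesis using amin_bounds(2) by (simp add: c factor_def mult_ac)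
qed

lemma a_ge_amin: "amin \<le> a (Suc n)"
proof -
  have "amin \<le> a (Suc n) * sqrt (s (Suc n) / s n)"
  proof (induction n)
    case 0
    show ?case by (intro step_ge_if_cap_ge cap_0_ge)
  next
    case (Suc n)
    then show ?case by (rule step_ge_if_cap_ge[OF cap_Suc_ge])
  qed
  also have "\<dots> \<le> a (Suc n) * 1"
    using a_pos[of "Suc n"] s_ratio(2)[of n] by (intro mult_left_mono) auto
  finally show ?thesis by simp
qed

end

end

section \<open>Convergence rates\<close>

lemma Min_le_average:
  fixes h :: "nat \<Rightarrow> real"
  assumes "(\<Sum>k\<le>K. h k) \<le> B"
  shows "Min (h ` {..K}) \<le> B / (1 + real K)"
proof -
  have "of_nat (card {..K}) * Min (h ` {..K}) \<le> sum h {..K}"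
    by (rule sum_bounded_below) (simp add: Min_le)
  then have "(1 + real K) * Min (h ` {..K}) \<le> B" using assms by simp
  then show ?thesis by (simp add: pos_le_divide_eq mult.commute add_pos_nonneg)
qed

lemma ext_dist_zero_power2_le:
  assumes "v \<in> E"
  shows "(ext_dist 0 E)\<^sup>2 \<le> ereal ((norm v)\<^sup>2)"
proof -
  have "0 \<le> ext_dist 0 E" unfolding ext_dist_def by (intro INF_greatest) simp
  moreover have "ext_dist 0 E \<le> ereal (norm v)"
    unfolding ext_dist_def using assms by (intro INF_lower2[of v]) simp_all
  ultimately obtain t where "ext_dist 0 E = ereal t" "0 \<le> t" "t \<le> norm v"
    by (cases "ext_dist 0 E") auto
  then show ?thesis by (simp add: power_mono)
qed

context adaBiM_run
begin

definition residual :: "nat \<Rightarrow> 'a" where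
  "residual n = (1 / a (Suc n)) *\<^sub>R (X n - X (Suc n))
     - (grad (f (s (Suc n))) (X n) - grad (f (s (Suc n))) (X (Suc n)))"

lemma residual_subdiff: "residual n \<in> subdiff (phi_reg f1 f2 g1 g2 (s (Suc n))) (X (Suc n))"
  unfolding residual_def iteration(4)[of n] step_def
  by (rule prox_step_residual(2)[OF s_pos a_pos])

lemma residual_ineq:
  "u \<in> D \<Longrightarrow> s (Suc n) * \<Phi>1 (X (Suc n)) + \<Phi>2 (X (Suc n)) + residual n \<bullet> (u - X (Suc n))
     \<le> s (Suc n) * \<Phi>1 u + \<Phi>2 u"
  unfolding residual_def iteration(4)[of n] step_def
  by (rule prox_step_residual(1)[OF s_pos a_pos])

lemma phi_bar_0: "phi_bar f1 f2 g1 g2 (s 0) (X 0) = ereal (\<phi>bar (s 0) (X 0))"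
  by (rule phi_bar_eq[OF X_in_D])

lemma step_rate:
  "ereal (Min ((\<lambda>k. (step_len x k)\<^sup>2) ` {..K}))
    \<le> ereal \<alpha>max * phi_bar f1 f2 g1 g2 (s 0) (X 0) / ereal ((1 - \<nu>) * (1 + real K))"
proof -
  have "(1 - \<nu>) * (1 + real K) \<noteq> 0" using params by simp
  moreover have "Min ((\<lambda>k. (\<delta> k)\<^sup>2) ` {..K}) \<le> \<alpha>max * (\<phi>bar (s 0) (X 0) / (1 - \<nu>)) / (1 + real K)"
    by (rule Min_le_average[OF \<delta>_sum_le])
  ultimately show ?thesis unfolding phi_bar_0 step_len_eq by simp
qed

context
  fixes L assumes valid: "valid_modulus (f (s 0)) \<eta> \<alpha>max x L"
begin

lemma residual_le: "norm (residual n) \<le> (1 + \<alpha>max * L) * (\<delta> n / a (Suc n))"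
proof -
  note pos = a_pos[of "Suc n"]
  have "norm (residual n) \<le> norm ((1 / a (Suc n)) *\<^sub>R (X n - X (Suc n)))
      + norm (grad (f (s (Suc n))) (X n) - grad (f (s (Suc n))) (X (Suc n)))"
    unfolding residual_def by (rule norm_triangle_ineq4)
  also have "norm (grad (f (s (Suc n))) (X n) - grad (f (s (Suc n))) (X (Suc n))) = Lk n * \<delta> n"
    unfolding Lip_est_mult[symmetric] Lk_def \<delta>_def by (simp add: norm_minus_commute)
  also have "norm ((1 / a (Suc n)) *\<^sub>R (X n - X (Suc n))) = \<delta> n / a (Suc n)"
    using pos by (simp add: \<delta>_def norm_minus_commute)
  also have "Lk n * \<delta> n \<le> L * \<delta> n"
    using Lk_le[OF valid] \<delta>_nonneg by (intro mult_right_mono) auto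
  also have "L * \<delta> n = (a (Suc n) * L) * (\<delta> n / a (Suc n))" using pos by simp
  also have "\<dots> \<le> (\<alpha>max * L) * (\<delta> n / a (Suc n))"
    using a_le_\<alpha>max[of n] modulus(4)[OF valid] \<delta>_nonneg[of n] pos by (intro mult_right_mono) auto
  finally show ?thesis by (simp only: distrib_right mult_1_left)
qed

lemma residual_sum_le:
  "(\<Sum>k\<le>K. (norm (residual k))\<^sup>2) \<le> (1 + \<alpha>max * L)\<^sup>2 / alpha_min \<eta> \<nu> L * (\<phi>bar (s 0) (X 0) / (1 - \<nu>))"
proof -
  define M where "M = 1 + \<alpha>max * L"
  define m where "m = alpha_min \<eta> \<nu> L"
  have "0 < m" unfolding m_def by (rule amin_bounds(1)[OF valid])
  have "(norm (residual k))\<^sup>2 \<le> M\<^sup>2 / m * ((\<delta> k)\<^sup>2 / a (Suc k))" for k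
  proof -
    have am: "m \<le> a (Suc k)" unfolding m_def by (rule a_ge_amin[OF valid])
    have "(norm (residual k))\<^sup>2 \<le> (M * (\<delta> k / a (Suc k)))\<^sup>2"
      unfolding M_def by (intro power_mono residual_le) auto
    also have "\<dots> = M\<^sup>2 / a (Suc k) * ((\<delta> k)\<^sup>2 / a (Suc k))"
      by (simp add: power_mult_distrib power_divide power2_eq_square)
    also have "\<dots> \<le> M\<^sup>2 / m * ((\<delta> k)\<^sup>2 / a (Suc k))"
      using am \<open>0 < m\<close> a_pos[of "Suc k"] by (intro mult_right_mono divide_left_mono) auto
    finally show ?thesis .
  qed
  then have "(\<Sum>k\<le>K. (norm (residual k))\<^sup>2) \<le> (\<Sum>k\<le>K. M\<^sup>2 / m * ((\<delta> k)\<^sup>2 / a (Suc k)))"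
    by (rule sum_mono)
  also have "\<dots> = M\<^sup>2 / m * (\<Sum>k\<le>K. (\<delta> k)\<^sup>2 / a (Suc k))" by (simp add: sum_distrib_left)
  also have "\<dots> \<le> M\<^sup>2 / m * (\<phi>bar (s 0) (X 0) / (1 - \<nu>))"
    using \<open>0 < m\<close> by (intro mult_left_mono descent_sum') auto
  finally show ?thesis unfolding M_def m_def .
qed

text \<open>The average of the squared residuals yields the bound with the factor \<open>1 / \<alpha>\<^sub>m\<^sub>i\<^sub>n\<close>; the hypothesis
  on \<open>\<alpha>max\<close> then allows the factor \<open>\<alpha>max / \<alpha>\<^sub>m\<^sub>i\<^sub>n\<close>.\<close>

lemma residual_rate:
  assumes "1 \<le> \<alpha>max"
  shows "Min ((\<lambda>k. (ext_dist 0 (subdiff (phi_reg f1 f2 g1 g2 (s (Suc k))) (X (Suc k))))\<^sup>2) ` {..K})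
    \<le> ereal (\<alpha>max / alpha_min \<eta> \<nu> L) *
       (ereal ((1 + \<alpha>max * L)\<^sup>2) * phi_bar f1 f2 g1 g2 (s 0) (X 0) / ereal ((1 - \<nu>) * (1 + real K)))"
proof -
  define C where "C = \<phi>bar (s 0) (X 0)"
  define M where "M = 1 + \<alpha>max * L"
  define m where "m = alpha_min \<eta> \<nu> L"
  have "0 < m" unfolding m_def by (rule amin_bounds(1)[OF valid])
  have "0 \<le> C" unfolding C_def by (rule \<phi>bar_X_nonneg)
  let ?h = "\<lambda>k. (norm (residual k))\<^sup>2"
  let ?e = "\<lambda>k. ext_dist 0 (subdiff (phi_reg f1 f2 g1 g2 (s (Suc k))) (X (Suc k)))"
  have "Min (?h ` {..K}) \<in> ?h ` {..K}" by (rule Min_in) auto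
  then obtain j where j: "j \<le> K" "?h j = Min (?h ` {..K})" by force
  have "Min ((\<lambda>k. (?e k)\<^sup>2) ` {..K}) \<le> (?e j)\<^sup>2" using j by (intro Min_le) auto
  also have "\<dots> \<le> ereal (?h j)"
    by (rule ext_dist_zero_power2_le[OF residual_subdiff])
  also have "?h j \<le> M\<^sup>2 / m * (C / (1 - \<nu>)) / (1 + real K)"
    unfolding j(2) M_def m_def C_def by (rule Min_le_average[OF residual_sum_le])
  also have "\<dots> \<le> \<alpha>max * (M\<^sup>2 / m * (C / (1 - \<nu>)) / (1 + real K))"
  proof -
    have "0 \<le> M\<^sup>2 / m * (C / (1 - \<nu>)) / (1 + real K)" using \<open>0 < m\<close> \<open>0 \<le> C\<close> params by simp
    from mult_right_mono[OF assms this] show ?thesis by simp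
  qed
  finally have "Min ((\<lambda>k. (?e k)\<^sup>2) ` {..K}) \<le> ereal (\<alpha>max * (M\<^sup>2 / m * (C / (1 - \<nu>)) / (1 + real K)))"
    by simp
  also have "\<dots> = ereal (\<alpha>max / m) * (ereal (M\<^sup>2) * ereal C / ereal ((1 - \<nu>) * (1 + real K)))"
  proof -
    have "(1 - \<nu>) * (1 + real K) \<noteq> 0" using params by simp
    then show ?thesis by simp
  qed
  finally show ?thesis unfolding phi_bar_0 M_def m_def C_def .
qed

end

end

section \<open>Convergence to the solution set\<close>

locale adaBiM_diminishing = adaBiM_run +
  assumes s_tendsto: "s \<longlonglongrightarrow> 0" and s_not_summable: "\<not> summable s"
begin

text \<open>Test the residual with a solution: the residual tends to zero with the step lengths, the iterates are
  bounded, and the weight \<open>s\<close> of the upper level vanishes, while \<open>\<Phi>1\<close> is bounded below.\<close>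

lemma \<Phi>2_tendsto: "(\<lambda>n. \<Phi>2 (X n)) \<longlonglongrightarrow> v2"
proof -
  obtain u where u: "u \<in> S" using S_nonempty by auto
  obtain L where valid: "valid_modulus (f (s 0)) \<eta> \<alpha>max x L" by (rule valid_modulus_exists)
  define m where "m = alpha_min \<eta> \<nu> L"
  have "0 < m" unfolding m_def by (rule amin_bounds(1)[OF valid])
  define M where "M = (1 + \<alpha>max * L) / m"
  obtain B where B: "\<And>n. norm (u - X n) \<le> B"
  proof -
    obtain B where "\<And>n. dist u (X n) \<le> B" using X_bounded[unfolded bounded_any_center[of _ u]] by auto
    then show ?thesis using that[of B] by (simp add: dist_norm)
  qed
  have LM: "0 \<le> 1 + \<alpha>max * L" using modulus(4)[OF valid] params by simp
  have upper: "\<Phi>2 (X (Suc n)) - v2 \<le> s (Suc n) * (v1 - m1) + M * \<delta> n * B" for n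
  proof -
    have am: "m \<le> a (Suc n)" unfolding m_def by (rule a_ge_amin[OF valid])
    have "norm (residual n) \<le> (1 + \<alpha>max * L) * (\<delta> n / a (Suc n))" by (rule residual_le[OF valid])
    also have "\<dots> \<le> (1 + \<alpha>max * L) * (\<delta> n / m)"
      using am \<open>0 < m\<close> a_pos[of "Suc n"] \<delta>_nonneg[of n] LM by (intro mult_left_mono divide_left_mono) auto
    finally have r: "norm (residual n) \<le> M * \<delta> n" by (simp add: M_def)
    have "- (residual n \<bullet> (u - X (Suc n))) \<le> norm (residual n) * norm (u - X (Suc n))"
      using norm_cauchy_schwarz[of "- residual n" "u - X (Suc n)"] by simp
    also have "\<dots> \<le> M * \<delta> n * B"
      using r B[of "Suc n"] by (intro mult_mono) (auto intro: order_trans[OF norm_ge_zero])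
    finally have "- (residual n \<bullet> (u - X (Suc n))) \<le> M * \<delta> n * B" .
    moreover have "s (Suc n) * m1 \<le> s (Suc n) * \<Phi>1 (X (Suc n))"
      using \<Phi>1_ge[OF X_in_D] s_pos[of "Suc n"] by (intro mult_left_mono) auto
    ultimately show ?thesis
      using residual_ineq[OF S_in_D[OF u], of n] S_value[OF u] by (simp add: algebra_simps)
  qed
  have "(\<lambda>n. s (Suc n) * (v1 - m1) + M * \<delta> n * B) \<longlonglongrightarrow> 0 * (v1 - m1) + M * 0 * B"
    by (intro tendsto_intros \<delta>_tendsto_0 LIMSEQ_Suc s_tendsto)
  then have lim: "(\<lambda>n. s (Suc n) * (v1 - m1) + M * \<delta> n * B) \<longlonglongrightarrow> 0" by simp
  have "(\<lambda>n. \<Phi>2 (X (Suc n)) - v2) \<longlonglongrightarrow> 0"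
  proof (rule tendsto_sandwich[OF _ _ tendsto_const lim])
    show "\<forall>\<^sub>F n in sequentially. 0 \<le> \<Phi>2 (X (Suc n)) - v2" using \<Phi>2_ge[OF X_in_D] by simp
    show "\<forall>\<^sub>F n in sequentially. \<Phi>2 (X (Suc n)) - v2 \<le> s (Suc n) * (v1 - m1) + M * \<delta> n * B"
      using upper by simp
  qed
  then have "(\<lambda>n. \<Phi>2 (X (Suc n))) \<longlonglongrightarrow> v2" by (rule LIM_zero_cancel)
  then show ?thesis by (rule LIMSEQ_imp_Suc)
qed

text \<open>Otherwise \<open>U\<close>, which is nonnegative, would eventually lose at least \<open>c * s n\<close> in every step, and \<open>s\<close>
  would be summable.\<close>

lemma \<Phi>1_frequently_below:
  assumes "v1 < T"
  shows "\<exists>j\<ge>N. \<Phi>1 (X j) < T"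
proof (rule ccontr)
  assume "\<not> ?thesis"
  then have above: "T \<le> \<Phi>1 (X j)" if "N \<le> j" for j using that by force
  obtain u where u: "u \<in> S" using S_nonempty by auto
  obtain L where valid: "valid_modulus (f (s 0)) \<eta> \<alpha>max x L" by (rule valid_modulus_exists)
  define m where "m = alpha_min \<eta> \<nu> L"
  have "0 < m" unfolding m_def by (rule amin_bounds(1)[OF valid])
  define c where "c = m * (T - v1)"
  have "0 < c" using \<open>0 < m\<close> assms by (simp add: c_def)
  have dec: "U T u (Suc n) + c * s (Suc (Suc n)) \<le> U T u n" if "N \<le> n" for n
  proof -
    have "m \<le> a (Suc (Suc n))" unfolding m_def by (rule a_ge_amin[OF valid])
    then have "s (Suc (Suc n)) * (m * (T - v1)) \<le> s (Suc (Suc n)) * (a (Suc (Suc n)) * (T - v1))"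
      using s_pos[of "Suc (Suc n)"] assms by (intro mult_left_mono mult_right_mono) auto
    then show ?thesis using U_decrease[OF u above[of "Suc n"]] that by (simp add: c_def mult_ac)
  qed
  have sum: "U T u (N + k) + (\<Sum>i<k. c * s (i + (N + 2))) \<le> U T u N" for k
  proof (induction k)
    case (Suc k)
    have "U T u (N + Suc k) + c * s (k + (N + 2)) \<le> U T u (N + k)"
      using dec[of "N + k"] by (simp add: add_ac)
    then show ?case using Suc by simp
  qed simp
  have nonneg: "0 \<le> U T u (N + k)" for k
    using U_ge[of "N + k" u T] by (rule order_trans[rotated]) simp
  have "(\<Sum>i<k. c * s (i + (N + 2))) \<le> U T u N" for k
    using sum[of k] nonneg[of k] by linarith
  moreover have "0 \<le> c * s (i + (N + 2))" for i
    using \<open>0 < c\<close> s_pos[of "i + (N + 2)"] by simp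
  ultimately have "summable (\<lambda>i. c * s (i + (N + 2)))"
    by (intro summableI_nonneg_bounded)
  then have "summable (\<lambda>i. s (i + (N + 2)))" using \<open>0 < c\<close> by (simp add: summable_cmult_iff)
  then show False using s_not_summable summable_iff_shift[of s "N + 2"] by simp
qed

text \<open>Given \<open>e\<close>, choose \<open>T\<close> so close to the optimal value that late iterates below \<open>T\<close> are within \<open>e / 4\<close> of the
  solution set. Each later iterate is compared with the last one below \<open>T\<close>, using \<open>U\<close> for a solution
  near the latter. There, the terms of \<open>U\<close> other than the squared distance are small,
  as they consist of a squared step length and a multiple of the lower-level excess.\<close>

lemma infdist_tendsto_0: "(\<lambda>n. infdist (X n) S) \<longlonglongrightarrow> 0"
proof -
  obtain R where R: "\<And>n. \<rho> n \<le> R" "0 \<le> R" using \<rho>_bounded by blast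
  obtain B where B: "\<And>n. norm (X n) \<le> B" using X_bounded by (auto simp: bounded_iff)
  have "\<forall>\<^sub>F n in sequentially. infdist (X n) S < e" if "0 < e" for e
  proof -
    obtain \<epsilon> where \<epsilon>: "0 < \<epsilon>"
      "\<And>x. x \<in> D \<Longrightarrow> norm x \<le> B \<Longrightarrow> \<Phi>1 x \<le> v1 + \<epsilon> \<Longrightarrow> \<Phi>2 x \<le> v2 + \<epsilon> \<Longrightarrow> infdist x S < e / 4"
      using near_optimal_imp_near_S[of "e / 4" B] \<open>0 < e\<close> by auto
    define T where "T = v1 + \<epsilon>"
    define c where "c = \<alpha>max * (1 + R)"
    have "0 < c" using R params by (simp add: c_def)
    have "(\<lambda>n. c * (\<Phi>2 (X n) - v2)) \<longlonglongrightarrow> c * (v2 - v2)"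
      by (intro tendsto_intros \<Phi>2_tendsto)
    then have "\<forall>\<^sub>F n in sequentially. c * (\<Phi>2 (X n) - v2) < e\<^sup>2 / 16"
      using \<open>0 < e\<close> by (intro order_tendstoD(2)) auto
    moreover have "\<forall>\<^sub>F n in sequentially. \<Phi>2 (X n) < v2 + \<epsilon>"
      using \<Phi>2_tendsto \<epsilon>(1) by (intro order_tendstoD(2)) auto
    moreover have "\<forall>\<^sub>F n in sequentially. \<delta> n < e / 4"
      using \<delta>_tendsto_0 \<open>0 < e\<close> by (intro order_tendstoD(2)) auto
    ultimately have "\<forall>\<^sub>F n in sequentially. c * (\<Phi>2 (X n) - v2) < e\<^sup>2 / 16 \<and> \<Phi>2 (X n) < v2 + \<epsilon> \<and> \<delta> n < e / 4"
      by eventually_elim auto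
    then obtain N where N: "\<And>n. N \<le> n \<Longrightarrow> c * (\<Phi>2 (X n) - v2) < e\<^sup>2 / 16"
      "\<And>n. N \<le> n \<Longrightarrow> \<Phi>2 (X n) < v2 + \<epsilon>" "\<And>n. N \<le> n \<Longrightarrow> \<delta> n < e / 4"
      by (auto simp: eventually_sequentially)
    obtain j0 where j0: "N \<le> j0" "\<Phi>1 (X j0) < T"
      using \<Phi>1_frequently_below[of T N] \<epsilon>(1) by (auto simp: T_def)
    have "infdist (X (Suc k)) S < e" if k: "j0 \<le> k" for k
    proof (cases rule: last_visit_below[of k T])
      case (1 j)
      have "j0 \<le> j" using 1(3)[of j0] j0(2) k by (meson not_le)
      then have "N \<le> j" using j0 by simp
      note Nj = N(1)[OF this] N(2)[OF this] N(3)[OF this]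
      have "infdist (X j) S < e / 4"
        using 1(2) Nj(2) B[of j] by (intro \<epsilon>(2) X_in_D) (auto simp: T_def)
      then obtain u where u: "u \<in> S" "dist (X j) u < e / 4"
      proof -
        have "Inf (dist (X j) ` S) < e / 4"
          using \<open>infdist (X j) S < e / 4\<close> S_nonempty by (simp add: infdist_notempty)
        then obtain t where "t \<in> dist (X j) ` S" "t < e / 4"
          using cInf_lessD[of "dist (X j) ` S" "e / 4"] S_nonempty by blast
        then show ?thesis using that by blast
      qed
      have "norm (X (Suc j) - u) \<le> e / 2"
        using norm_triangle_ineq[of "X (Suc j) - X j" "X j - u"] u(2) Nj(3) by (simp add: \<delta>_def dist_norm)
      then have "(norm (X (Suc j) - u))\<^sup>2 \<le> (e / 2)\<^sup>2" by (intro power_mono) auto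
      moreover have "(\<delta> j)\<^sup>2 \<le> (e / 4)\<^sup>2" using Nj(3) \<delta>_nonneg[of j] by (intro power_mono) auto
      moreover have "U T u k \<le> U T u j"
        using 1 \<epsilon>(1) by (intro U_excursion u) (auto simp: T_def)
      moreover have "(norm (X (Suc k) - u))\<^sup>2 / 2 \<le> U T u k" by (rule U_ge)
      moreover have "U T u j \<le> (norm (X (Suc j) - u))\<^sup>2 / 2 + (\<delta> j)\<^sup>2 / 4 + c * (\<Phi>2 (X j) - v2)"
        unfolding c_def by (rule U_below_target[OF R(1) 1(2)])
      (* the right-hand side is 13/64 times the square of e *)
      ultimately have "(norm (X (Suc k) - u))\<^sup>2 / 2 < (e / 2)\<^sup>2 / 2 + (e / 4)\<^sup>2 / 4 + e\<^sup>2 / 16"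
        using Nj(1) by linarith
      also have "\<dots> \<le> e\<^sup>2 / 2" by (simp add: power_divide)
      finally have "(norm (X (Suc k) - u))\<^sup>2 < e\<^sup>2" by simp
      then have "norm (X (Suc k) - u) < e" using \<open>0 < e\<close> by (auto intro: power2_less_imp_less)
      then show ?thesis using infdist_le[OF u(1), of "X (Suc k)"] by (simp add: dist_norm)
    next
      case 2
      then have "T \<le> \<Phi>1 (X j0)" using k by blast
      then show ?thesis using j0(2) by simp
    qed
    then have "infdist (X n) S < e" if "Suc j0 \<le> n" for n using that by (cases n) auto
    then show ?thesis unfolding eventually_sequentially by blast
  qed
  moreover have "\<forall>\<^sub>F n in sequentially. e < infdist (X n) S" if "e < 0" for e
    using that infdist_nonneg[of "X n" S for n] by (intro always_eventually allI) (rule less_le_trans)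
  ultimately show ?thesis by (intro order_tendstoI)
qed

end

theorem theorem2p4:
  fixes f1 f2 :: "'a::euclidean_space \<Rightarrow> real"
    and g1 g2 :: "'a \<Rightarrow> ereal"
    and \<eta> \<nu> \<alpha>max :: real
    and \<sigma> \<alpha> :: "int \<Rightarrow> real"
    and x :: "int \<Rightarrow> 'a"
  assumes "basic_assumption f1 f2 g1 g2"
    and "adaBiM f1 f2 g1 g2 \<eta> \<nu> \<alpha>max \<sigma> \<alpha> x"
    and "(\<lambda>k. \<sigma> (int k)) \<longlonglongrightarrow> 0"
    and "\<not> summable (\<lambda>k. \<sigma> (int k))"
  shows
    "((\<exists>k. step_len x k = max_step x) \<and> (\<forall>k. step_len x k \<le> max_step x)
        \<and> bounded (iter_region \<eta> x) \<and>
      (\<forall>L. valid_modulus (f_reg f1 f2 (\<sigma> 0)) \<eta> \<alpha>max x L \<longrightarrow>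
        (\<forall>k\<ge>1. \<alpha> k \<ge> alpha_min \<eta> \<nu> L)))
     \<and>
     (\<forall>K::nat. ereal (Min ((\<lambda>k. (step_len x k)\<^sup>2) ` {..K}))
        \<le> ereal \<alpha>max * phi_bar f1 f2 g1 g2 (\<sigma> 0) (x 0) / ereal ((1 - \<nu>) * (1 + real K)))
     \<and>
     (\<forall>L. valid_modulus (f_reg f1 f2 (\<sigma> 0)) \<eta> \<alpha>max x L \<and> 1 \<le> \<alpha>max \<longrightarrow>
        (\<forall>K::nat.
          Min ((\<lambda>k. (ext_dist 0 (subdiff (phi_reg f1 f2 g1 g2 (\<sigma> (int k + 1))) (x (int k + 1))))\<^sup>2) ` {..K})
          \<le> ereal (\<alpha>max / alpha_min \<eta> \<nu> L) *
             (ereal ((1 + \<alpha>max * L)\<^sup>2) * phi_bar f1 f2 g1 g2 (\<sigma> 0) (x 0)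
               / ereal ((1 - \<nu>) * (1 + real K)))))
     \<and>
     (bounded (range (\<lambda>k. x (int k))) \<and>
      (\<lambda>k. infdist (x (int k)) (bilevel_solutions f1 f2 g1 g2)) \<longlonglongrightarrow> 0)"
proof -
  interpret adaBiM_run f1 f2 g1 g2 \<eta> \<nu> \<alpha>max \<sigma> \<alpha> x
    using assms by unfold_locales
  have s_eq: "s = (\<lambda>k. \<sigma> (int k))" by (auto simp: s_def)
  interpret adaBiM_diminishing f1 f2 g1 g2 \<eta> \<nu> \<alpha>max \<sigma> \<alpha> x
    using assms by unfold_locales (simp_all add: s_eq)
  have zero: "s 0 = \<sigma> 0" "X 0 = x 0" by (simp_all add: s_def X_def)
  have Suc: "\<sigma> (int k + 1) = s (Suc k)" "x (int k + 1) = X (Suc k)" for k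
    by (simp_all add: s_def X_def add.commute)
  have X_eq: "(\<lambda>k. x (int k)) = X" by (auto simp: X_def)
  show ?thesis
  proof (intro conjI allI impI)
    obtain k where "max_step x = \<delta> k" using max_step_attained by blast
    then show "\<exists>k. step_len x k = max_step x" by (auto simp: step_len_eq)
    show "step_len x k \<le> max_step x" for k by (simp add: step_len_eq \<delta>_le_max_step)
    show "bounded (iter_region \<eta> x)" using V_bounded by (simp add: V_def)
    show "alpha_min \<eta> \<nu> L \<le> \<alpha> k"
      if valid: "valid_modulus (f_reg f1 f2 (\<sigma> 0)) \<eta> \<alpha>max x L" and "1 \<le> k" for L k
    proof -
      define n where "n = nat (k - 1)"
      have "k = int (Suc n)" using \<open>1 \<le> k\<close> by (simp add: n_def)
      then show ?thesis using a_ge_amin[OF valid[folded zero(1)], of n] by (simp add: a_def)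
    qed
    show "ereal (Min ((\<lambda>k. (step_len x k)\<^sup>2) ` {..K}))
        \<le> ereal \<alpha>max * phi_bar f1 f2 g1 g2 (\<sigma> 0) (x 0) / ereal ((1 - \<nu>) * (1 + real K))" for K
      using step_rate unfolding zero .
    show "Min ((\<lambda>k. (ext_dist 0 (subdiff (phi_reg f1 f2 g1 g2 (\<sigma> (int k + 1))) (x (int k + 1))))\<^sup>2) ` {..K})
          \<le> ereal (\<alpha>max / alpha_min \<eta> \<nu> L) *
             (ereal ((1 + \<alpha>max * L)\<^sup>2) * phi_bar f1 f2 g1 g2 (\<sigma> 0) (x 0)
               / ereal ((1 - \<nu>) * (1 + real K)))"
      if "valid_modulus (f_reg f1 f2 (\<sigma> 0)) \<eta> \<alpha>max x L \<and> 1 \<le> \<alpha>max" for L K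
      using residual_rate[of L K] that unfolding zero Suc by blast
    show "bounded (range (\<lambda>k. x (int k)))" unfolding X_eq by (rule X_bounded)
    show "(\<lambda>k. infdist (x (int k)) (bilevel_solutions f1 f2 g1 g2)) \<longlonglongrightarrow> 0"
      using infdist_tendsto_0 by (simp add: X_def)
  qed
qed

end
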